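(* Let $\kappa_c := \beta\sigma^2+\sigma^4/2$. For every interaction parameter $\kappa>\kappa_c$, there exist non-uniform stationary solutions of the Kuramoto mean field game with interaction parameter $\kappa$.
   Context: Fixed constants $\beta>0$ (discount), $\sigma>0$ (noise), and the interaction parameter $\kappa>0$. State space: the torus $\mathbb T=\mathbb R/(2\pi\mathbb Z)$; $\mathcal P(\mathbb T)$ is the set of Borel probability measures on $\mathbb T$; $\nu(f)=\int_{\mathbb T} f\,d\nu$; $U(dx)=dx/(2\pi)$ is the uniform measure. A filtered probability space satisfying the usual conditions is fixed, carrying a Brownian motion $B$ adapted to the filtration, with $\mathcal F_0$ rich enough that every $\mu_0\in\mathcal P(\mathbb T)$ is the law of some $\mathcal F_0$-measurable $\mathbb T$-valued $X_0$. $\mathcal A$ is the set of real-valued progressively measurable processes $\alpha=(\alpha_t)_{t\ge0}$. Given a flow $\boldsymbol\mu=(\mu_t)_{t\ge0}$ in $\mathcal P(\mathbb T)$, set $\ell_{\boldsymbol\mu}(t,x)=-\kappa\mu_t(\cos)\cos(x)-\kappa\mu_t(\sin)\sin(x)$ and $$J_{\boldsymbol\mu,\kappa}(\alpha)=\mathbb E\int_0^\infty e^{-\beta t}\Big(\ell_{\boldsymbol\mu}(t,X^\alpha_t)+\tfrac12\alpha_t^2\Big)dt,\qquad X^\alpha_t=X_0+\int_0^t\alpha_u\,du+\sigma B_t,$$ where $X_0$ has law $\mu_0$. The flow $\boldsymbol\mu$ is a solution of the Kuramoto mean field game with interaction parameter $\kappa$ starting from $\mu_0$ if there is $\alpha^*\in\mathcal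 A$ with $J_{\boldsymbol\mu,\kappa}(\alpha^* )=\inf_{\alpha\in\mathcal A}J_{\boldsymbol\mu,\kappa}(\alpha)$ and $\mu_t$ is the law of $X^{\alpha^*}_t$ on $\mathbb T$ for all $t\ge0$. $\mu\in\mathcal P(\mathbb T)$ is a stationary solution if the constant flow $\mu_t=\mu$, $t\ge0$, is a solution; it is non-uniform if $\mu\ne U$. *)

theory Defs
  imports "HOL-Probability.Probability"
begin

section \<open>The torus $R/(2 \pi Z)$\<close>

quotient_type torus = real / "\<lambda>x y. \<exists>k::int. x - y = 2 * pi * of_int k"
  morphisms rep_torus to_torus
proof (rule equivpI)
  show "reflp (\<lambda>x y. \<exists>k::int. x - y = 2 * pi * of_int k)"
    by (rule reflpI) (rule exI[of _ 0], simp)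
  show "symp (\<lambda>x y. \<exists>k::int. x - y = 2 * pi * of_int k)"
  proof (rule sympI)
    fix x y :: real
    assume "\<exists>k::int. x - y = 2 * pi * of_int k"
    then obtain k :: int where "x - y = 2 * pi * of_int k" ..
    then have "y - x = 2 * pi * of_int (- k)" by simp
    then show "\<exists>k::int. y - x = 2 * pi * of_int k" ..
  qed
  show "transp (\<lambda>x y. \<exists>k::int. x - y = 2 * pi * of_int k)"
  proof (rule transpI)
    fix x y z :: real
    assume "\<exists>k::int. x - y = 2 * pi * of_int k" "\<exists>k::int. y - z = 2 * pi * of_int k"
    then obtain k l :: int where "x - y = 2 * pi * of_int k" "y - z = 2 * pi * of_int l"
      by blast
    then have "x - z = 2 * pi * of_int (k + l)" by (simp add: algebra_simps)
    then show "\<exists>k::int. x - z = 2 * pi * of_int k" ..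
  qed
qed

instantiation torus :: ab_group_add
begin

lift_definition zero_torus :: torus is 0 .

lift_definition plus_torus :: "torus \<Rightarrow> torus \<Rightarrow> torus" is "(+)"
proof -
  fix x x' y y' :: real
  assume "\<exists>k::int. x - x' = 2 * pi * of_int k" "\<exists>k::int. y - y' = 2 * pi * of_int k"
  then obtain k l :: int where "x - x' = 2 * pi * of_int k" "y - y' = 2 * pi * of_int l"
    by blast
  then have "(x + y) - (x' + y') = 2 * pi * of_int (k + l)" by (simp add: algebra_simps)
  then show "\<exists>k::int. (x + y) - (x' + y') = 2 * pi * of_int k" ..
qed

lift_definition uminus_torus :: "torus \<Rightarrow> torus" is uminus
proof -
  fix x y :: real
  assume "\<exists>k::int. x - y = 2 * pi * of_int k"
  then obtain k :: int where "x - y = 2 * pi * of_int k" ..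
  then have "- x - - y = 2 * pi * of_int (- k)" by simp
  then show "\<exists>k::int. - x - - y = 2 * pi * of_int k" ..
qed

definition minus_torus :: "torus \<Rightarrow> torus \<Rightarrow> torus" where
  "minus_torus x y = x + - y"

instance
proof
  fix a b c :: torus
  show "a + b + c = a + (b + c)" by transfer (rule exI[of _ 0], simp)
  show "a + b = b + a" by transfer (rule exI[of _ 0], simp)
  show "0 + a = a" by transfer (rule exI[of _ 0], simp)
  show "- a + a = 0" by transfer (rule exI[of _ 0], simp)
  show "a - b = a + - b" by (rule minus_torus_def)
qed

end

text \<open>The quotient topology; \<open>borel :: torus measure\<close> is the Borel sigma-algebra of the torus.\<close>

instantiation torus :: topological_space
begin

definition open_torus :: "torus set \<Rightarrow> bool" where
  "open_torus S \<longleftrightarrow> open (to_torus -` S)"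

instance
proof
  show "open (UNIV :: torus set)" by (simp add: open_torus_def)
  show "open (S \<inter> T)" if "open S" "open T" for S T :: "torus set"
    using that by (simp add: open_torus_def vimage_Int open_Int)
  show "open (\<Union>K)" if "\<forall>S\<in>K. open S" for K :: "torus set set"
    using that by (auto simp: open_torus_def vimage_Union)
qed

end

lift_definition cos_torus :: "torus \<Rightarrow> real" is cos
proof -
  fix x y :: real
  assume "\<exists>k::int. x - y = 2 * pi * of_int k"
  then obtain k :: int where "x = y + 2 * pi * of_int k" by (auto simp: algebra_simps)
  then show "cos x = cos y" by (simp add: cos_add cos_int_2pin sin_int_2pin)
qed

lift_definition sin_torus :: "torus \<Rightarrow> real" is sin
proof -
  fix x y :: real
  assume "\<exists>k::int. x - y = 2 * pi * of_int k"
  then obtain k :: int where "x = y + 2 * pi * of_int k" by (auto simp: algebra_simps)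
  then show "sin x = sin y" by (simp add: sin_add cos_int_2pin sin_int_2pin)
qed

definition torus_probs :: "torus measure set" where
  "torus_probs = {\<nu>. prob_space \<nu> \<and> sets \<nu> = sets borel}"

definition uniform_torus :: "torus measure" where
  "uniform_torus = distr (uniform_measure lborel {0..<2 * pi}) borel to_torus"

section \<open>The probabilistic basis\<close>

text \<open>Time is real, but only \<open>t \<ge> 0\<close> matters: no condition involves \<open>B\<close>, controls or flows at
  negative times, and a filtration on $[0,\infty)$ is the same as one here with \<open>F t = F 0\<close> for
  \<open>t < 0\<close>.  The Brownian motion is one relative to \<open>F\<close>: its increments after \<open>s\<close> are
  independent of \<open>F s\<close>.\<close>

locale brownian_basis = prob_space M + complete_measure M + filtration "space M" F
  for M :: "'w measure" and F :: "real \<Rightarrow> 'w measure" +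
  fixes B :: "real \<Rightarrow> 'w \<Rightarrow> real"
  assumes sub_F: "\<And>t. 0 \<le> t \<Longrightarrow> subalgebra M (F t)"
    and null_sets_F0: "null_sets M \<subseteq> sets (F 0)"
    and right_continuous_F: "\<And>t. 0 \<le> t \<Longrightarrow> sets (F t) = (\<Inter>s\<in>{t<..}. sets (F s))"
    and F0_rich: "\<And>\<nu>. \<nu> \<in> torus_probs \<Longrightarrow>
      \<exists>X0 :: 'w \<Rightarrow> torus. X0 \<in> F 0 \<rightarrow>\<^sub>M borel \<and> distr M borel X0 = \<nu>"
    and B_adapted: "\<And>t. 0 \<le> t \<Longrightarrow> B t \<in> F t \<rightarrow>\<^sub>M borel"
    and B_zero: "AE \<omega> in M. B 0 \<omega> = 0"
    and B_continuous: "AE \<omega> in M. continuous_on {0..} (\<lambda>t. B t \<omega>)"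
    and B_normal: "\<And>s t. 0 \<le> s \<Longrightarrow> s < t \<Longrightarrow>
      distributed M lborel (\<lambda>\<omega>. B t \<omega> - B s \<omega>) (normal_density 0 (sqrt (t - s)))"
    and B_indep: "\<And>s t. 0 \<le> s \<Longrightarrow> s < t \<Longrightarrow>
      indep_set (sets (F s)) (sets (vimage_algebra (space M) (\<lambda>\<omega>. B t \<omega> - B s \<omega>) borel))"

definition progressive :: "(real \<Rightarrow> 'w measure) \<Rightarrow> (real \<Rightarrow> 'w \<Rightarrow> real) \<Rightarrow> bool" where
  "progressive F \<alpha> \<longleftrightarrow>
    (\<forall>T\<ge>0. (\<lambda>(t, \<omega>). \<alpha> t \<omega>) \<in> (restrict_space borel {0..T} \<Otimes>\<^sub>M F T) \<rightarrow>\<^sub>M borel)"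

section \<open>The Kuramoto mean field game\<close>

text \<open>The extended-real integral: integral of the positive part minus integral of the negative
  part (\<open>e2ennreal\<close> sends negative numbers to 0).  It is meant for integrands one of whose two
  parts has finite integral.\<close>

definition ereal_integral :: "'a measure \<Rightarrow> ('a \<Rightarrow> ereal) \<Rightarrow> ereal" where
  "ereal_integral N f =
    enn2ereal (\<integral>\<^sup>+ x. e2ennreal (f x) \<partial>N) - enn2ereal (\<integral>\<^sup>+ x. e2ennreal (- f x) \<partial>N)"

text \<open>Where \<open>\<alpha>\<close> is not integrable on \<open>{0..t}\<close>, the integral below is 0 by convention.  This does
  not matter for the game: \<open>\<alpha>\<close> is then not square integrable on \<open>{0..t}\<close> either, so the running
  cost of that path is infinite.\<close>

definition state ::
  "real \<Rightarrow> (real \<Rightarrow> 'w \<Rightarrow> real) \<Rightarrow> ('w \<Rightarrow> torus) \<Rightarrow> (real \<Rightarrow> 'w \<Rightarrow> real) \<Rightarrow> real \<Rightarrow> 'w \<Rightarrow> torus"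
  where
  "state \<sigma> B X0 \<alpha> t \<omega> = X0 \<omega> + to_torus ((LINT u:{0..t}|lborel. \<alpha> u \<omega>) + \<sigma> * B t \<omega>)"

definition kuramoto_cost :: "real \<Rightarrow> (real \<Rightarrow> torus measure) \<Rightarrow> real \<Rightarrow> torus \<Rightarrow> real" where
  "kuramoto_cost \<kappa> \<mu> t x =
    - \<kappa> * (\<integral>y. cos_torus y \<partial>\<mu> t) * cos_torus x - \<kappa> * (\<integral>y. sin_torus y \<partial>\<mu> t) * sin_torus x"

text \<open>The integrand is at least \<open>- 2 * \<bar>\<kappa>\<bar> * exp (- \<beta> * t)\<close>, so both integrals
  are well defined with values in $(-\infty,\infty]$.\<close>

definition total_cost ::
  "real \<Rightarrow> real \<Rightarrow> 'w measure \<Rightarrow> (real \<Rightarrow> 'w \<Rightarrow> real) \<Rightarrow> real \<Rightarrow> (real \<Rightarrow> torus measure) \<Rightarrow>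
    ('w \<Rightarrow> torus) \<Rightarrow> (real \<Rightarrow> 'w \<Rightarrow> real) \<Rightarrow> ereal"
  where
  "total_cost \<beta> \<sigma> M B \<kappa> \<mu> X0 \<alpha> =
    ereal_integral M (\<lambda>\<omega>. ereal_integral (restrict_space lborel {0..}) (\<lambda>t.
      ereal (exp (- \<beta> * t) *
        (kuramoto_cost \<kappa> \<mu> t (state \<sigma> B X0 \<alpha> t \<omega>) + (\<alpha> t \<omega>)\<^sup>2 / 2))))"

text \<open>A flow is a solution irrespective of the choice of the initial state \<open>X0\<close> with law
  \<open>\<mu> 0\<close>; at least one such \<open>X0\<close> exists by \<open>F0_rich\<close>.\<close>

definition kuramoto_solution ::
  "real \<Rightarrow> real \<Rightarrow> 'w measure \<Rightarrow> (real \<Rightarrow> 'w measure) \<Rightarrow> (real \<Rightarrow> 'w \<Rightarrow> real) \<Rightarrow> real \<Rightarrow>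
    (real \<Rightarrow> torus measure) \<Rightarrow> bool"
  where
  "kuramoto_solution \<beta> \<sigma> M F B \<kappa> \<mu> \<longleftrightarrow>
    (\<forall>t\<ge>0. \<mu> t \<in> torus_probs) \<and>
    (\<forall>X0. X0 \<in> F 0 \<rightarrow>\<^sub>M borel \<and> distr M borel X0 = \<mu> 0 \<longrightarrow>
      (\<exists>\<alpha>. progressive F \<alpha> \<and>
        total_cost \<beta> \<sigma> M B \<kappa> \<mu> X0 \<alpha> =
          (INF \<alpha>'\<in>{\<alpha>'. progressive F \<alpha>'}. total_cost \<beta> \<sigma> M B \<kappa> \<mu> X0 \<alpha>') \<and>
        (\<forall>t\<ge>0. distr M borel (state \<sigma> B X0 \<alpha> t) = \<mu> t)))"

definition stationary_solution ::
  "real \<Rightarrow> real \<Rightarrow> 'w measure \<Rightarrow> (real \<Rightarrow> 'w measure) \<Rightarrow> (real \<Rightarrow> 'w \<Rightarrow> real) \<Rightarrow> real \<Rightarrow>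
    torus measure \<Rightarrow> bool"
  where
  "stationary_solution \<beta> \<sigma> M F B \<kappa> \<mu> \<longleftrightarrow> kuramoto_solution \<beta> \<sigma> M F B \<kappa> (\<lambda>t. \<mu>)"

definition critical_kappa :: "real \<Rightarrow> real \<Rightarrow> real" where
  "critical_kappa \<beta> \<sigma> = \<beta> * \<sigma>\<^sup>2 + \<sigma> ^ 4 / 2"

end

theory Submission
  imports Defs
begin

text \<open>For \<open>\<gamma> > 0\<close> let \<open>v\<close> be the periodic solution of
  \<open>\<beta> v = \<sigma>\<^sup>2/2 v'' - v'\<^sup>2/2 - \<gamma> cos x\<close>, the value function for the running cost
  \<open>- \<gamma> cos x + a\<^sup>2/2\<close>; it is found by shooting. The optimal feedback \<open>- v'\<close> has the invariant density
  proportional to \<open>exp (- 2 v / \<sigma>\<^sup>2)\<close>, and the invariant law \<open>\<mu>\<close> is a stationary solution as soon as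
  \<open>\<gamma> = \<kappa> \<mu>(cos)\<close>. For small \<open>\<gamma>\<close> one has
  \<open>v \<approx> - \<gamma> cos x / (\<beta> + \<sigma>\<^sup>2/2)\<close> and hence \<open>\<mu>(cos) \<approx> \<gamma> / \<kappa>\<^sub>c\<close>, so
  \<open>\<kappa> \<mu>(cos) > \<gamma>\<close> if \<open>\<kappa> > \<kappa>\<^sub>c\<close>, while \<open>\<kappa> \<mu>(cos) \<le> \<gamma>\<close> at
  \<open>\<gamma> = \<kappa>\<close>; the intermediate value theorem gives a self-consistent \<open>\<gamma> > 0\<close>.

  No stochastic integral is needed. The noise is additive, so the state equation is solved path by path; the expectation
  of Ito's formula follows by summing one-step Taylor estimates over a partition; and the invariance of \<open>\<mu>\<close> follows
  because one Euler step of length \<open>h\<close> changes \<open>\<mu>(f)\<close> by at most \<open>O(h\<^sup>3\<^sup>/\<^sup>2)\<close>.\<close>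

section \<open>Ordinary differential equations\<close>

text \<open>Several obstacles shape the argument. The quadratic gradient term rules out a direct
  global existence theorem for the equation of \<open>v\<close>; it is replaced by a Lipschitz
  truncation, and an a priori bound on the slope shows afterwards that the truncation is inactive.
  Periodicity is a condition on value and slope; since the cost is even, it follows from vanishing
  slope at 0 and at \<open>pi\<close>, which leaves one parameter to shoot with. The dependence of
  \<open>v\<close> on \<open>\<gamma>\<close> is controlled by the maximum principle: two solutions
  differ by at most the difference of the costs divided by \<open>\<beta>\<close>. This single
  estimate yields continuity in \<open>\<gamma>\<close>, the error of the expansion for small
  \<open>\<gamma>\<close>, and the evenness of \<open>v\<close>, which makes the mean of the sine
  vanish. On the stochastic side a competing control is only progressively measurable, and all that
  a finite cost provides is a bound on its discounted energy; the errors in the formula of Ito are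
  therefore bounded by the energy and by moments of the noise, while controls of infinite discounted
  energy have infinite cost.\<close>

lemma antiderivative_UNIV:
  fixes g :: "real \<Rightarrow> 'a::euclidean_space"
  assumes "continuous_on UNIV g"
  obtains G where "G 0 = 0" "\<And>t. (G has_vector_derivative g t) (at t)"
proof (rule that[of "\<lambda>t. LBINT s=ereal 0..ereal t. g s"])
  let ?G = "\<lambda>t. LBINT s=ereal 0..ereal t. g s"
  show "?G 0 = 0" by simp
  fix t :: real
  let ?r = "\<bar>t\<bar> + 1"
  have "(?G has_vector_derivative g t) (at t within {-?r..?r})"
    by (rule interval_integral_FTC2) (auto intro: continuous_on_subset[OF assms])
  then show "(?G has_vector_derivative g t) (at t)"
    by (subst (asm) at_within_interior) auto
qed

text \<open>Integrating a bound \<open>C * exp (l * |t|)\<close> gains a factor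
  \<open>1 / l\<close>. With a large rate \<open>l\<close> this gain beats any Lipschitz constant,
  which makes the Picard map in \<open>ode_exists\<close> contract on the whole line at once.
  Negative times reduce to positive ones by reflection.\<close>

lemma exp_weight_growth:
  fixes G :: "real \<Rightarrow> 'a::euclidean_space"
  assumes G: "\<And>t. (G has_vector_derivative g t) (at t)"
    and g: "\<And>t. norm (g t) \<le> C * exp (l * \<bar>t\<bar>)" and l: "l > 0"
  shows "norm (G t - G 0) \<le> C / l * (exp (l * \<bar>t\<bar>) - 1)"
proof -
  have pos: "norm (H t - H 0) \<le> C / l * (exp (l * t) - 1)"
    if H: "\<And>t. (H has_vector_derivative h t) (at t)"
      and h: "\<And>t. norm (h t) \<le> C * exp (l * \<bar>t\<bar>)" and t: "t > 0" 
    for H h :: "real \<Rightarrow> 'a" and t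
  proof -
    have "norm (H t - H 0) \<le> C / l * exp (l * t) - C / l * exp (l * 0)"
    proof (rule differentiable_bound_general[OF t])
      show "continuous_on {0..t} H"
        using H by (meson continuous_at_imp_continuous_on differentiableI_vector
            differentiable_imp_continuous_within)
      show "continuous_on {0..t} (\<lambda>s. C / l * exp (l * s))" by (intro continuous_intros)
      fix x assume "0 < x" "x < t"
      show "(H has_vector_derivative h x) (at x)" by (rule H)
      show "((\<lambda>s. C / l * exp (l * s)) has_vector_derivative C * exp (l * x)) (at x)"
        unfolding has_real_derivative_iff_has_vector_derivative[symmetric]
        using l by (auto intro!: derivative_eq_intros)
      show "norm (h x) \<le> C * exp (l * x)" using h[of x] \<open>0 < x\<close> by simp
    qed
    then show ?thesis by (simp add: right_diff_distrib)
  qed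
  consider "t > 0" | "t = 0" | "t < 0" by linarith
  then show ?thesis
  proof cases
    case 1 then show ?thesis using pos[OF G g 1] by simp
  next
    case 2 then show ?thesis by simp
  next
    case 3
    have "((\<lambda>s. G (- s)) has_vector_derivative - g (- s)) (at s)" for s
      using vector_diff_chain_at[OF has_vector_derivative_minus[OF has_vector_derivative_id] G, of s]
      by (simp add: o_def)
    from pos[OF this, of "- t"] show ?thesis using 3 g[of "- _"] by simp
  qed
qed

text \<open>Picard iteration in an exponentially weighted sup norm: a curve is written as
  \<open>exp (l * |t|)\<close> times a bounded continuous function, and the integral operator halves
  distances between such functions. The Banach fixed point is a global solution, without any gluing
  of local ones.\<close>

lemma ode_exists:
  fixes f :: "real \<Rightarrow> 'a::euclidean_space \<Rightarrow> 'a"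
  assumes cont: "\<And>z. continuous_on UNIV z \<Longrightarrow> continuous_on UNIV (\<lambda>t. f t (z t))"
    and lip: "\<And>t x y. norm (f t x - f t y) \<le> L * norm (x - y)"
    and bd: "\<And>t. norm (f t 0) \<le> C"
  obtains y where "y 0 = y0" "\<And>t. (y has_vector_derivative f t (y t)) (at t)"
proof -
  \<comment> \<open>The rate is chosen such that \<open>|L| / l\<close> is at most 1/2, the
    contraction factor below; the added 1 keeps it positive when \<open>L = 0\<close>.\<close>
  define l where "l = 2 * \<bar>L\<bar> + 1"
  have l: "l > 0" "\<bar>L\<bar> / l \<le> 1 / 2" by (auto simp: l_def field_simps)
  have C: "0 \<le> C" using bd[of 0] norm_ge_zero order_trans by blast
  have cancel: "exp (- l * r) * (A * exp (l * r)) = A" for A r :: real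
    by (simp add: exp_minus field_simps)
  define Y where "Y z t = exp (l * \<bar>t\<bar>) *\<^sub>R apply_bcontfun z t" for z :: "real \<Rightarrow>\<^sub>C 'a" and t
  have contY: "continuous_on UNIV (Y z)" for z
    unfolding Y_def by (intro continuous_intros) auto
  have "\<exists>G. G 0 = 0 \<and> (\<forall>t. (G has_vector_derivative f t (Y z t)) (at t))" for z
    using antiderivative_UNIV[OF cont[OF contY[of z]]] by metis
  then obtain G where G0: "\<And>z. G z 0 = 0"
    and G: "\<And>z t. (G z has_vector_derivative f t (Y z t)) (at t)"
    by metis
  have lip': "norm (f t x - f t y) \<le> \<bar>L\<bar> * norm (x - y)" for t x y
    using lip[of t x y] by (meson abs_ge_self mult_right_mono norm_ge_zero order_trans)
  have contG: "continuous_on UNIV (G z)" for z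
    using G by (meson continuous_at_imp_continuous_on differentiableI_vector
            differentiable_imp_continuous_within)
  \<comment> \<open>The Picard map read in the weighted space: integrate \<open>f\<close> along the
    curve \<open>Y z\<close>, add the initial value, then divide the weight out again.\<close>
  define T where "T z t = exp (- l * \<bar>t\<bar>) *\<^sub>R (y0 + G z t)" for z t
  have Tb: "T z \<in> bcontfun" for z
  proof (rule bcontfun_normI)
    show "continuous_on UNIV (T z)" unfolding T_def by (intro continuous_intros contG)
    fix t
    have "norm (f s (Y z s)) \<le> (C + \<bar>L\<bar> * norm z) * exp (l * \<bar>s\<bar>)" for s
    proof -
      have "norm (f s (Y z s)) \<le> norm (f s (Y z s) - f s 0) + norm (f s 0)"
        using norm_triangle_ineq[of "f s (Y z s) - f s 0" "f s 0"] by simp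
      also have "\<dots> \<le> \<bar>L\<bar> * norm (Y z s - 0) + C" by (intro add_mono lip' bd)
      also have "\<dots> \<le> \<bar>L\<bar> * (exp (l * \<bar>s\<bar>) * norm z) + C"
        unfolding Y_def using norm_bounded[of z s] by (intro add_right_mono mult_left_mono) auto
      also have "\<bar>L\<bar> * (exp (l * \<bar>s\<bar>) * norm z) + C
          \<le> \<bar>L\<bar> * (exp (l * \<bar>s\<bar>) * norm z) + C * exp (l * \<bar>s\<bar>)"
        using l C by (auto intro!: mult_left_mono[of 1 _ C, simplified])
      finally show ?thesis by (simp add: algebra_simps)
    qed
    from exp_weight_growth[OF G this l(1), of t]
    have "norm (G z t) \<le> (C + \<bar>L\<bar> * norm z) / l * exp (l * \<bar>t\<bar>)"
      using C l by (simp add: G0 right_diff_distrib) (smt (verit, best) divide_nonneg_pos mult_nonneg_nonneg norm_ge_zero)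
    then have "exp (- l * \<bar>t\<bar>) * norm (G z t)
        \<le> exp (- l * \<bar>t\<bar>) * ((C + \<bar>L\<bar> * norm z) / l * exp (l * \<bar>t\<bar>))"
      by (intro mult_left_mono) auto
    also have "\<dots> = (C + \<bar>L\<bar> * norm z) / l" by (rule cancel)
    finally have 1: "exp (- l * \<bar>t\<bar>) * norm (G z t) \<le> (C + \<bar>L\<bar> * norm z) / l" .
    have "exp (- l * \<bar>t\<bar>) * norm y0 \<le> 1 * norm y0"
      using l by (intro mult_right_mono) auto
    moreover have "norm (T z t) \<le> exp (- l * \<bar>t\<bar>) * (norm y0 + norm (G z t))"
      unfolding T_def by (simp add: norm_triangle_ineq)
    ultimately show "norm (T z t) \<le> norm y0 + (C + \<bar>L\<bar> * norm z) / l"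
      using 1 by (simp add: distrib_left)
  qed
  define TT where "TT z = Bcontfun (T z)" for z
  have TT: "apply_bcontfun (TT z) = T z" for z
    unfolding TT_def by (rule Bcontfun_inverse[OF Tb])
  have contr: "dist (TT z) (TT w) \<le> 1 / 2 * dist z w" for z w
  proof (rule dist_bound)
    fix t
    let ?D = "\<bar>L\<bar> * dist z w"
    have der: "((\<lambda>s. G z s - G w s) has_vector_derivative f s (Y z s) - f s (Y w s)) (at s)" for s
      by (intro has_vector_derivative_diff G)
    have "norm (f s (Y z s) - f s (Y w s)) \<le> ?D * exp (l * \<bar>s\<bar>)" for s
    proof -
      have "norm (f s (Y z s) - f s (Y w s)) \<le> \<bar>L\<bar> * norm (Y z s - Y w s)" by (rule lip')
      also have "norm (Y z s - Y w s) = exp (l * \<bar>s\<bar>) * dist (apply_bcontfun z s) (apply_bcontfun w s)"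
        unfolding Y_def dist_norm scaleR_diff_right[symmetric] by simp
      finally have "norm (f s (Y z s) - f s (Y w s))
          \<le> \<bar>L\<bar> * (exp (l * \<bar>s\<bar>) * dist (apply_bcontfun z s) (apply_bcontfun w s))" .
      also have "\<dots> \<le> \<bar>L\<bar> * (exp (l * \<bar>s\<bar>) * dist z w)" by (intro mult_left_mono dist_bounded) auto
      finally show ?thesis by (simp add: algebra_simps)
    qed
    from exp_weight_growth[OF der this l(1), of t]
    have "norm (G z t - G w t) \<le> ?D / l * (exp (l * \<bar>t\<bar>) - 1)" by (simp add: G0)
    also have "\<dots> \<le> ?D / l * exp (l * \<bar>t\<bar>)" using l by (intro mult_left_mono) auto
    finally have "exp (- l * \<bar>t\<bar>) * norm (G z t - G w t) \<le> exp (- l * \<bar>t\<bar>) * (?D / l * exp (l * \<bar>t\<bar>))"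
      by (intro mult_left_mono) auto
    also have "\<dots> = ?D / l" by (rule cancel)
    also have "\<dots> = \<bar>L\<bar> / l * dist z w" by simp
    also have "\<dots> \<le> 1 / 2 * dist z w" using l by (intro mult_right_mono) auto
    finally show "dist (apply_bcontfun (TT z) t) (apply_bcontfun (TT w) t) \<le> 1 / 2 * dist z w"
      unfolding TT T_def dist_norm scaleR_diff_right[symmetric] by simp
  qed
  have "\<exists>!z. TT z = z"
    by (rule banach_fix_type[of "1/2"]) (use contr in auto)
  then obtain z where "TT z = z" by auto
  then have z: "apply_bcontfun z t = T z t" for t using TT[of z] by simp
  have Yz: "Y z = (\<lambda>t. y0 + G z t)"
    unfolding Y_def z T_def by (simp add: exp_minus)
  show thesis
  proof (rule that[of "Y z"])
    show "Y z 0 = y0" by (simp add: Yz G0)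
    fix t show "(Y z has_vector_derivative f t (Y z t)) (at t)"
      by (subst Yz) (auto intro!: derivative_eq_intros G)
  qed
qed

text \<open>Gronwall for the squared distance \<open>u\<close>: since
  \<open>|u'| \<le> 2 * L * u\<close>, the product \<open>u * exp (- 2 * L * t)\<close> decreases
  and \<open>u * exp (2 * L * t)\<close> increases, so the estimate holds in both directions of
  time. It serves as continuous dependence on the initial value and, for curves that meet at
  \<open>s\<close>, as uniqueness.\<close>

lemma ode_stability:
  fixes f :: "real \<Rightarrow> 'a::euclidean_space \<Rightarrow> 'a"
  assumes lip: "\<And>t x y. norm (f t x - f t y) \<le> L * norm (x - y)"
    and y: "\<And>t. (y has_vector_derivative f t (y t)) (at t)"
    and z: "\<And>t. (z has_vector_derivative f t (z t)) (at t)"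
  shows "norm (y t - z t) \<le> exp (L * \<bar>t - s\<bar>) * norm (y s - z s)"
proof -
  define u where "u t = (y t - z t) \<bullet> (y t - z t)" for t
  define u' where "u' t = 2 * ((f t (y t) - f t (z t)) \<bullet> (y t - z t))" for t
  have du: "(u has_real_derivative u' t) (at t)" for t
  proof -
    have "((\<lambda>t. y t - z t) has_vector_derivative f t (y t) - f t (z t)) (at t)"
      by (intro has_vector_derivative_diff y z)
    from bounded_bilinear.has_vector_derivative[OF bounded_bilinear_inner this this]
    show ?thesis unfolding u_def u'_def has_real_derivative_iff_has_vector_derivative
      by (simp add: inner_commute)
  qed
  have b: "\<bar>u' t\<bar> \<le> 2 * L * u t" for t
  proof -
    have "\<bar>u' t\<bar> \<le> 2 * (norm (f t (y t) - f t (z t)) * norm (y t - z t))"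
      unfolding u'_def abs_mult using Cauchy_Schwarz_ineq2 by auto
    also have "\<dots> \<le> 2 * (L * norm (y t - z t) * norm (y t - z t))"
      by (intro mult_left_mono mult_right_mono lip) auto
    finally show ?thesis by (simp add: u_def dot_square_norm power2_eq_square)
  qed
  have "u t \<le> exp (2 * L * \<bar>t - s\<bar>) * u s"
  proof (cases "s \<le> t")
    case True
    have "u t * exp (- 2 * L * t) \<le> u s * exp (- 2 * L * s)"
    proof (rule DERIV_nonpos_imp_nonincreasing[OF True])
      fix x
      have "((\<lambda>t. u t * exp (- 2 * L * t)) has_real_derivative (u' x - 2 * L * u x) * exp (- 2 * L * x)) (at x)"
        by (auto intro!: derivative_eq_intros du simp: algebra_simps)
      moreover have "(u' x - 2 * L * u x) * exp (- 2 * L * x) \<le> 0"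
        using b[of x] by (intro mult_nonpos_nonneg) auto
      ultimately show "\<exists>y. ((\<lambda>t. u t * exp (- 2 * L * t)) has_real_derivative y) (at x) \<and> y \<le> 0"
        by blast
    qed
    then have "u t * exp (- 2 * L * t) * exp (2 * L * t) \<le> u s * exp (- 2 * L * s) * exp (2 * L * t)"
      by (intro mult_right_mono) auto
    then show ?thesis using True by (simp add: mult.assoc exp_add[symmetric] algebra_simps)
  next
    case False
    have "u t * exp (2 * L * t) \<le> u s * exp (2 * L * s)"
    proof (rule DERIV_nonneg_imp_nondecreasing[where a = t and b = s])
      show "t \<le> s" using False by simp
    next
      fix x
      have "((\<lambda>t. u t * exp (2 * L * t)) has_real_derivative (u' x + 2 * L * u x) * exp (2 * L * x)) (at x)"
        by (auto intro!: derivative_eq_intros du simp: algebra_simps)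
      moreover have "(u' x + 2 * L * u x) * exp (2 * L * x) \<ge> 0"
        using b[of x] by (intro mult_nonneg_nonneg) auto
      ultimately show "\<exists>y. ((\<lambda>t. u t * exp (2 * L * t)) has_real_derivative y) (at x) \<and> y \<ge> 0"
        by blast
    qed
    then have "u t * exp (2 * L * t) * exp (- 2 * L * t) \<le> u s * exp (2 * L * s) * exp (- 2 * L * t)"
      by (intro mult_right_mono) auto
    then show ?thesis using False by (simp add: mult.assoc exp_add[symmetric] algebra_simps)
  qed
  also have "exp (2 * L * \<bar>t - s\<bar>) = (exp (L * \<bar>t - s\<bar>))\<^sup>2"
    by (simp add: power2_eq_square exp_add[symmetric])
  finally have "(norm (y t - z t))\<^sup>2 \<le> (exp (L * \<bar>t - s\<bar>) * norm (y s - z s))\<^sup>2"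
    by (simp add: u_def dot_square_norm power_mult_distrib)
  then show ?thesis by (rule power2_le_imp_le) simp
qed

section \<open>The stationary Hamilton-Jacobi-Bellman equation\<close>

lemma DERIV_reflect:
  fixes f :: "real \<Rightarrow> real"
  assumes "(f has_real_derivative D) (at (c - x))"
  shows "((\<lambda>x. f (c - x)) has_real_derivative - D) (at x)"
proof -
  have "((\<lambda>x. c - x) has_real_derivative - 1) (at x)" by (auto intro!: derivative_eq_intros)
  from DERIV_chain2[where g = "\<lambda>x. c - x", OF assms this] show ?thesis by simp
qed

text \<open>The operator \<open>D\<^sup>2 - m\<^sup>2\<close> factors as
  \<open>(D - m) (D + m)\<close>, which splits the second-order comparison into two first-order
  ones: \<open>q = d1 + m * d\<close> has \<open>q' - m * q \<ge> 0\<close> and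
  \<open>q 0 = 0\<close>, hence \<open>q \<ge> 0\<close>; then \<open>d' + m * d \<ge> 0\<close>
  gives \<open>d \<ge> 0\<close>, and with it \<open>d2 \<ge> 0\<close>.\<close>

lemma second_order_lower:
  fixes d d1 d2 :: "real \<Rightarrow> real"
  assumes d: "\<And>x. (d has_real_derivative d1 x) (at x)"
    and d1: "\<And>x. (d1 has_real_derivative d2 x) (at x)"
    and init: "d 0 = 0" "d1 0 = 0"
    and ge: "\<And>x. d2 x \<ge> m\<^sup>2 * d x"
    and x: "(x::real) \<ge> 0"
  shows "d x \<ge> 0" "d1 x \<ge> 0"
proof -
  have q: "d1 y + m * d y \<ge> 0" if y: "y \<ge> 0" for y :: real
  proof -
    have "(d1 0 + m * d 0) * exp (- m * 0) \<le> (d1 y + m * d y) * exp (- m * y)"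
    proof (rule DERIV_nonneg_imp_nondecreasing[where a = 0 and b = y and f = "\<lambda>y. (d1 y + m * d y) * exp (- m * y)"])
      fix z
      have "((\<lambda>y. (d1 y + m * d y) * exp (- m * y)) has_real_derivative
          (d2 z - m\<^sup>2 * d z) * exp (- m * z)) (at z)"
        by (auto intro!: derivative_eq_intros d d1 simp: algebra_simps power2_eq_square)
      moreover have "(d2 z - m\<^sup>2 * d z) * exp (- m * z) \<ge> 0"
        using ge[of z] by (intro mult_nonneg_nonneg) auto
      ultimately show "\<exists>y. ((\<lambda>y. (d1 y + m * d y) * exp (- m * y)) has_real_derivative y) (at z) \<and> 0 \<le> y"
        by blast
    qed (rule y)
    then have "0 * exp (- m * y) \<le> (d1 y + m * d y) * exp (- m * y)" unfolding init by simp
    then show ?thesis by (rule mult_right_le_imp_le) simp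
  qed
  have dn: "d y \<ge> 0" if y: "y \<ge> 0" for y :: real
  proof -
    have "d 0 * exp (m * 0) \<le> d y * exp (m * y)"
    proof (rule DERIV_nonneg_imp_nondecreasing[where a = 0 and b = y and f = "\<lambda>y. d y * exp (m * y)"])
      fix z :: real assume "0 \<le> z"
      have "((\<lambda>y. d y * exp (m * y)) has_real_derivative (d1 z + m * d z) * exp (m * z)) (at z)"
        by (auto intro!: derivative_eq_intros d simp: algebra_simps)
      moreover have "(d1 z + m * d z) * exp (m * z) \<ge> 0"
        using q[OF \<open>0 \<le> z\<close>] by (intro mult_nonneg_nonneg) auto
      ultimately show "\<exists>D. ((\<lambda>y. d y * exp (m * y)) has_real_derivative D) (at z) \<and> 0 \<le> D"
        by blast
    qed (rule y)
    then have "0 * exp (m * y) \<le> d y * exp (m * y)" unfolding init by simp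
    then show ?thesis by (rule mult_right_le_imp_le) simp
  qed
  show "d x \<ge> 0" by (rule dn[OF x])
  have "d1 0 \<le> d1 x"
  proof (rule DERIV_nonneg_imp_nondecreasing[OF x])
    fix z :: real assume "0 \<le> z"
    have "0 \<le> m\<^sup>2 * d z" using dn[OF \<open>0 \<le> z\<close>] by simp
    then show "\<exists>y. (d1 has_real_derivative y) (at z) \<and> 0 \<le> y"
      using d1 ge[of z] by (meson order_trans)
  qed
  then show "d1 x \<ge> 0" by (simp add: init)
qed

text \<open>A negative second derivative would make \<open>v1\<close> negative, hence
  \<open>v\<close> decreasing, just to the right of the minimum. This is the core of the maximum
  principle in \<open>hjb_comparison\<close>.\<close>

lemma deriv2_nonneg_at_min:
  fixes v v1 v2 :: "real \<Rightarrow> real"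
  assumes v: "\<And>x. (v has_real_derivative v1 x) (at x)"
    and v1: "\<And>x. (v1 has_real_derivative v2 x) (at x)"
    and min: "\<And>x. v x0 \<le> v x"
  shows "v1 x0 = 0" "v2 x0 \<ge> 0"
proof -
  show z: "v1 x0 = 0" by (rule DERIV_local_min[OF v, of 1]) (use min in auto)
  show "v2 x0 \<ge> 0"
  proof (rule ccontr)
    assume "\<not> v2 x0 \<ge> 0"
    then obtain e where e: "e > 0" "\<And>h. 0 < h \<Longrightarrow> h < e \<Longrightarrow> v1 (x0 + h) < v1 x0"
      using DERIV_neg_dec_right[OF v1[of x0]] by auto
    have "v (x0 + e / 2) < v x0"
    proof (rule DERIV_neg_imp_decreasing_open[where a = x0 and b = "x0 + e / 2"])
      fix y assume "x0 < y" "y < x0 + e / 2"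
      then show "\<exists>D. (v has_real_derivative D) (at y) \<and> D < 0"
        using v[of y] e(2)[of "y - x0"] z e(1) by auto
    next
      show "continuous_on {x0..x0 + e / 2} v" by (rule DERIV_continuous_on[OF has_field_derivative_at_within[OF v]])
    qed (use e(1) in simp)
    then show False using min[of "x0 + e / 2"] by simp
  qed
qed

section \<open>Periodic functions on the line\<close>

definition per :: "(real \<Rightarrow> 'a) \<Rightarrow> bool" where "per f \<longleftrightarrow> (\<forall>x. f (x + 2 * pi) = f x)"

lemma per_int:
  assumes "per f" shows "f (x + 2 * pi * of_int j) = f x"
proof (induction j rule: int_induct[where k = 0])
  case (step1 i)
  have "f (x + 2 * pi * of_int (i + 1)) = f (x + 2 * pi * of_int i + 2 * pi)"
    by (simp add: algebra_simps)
  then show ?case using step1 assms by (simp add: per_def)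
next
  case (step2 i)
  have "f (x + 2 * pi * of_int i) = f (x + 2 * pi * of_int (i - 1) + 2 * pi)"
    by (simp add: algebra_simps)
  then show ?case using step2 assms by (simp add: per_def)
qed simp

lemma per_deriv:
  fixes f :: "real \<Rightarrow> real"
  assumes "per f" "\<And>x. (f has_real_derivative f1 x) (at x)"
  shows "per f1"
  unfolding per_def
proof
  fix x
  have "((\<lambda>x. f (x + 2 * pi)) has_real_derivative f1 (x + 2 * pi)) (at x)"
    using assms(2)[of "x + 2 * pi"] by (simp only: DERIV_shift)
  then have "(f has_real_derivative f1 (x + 2 * pi)) (at x)" using assms(1) by (simp add: per_def)
  then show "f1 (x + 2 * pi) = f1 x" by (rule DERIV_unique[OF _ assms(2)])
qed

lemma shift_into_period: "\<exists>j::int. x + 2 * pi * of_int j \<in> {a..a + 2 * pi}"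
proof
  let ?j = "\<lfloor>(x - a) / (2 * pi)\<rfloor>"
  have p: "2 * pi > 0" by simp
  have "of_int ?j * (2 * pi) \<le> x - a" "x - a < (of_int ?j + 1) * (2 * pi)"
    using floor_correct[of "(x - a) / (2 * pi)"]
    by (simp_all only: pos_le_divide_eq[OF p] pos_divide_less_eq[OF p] of_int_add of_int_1)
  then have "2 * pi * of_int ?j \<le> x - a" "x - a \<le> 2 * pi * of_int ?j + 2 * pi"
    by (simp_all add: algebra_simps)
  then show "x + 2 * pi * of_int (- ?j) \<in> {a..a + 2 * pi}" by auto
qed

lemma per_bound:
  assumes "per f" "\<And>x. x \<in> {a..a + 2 * pi} \<Longrightarrow> P (f x)" shows "P (f x)"
proof -
  obtain j :: int where "x + 2 * pi * of_int j \<in> {a..a + 2 * pi}"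
    using shift_into_period[of x a] by blast
  from assms(2)[OF this] show ?thesis by (simp only: per_int[OF assms(1)])
qed

lemma per_attains_min:
  fixes f :: "real \<Rightarrow> real"
  assumes "per f" "continuous_on UNIV f"
  obtains x0 where "\<And>x. f x0 \<le> f x"
proof -
  have "\<exists>x0\<in>{0..2 * pi}. \<forall>x\<in>{0..2 * pi}. f x0 \<le> f x"
    by (rule continuous_attains_inf) (auto intro: continuous_on_subset[OF assms(2)])
  then obtain x0 where x0: "\<And>x. x \<in> {0..2 * pi} \<Longrightarrow> f x0 \<le> f x" by blast
  have "f x0 \<le> f x" for x
    by (rule per_bound[OF assms(1), where P = "\<lambda>y. f x0 \<le> y" and a = 0]) (simp add: x0)
  then show thesis by (rule that)
qed

lemma per_cont_bounded:
  fixes f :: "real \<Rightarrow> real"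
  assumes "per f" "continuous_on UNIV f"
  obtains C where "\<And>x. \<bar>f x\<bar> \<le> C"
proof -
  have "per (\<lambda>x. - \<bar>f x\<bar>)" "continuous_on UNIV (\<lambda>x. - \<bar>f x\<bar>)"
    using assms by (auto simp: per_def intro!: continuous_intros)
  from per_attains_min[OF this] obtain x0 where "\<And>x. - \<bar>f x0\<bar> \<le> - \<bar>f x\<bar>" by blast
  then have "\<bar>f x\<bar> \<le> \<bar>f x0\<bar>" for x by simp
  then show thesis by (rule that)
qed

text \<open>The equation of the overview solved for the second derivative: \<open>k\<close> stands
  for \<open>2 / \<sigma>\<^sup>2\<close>, and \<open>f\<close> is minus the part of the running
  cost that depends on the position. The slope \<open>v1\<close> is carried along, and the equation
  itself supplies the second derivative.\<close>

definition hjb :: "real \<Rightarrow> real \<Rightarrow> (real \<Rightarrow> real) \<Rightarrow> (real \<Rightarrow> real) \<Rightarrow> (real \<Rightarrow> real) \<Rightarrow> bool" where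
  "hjb \<beta> k f v v1 \<longleftrightarrow> per v \<and> (\<forall>x. (v has_real_derivative v1 x) (at x)) \<and>
    (\<forall>x. (v1 has_real_derivative k * (\<beta> * v x + (v1 x)\<^sup>2 / 2 + f x)) (at x))"

text \<open>Maximum principle: where \<open>u - w\<close> is minimal the slopes agree, so the
  quadratic terms cancel, and the sign of the second derivative leaves
  \<open>\<beta> * (w - u) \<le> f - g\<close> at that point. Used in both directions it gives
  uniqueness and Lipschitz dependence on the cost.\<close>

lemma hjb_comparison:
  assumes u: "hjb \<beta> k f u u1" and w: "hjb \<beta> k g w w1"
    and pos: "\<beta> > 0" "k > 0" and le: "\<And>x. f x - g x \<le> c"
  shows "w x - u x \<le> c / \<beta>"
proof -
  let ?d = "\<lambda>x. u x - w x" 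
  have D: "(?d has_real_derivative u1 x - w1 x) (at x)" for x
    using u w unfolding hjb_def by (auto intro!: derivative_intros)
  have D1: "((\<lambda>x. u1 x - w1 x) has_real_derivative
      k * (\<beta> * u x + (u1 x)\<^sup>2 / 2 + f x) - k * (\<beta> * w x + (w1 x)\<^sup>2 / 2 + g x)) (at x)" for x
    using u w unfolding hjb_def by (auto intro!: derivative_intros)
  have "per ?d" using u w by (auto simp: per_def hjb_def)
  moreover have "continuous_on UNIV ?d" by (rule DERIV_continuous_on[OF has_field_derivative_at_within[OF D]])
  ultimately obtain x0 where x0: "\<And>x. ?d x0 \<le> ?d x" using per_attains_min by blast
  from deriv2_nonneg_at_min[OF D D1 x0]
  have z: "u1 x0 = w1 x0"
    and "0 \<le> k * (\<beta> * u x0 + (u1 x0)\<^sup>2 / 2 + f x0) - k * (\<beta> * w x0 + (w1 x0)\<^sup>2 / 2 + g x0)" by auto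
  then have "0 \<le> k * (\<beta> * (u x0 - w x0) + (f x0 - g x0))" by (simp add: algebra_simps)
  then have "0 \<le> \<beta> * (u x0 - w x0) + (f x0 - g x0)" using pos by (simp add: zero_le_mult_iff)
  then have "\<beta> * (w x0 - u x0) \<le> c" using le[of x0] by (simp add: algebra_simps)
  then have "w x0 - u x0 \<le> c / \<beta>" using pos by (simp add: field_simps)
  then show ?thesis using x0[of x] by simp
qed

text \<open>The Hamiltonian \<open>p\<^sup>2 / 2\<close> frozen beyond \<open>|p| = K\<close>. For
  \<open>K \<ge> 0\<close> it is globally Lipschitz and bounded, so that \<open>ode_exists\<close>
  applies, and it agrees with the original as long as the slope stays between \<open>- K\<close> and
  \<open>K\<close>.\<close>

definition clamp_sq :: "real \<Rightarrow> real \<Rightarrow> real" where "clamp_sq K p = (min K \<bar>p\<bar>)\<^sup>2 / 2"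

lemma clamp_sq_lipschitz: assumes "K \<ge> 0" shows "\<bar>clamp_sq K p - clamp_sq K q\<bar> \<le> K * \<bar>p - q\<bar>"
proof -
  let ?a = "min K \<bar>p\<bar>" and ?b = "min K \<bar>q\<bar>"
  have "clamp_sq K p - clamp_sq K q = (?a + ?b) * (?a - ?b) / 2"
    by (simp add: clamp_sq_def power2_eq_square algebra_simps)
  then have "\<bar>clamp_sq K p - clamp_sq K q\<bar> = \<bar>?a + ?b\<bar> * \<bar>?a - ?b\<bar> / 2"
    by (simp only: abs_mult abs_divide) simp
  also have "\<dots> \<le> (2 * K) * \<bar>p - q\<bar> / 2"
    using assms by (intro divide_right_mono mult_mono) auto
  finally show ?thesis by simp
qed

lemma clamp_sq_bounds: "K \<ge> 0 \<Longrightarrow> 0 \<le> clamp_sq K p" "K \<ge> 0 \<Longrightarrow> clamp_sq K p \<le> K\<^sup>2 / 2"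
  using power_mono[of "min K \<bar>p\<bar>" K 2] by (simp_all add: clamp_sq_def)

text \<open>Shooting for the truncated equation: start at 0 with value \<open>a\<close> and slope 0,
  and choose \<open>a\<close> by the intermediate value theorem such that the slope at
  \<open>pi\<close> vanishes too. Reflections about 0 and \<open>pi\<close> are then symmetries of
  the solution, and their composition is the translation by \<open>2 * pi\<close>. The truncated
  Hamiltonian is nonnegative, so the bounds from below on \<open>v\<close> and on its second
  derivative do not involve \<open>K\<close>; hence the slope obeys a bound that can serve as
  \<open>K\<close>.\<close>

lemma hjb_exists:
  fixes \<beta> k \<gamma> :: real
  assumes pos: "\<beta> > 0" "k > 0" "\<gamma> \<ge> 0"
  obtains v v1 where "hjb \<beta> k (\<lambda>x. \<gamma> * cos x) v v1"
proof -
  \<comment> \<open>Origin of the level: the second derivative will turn out to be at least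
    \<open>- 2 * k * \<gamma>\<close>, and a slope that vanishes at both ends of a period of length
    \<open>2 * pi\<close> is then at most \<open>4 * pi * k * \<gamma>\<close> in absolute
    value.\<close>
  define K where "K = 4 * pi * k * \<gamma>"
  have K: "K \<ge> 0" using pos by (simp add: K_def)
  define f :: "real \<Rightarrow> real \<times> real \<Rightarrow> real \<times> real" where
    "f x y = (snd y, k * (\<beta> * fst y + clamp_sq K (snd y) + \<gamma> * cos x))" for x y
  define L where "L = 1 + k * (\<beta> + K)"
  have lip: "norm (f t x - f t y) \<le> L * norm (x - y)" for t x y
  proof -
    have s: "\<bar>snd x - snd y\<bar> \<le> norm (x - y)" "\<bar>fst x - fst y\<bar> \<le> norm (x - y)"
      using dist_snd_le[of x y] dist_fst_le[of x y] by (simp_all add: dist_norm)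
    let ?c = "clamp_sq K (snd x) - clamp_sq K (snd y)"
    let ?e = "k * (\<beta> * (fst x - fst y) + ?c)"
    have "f t x - f t y = (snd x - snd y, ?e)"
      unfolding f_def diff_Pair prod.inject by (intro conjI refl) algebra
    then have "norm (f t x - f t y) = norm (snd x - snd y, ?e)" by (simp only:)
    also have "\<dots> \<le> \<bar>snd x - snd y\<bar> + \<bar>?e\<bar>"
      using norm_Pair_le[of "snd x - snd y" ?e] by simp
    also have "\<bar>?e\<bar> = k * \<bar>\<beta> * (fst x - fst y) + ?c\<bar>"
      using pos by (simp only: abs_mult abs_of_pos)
    also have "\<bar>\<beta> * (fst x - fst y) + ?c\<bar> \<le> \<bar>\<beta> * (fst x - fst y)\<bar> + \<bar>?c\<bar>"
      by (rule abs_triangle_ineq)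
    also have "\<bar>\<beta> * (fst x - fst y)\<bar> = \<beta> * \<bar>fst x - fst y\<bar>"
      using pos by (simp only: abs_mult abs_of_pos)
    also have "\<bar>snd x - snd y\<bar> + k * (\<beta> * \<bar>fst x - fst y\<bar> + \<bar>?c\<bar>)
        \<le> norm (x - y) + k * (\<beta> * norm (x - y) + K * norm (x - y))"
      using order_trans[OF clamp_sq_lipschitz[OF K, of "snd x" "snd y"] mult_left_mono[OF s(1) K]] pos s
      by (intro mult_left_mono add_mono) (simp_all only: less_imp_le)
    finally have "norm (f t x - f t y) \<le> norm (x - y) + k * (\<beta> * norm (x - y) + K * norm (x - y))"
      using pos by (simp add: mult_left_mono)
    then show ?thesis by (simp add: L_def algebra_simps)
  qed
  have contc: "continuous_on UNIV (clamp_sq K)"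
    unfolding clamp_sq_def[abs_def] by (intro continuous_intros) auto
  have cont: "continuous_on UNIV (\<lambda>t. f t (z t))" if "continuous_on UNIV z" for z
    unfolding f_def
    by (intro continuous_intros that continuous_on_compose2[OF contc]) auto
  have bd: "norm (f t 0) \<le> k * \<gamma>" for t
    using pos K abs_cos_le_one[of t]
    by (auto simp: f_def clamp_sq_def abs_mult intro!: mult_left_le)
  have "\<forall>a. \<exists>y. y 0 = (a, 0) \<and> (\<forall>t. (y has_vector_derivative f t (y t)) (at t))"
  proof
    fix a :: real
    obtain z where "z 0 = (a, 0)" "\<And>t. (z has_vector_derivative f t (z t)) (at t)"
      using ode_exists[of f L "k * \<gamma>" "(a, 0)", OF cont lip bd] by blast
    then show "\<exists>y. y 0 = (a, 0) \<and> (\<forall>t. (y has_vector_derivative f t (y t)) (at t))" by blast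
  qed
  from choice[OF this] obtain y
    where yy: "\<forall>a. y a 0 = (a, 0) \<and> (\<forall>t. (y a has_vector_derivative f t (y a t)) (at t))" by blast
  then have y0: "\<And>a. y a 0 = (a, 0)"
    and y: "\<And>a t. (y a has_vector_derivative f t (y a t)) (at t)" by auto
  define v where "v a x = fst (y a x)" for a x
  define v1 where "v1 a x = snd (y a x)" for a x
  define v2 where "v2 a x = k * (\<beta> * v a x + clamp_sq K (v1 a x) + \<gamma> * cos x)" for a x
  have dv: "(v a has_real_derivative v1 a x) (at x)" for a x
    using bounded_linear.has_vector_derivative[OF bounded_linear_fst y[of a x]]
    by (simp add: v_def[abs_def] v1_def f_def has_real_derivative_iff_has_vector_derivative)
  have dv1: "(v1 a has_real_derivative v2 a x) (at x)" for a x
    using bounded_linear.has_vector_derivative[OF bounded_linear_snd y[of a x]]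
    by (simp add: v_def v1_def[abs_def] v2_def f_def has_real_derivative_iff_has_vector_derivative)
  have init: "v a 0 = a" "v1 a 0 = 0" for a by (simp_all add: v_def v1_def y0)
  define m where "m = sqrt (k * \<beta>)"
  have m: "m\<^sup>2 = k * \<beta>" using pos by (simp add: m_def)
  \<comment> \<open>Two constants that act as barriers. At \<open>a1\<close> the right-hand side is
    at least \<open>k * \<beta> * (v - a1)\<close>, so the solution bends upwards and reaches
    \<open>pi\<close> with slope \<open>\<ge> 0\<close>. At \<open>a0\<close> the inequality is
    reversed, since the truncated term is at most \<open>K\<^sup>2 / 2\<close>, and the slope at
    \<open>pi\<close> is \<open>\<le> 0\<close>.\<close>
  define a1 where "a1 = \<gamma> / \<beta>"
  define a0 where "a0 = - (\<gamma> + K\<^sup>2 / 2) / \<beta>"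
  have up: "v1 a1 pi \<ge> 0"
  proof (rule second_order_lower(2)[of "\<lambda>x. v a1 x - a1" "v1 a1" "v2 a1" m])
    fix x
    have "- \<gamma> \<le> \<gamma> * cos x" using mult_left_mono[OF cos_ge_minus_one pos(3), of x] by simp
    moreover have "\<beta> * a1 = \<gamma>" using pos by (simp add: a1_def)
    ultimately have "\<beta> * (v a1 x - a1) \<le> \<beta> * v a1 x + clamp_sq K (v1 a1 x) + \<gamma> * cos x"
      using clamp_sq_bounds(1)[OF K, of "v1 a1 x"] by (simp add: algebra_simps)
    from mult_left_mono[OF this, of k]
    show "m\<^sup>2 * (v a1 x - a1) \<le> v2 a1 x" using pos by (simp add: v2_def m mult.assoc)
  qed (auto intro!: derivative_eq_intros dv dv1 simp: init)
  have "- v1 a0 pi \<ge> 0"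
  proof (rule second_order_lower(2)[of "\<lambda>x. a0 - v a0 x" "\<lambda>x. - v1 a0 x" "\<lambda>x. - v2 a0 x" m])
    fix x
    have "\<gamma> * cos x \<le> \<gamma>" using mult_left_mono[OF cos_le_one pos(3), of x] by simp
    moreover have "\<beta> * a0 = - (\<gamma> + K\<^sup>2 / 2)" using pos by (simp add: a0_def)
    ultimately have "\<beta> * v a0 x + clamp_sq K (v1 a0 x) + \<gamma> * cos x \<le> \<beta> * (v a0 x - a0)"
      using clamp_sq_bounds(2)[OF K, of "v1 a0 x"] by (simp add: algebra_simps)
    from mult_left_mono[OF this, of k]
    show "m\<^sup>2 * (a0 - v a0 x) \<le> - v2 a0 x" using pos by (simp add: v2_def m algebra_simps)
  qed (auto intro!: derivative_eq_intros dv dv1 simp: init)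
  then have down: "v1 a0 pi \<le> 0" by simp
  have "a0 \<le> a1" unfolding a0_def a1_def using pos zero_le_power2[of K] by (intro divide_right_mono) linarith+
  moreover have "continuous_on {a0..a1} (\<lambda>a. v1 a pi)"
  proof (rule continuous_on_subset[OF _ subset_UNIV], rule lipschitz_on_continuous_on)
    show "(exp (L * pi))-lipschitz_on UNIV (\<lambda>a. v1 a pi)"
    proof (rule lipschitz_onI)
      fix a b :: real
      have "dist (v1 a pi) (v1 b pi) \<le> norm (y a pi - y b pi)"
        unfolding v1_def dist_norm[symmetric] by (rule dist_snd_le)
      also have "\<dots> \<le> exp (L * \<bar>pi - 0\<bar>) * norm (y a 0 - y b 0)"
        by (rule ode_stability[OF lip y y])
      finally show "dist (v1 a pi) (v1 b pi) \<le> exp (L * pi) * dist a b"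
        by (simp add: y0 dist_norm)
    qed simp
  qed
  ultimately obtain a where a: "v1 a pi = 0"
    using IVT'[of "\<lambda>a. v1 a pi" a0 0 a1] up down by blast
  \<comment> \<open>At a multiple \<open>c\<close> of \<open>pi\<close> the cosine is symmetric
    about \<open>c\<close>, and the truncated Hamiltonian is even in the slope. The reflected curve
    therefore solves the same equation with the same data at \<open>c\<close>, and
    \<open>ode_stability\<close> identifies the two.\<close>
  have refl: "v a (2 * c - x) = v a x"
    if c: "cos c = 1 \<or> cos c = - 1" "v1 a c = 0" for c x
  proof -
    define z where "z x = (v a (2 * c - x), - v1 a (2 * c - x))" for x
    have cs: "cos (2 * c - x) = cos x" for x
    proof -
      have "(sin c)\<^sup>2 = 1 - (cos c)\<^sup>2" by (simp add: sin_squared_eq)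
      then have "sin c = 0" using c(1) by auto
      then show ?thesis using c(1) by (auto simp: cos_diff cos_double sin_double)
    qed
    have z': "(z has_vector_derivative f x (z x)) (at x)" for x
    proof -
      have "((\<lambda>x. v a (2 * c - x)) has_real_derivative - v1 a (2 * c - x)) (at x)"
        by (rule DERIV_reflect[OF dv])
      moreover have "((\<lambda>x. - v1 a (2 * c - x)) has_real_derivative v2 a (2 * c - x)) (at x)"
        using DERIV_minus[OF DERIV_reflect[OF dv1[of a "2 * c - x"]]] by simp
      ultimately have "(z has_vector_derivative (- v1 a (2 * c - x), v2 a (2 * c - x))) (at x)"
        unfolding z_def[abs_def] has_real_derivative_iff_has_vector_derivative
        by (rule has_vector_derivative_Pair)
      moreover have "f x (z x) = (- v1 a (2 * c - x), v2 a (2 * c - x))"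
        by (simp add: f_def z_def v2_def cs clamp_sq_def)
      ultimately show ?thesis by simp
    qed
    have "norm (z x - y a x) \<le> exp (L * \<bar>x - c\<bar>) * norm (z c - y a c)"
      by (rule ode_stability[OF lip z' y])
    also have "z c = y a c" using c(2) by (simp add: z_def v_def v1_def prod_eq_iff)
    finally have "z x = y a x" by simp
    then show ?thesis by (simp add: z_def v_def prod_eq_iff)
  qed
  have per: "per (v a)"
    unfolding per_def
  proof
    fix x
    have "v a (x + 2 * pi) = v a (2 * pi - (x + 2 * pi))" using refl[of pi "x + 2 * pi"] a by simp
    also have "\<dots> = v a x" using refl[of 0 x] init by simp
    finally show "v a (x + 2 * pi) = v a x" .
  qed
  have per1: "per (v1 a)" by (rule per_deriv[OF per dv])
  have "continuous_on UNIV (v a)" by (rule DERIV_continuous_on[OF has_field_derivative_at_within[OF dv]])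
  from per_attains_min[OF per this] obtain x0 where x0: "\<And>x. v a x0 \<le> v a x" by blast
  \<comment> \<open>At the minimum the slope is 0, so the truncated term drops out and the lower
    bound on \<open>v\<close> does not involve \<open>K\<close>.\<close>
  have "0 \<le> \<beta> * v a x0 + \<gamma> * cos x0"
    using deriv2_nonneg_at_min[OF dv dv1 x0] pos K by (simp add: v2_def clamp_sq_def zero_le_mult_iff)
  moreover have "\<gamma> * cos x0 \<le> \<gamma>" using mult_left_mono[OF cos_le_one pos(3), of x0] by simp
  ultimately have low: "- \<gamma> \<le> \<beta> * v a x" for x
    using mult_left_mono[OF x0[of x] less_imp_le[OF pos(1)]] by linarith
  have v2low: "- 2 * k * \<gamma> \<le> v2 a x" for x
  proof -
    have "- \<gamma> \<le> \<gamma> * cos x" using mult_left_mono[OF cos_ge_minus_one pos(3), of x] by simp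
    then have "- 2 * \<gamma> \<le> \<beta> * v a x + clamp_sq K (v1 a x) + \<gamma> * cos x"
      using low[of x] clamp_sq_bounds(1)[OF K, of "v1 a x"] by simp
    from mult_left_mono[OF this, of k] show ?thesis using pos by (simp add: v2_def mult.assoc)
  qed
  have incr: "v1 a x + 2 * k * \<gamma> * x \<le> v1 a z + 2 * k * \<gamma> * z" if "x \<le> z" for x z
  proof (rule DERIV_nonneg_imp_nondecreasing[OF that, where f = "\<lambda>x. v1 a x + 2 * k * \<gamma> * x"])
    fix w
    have "((\<lambda>x. v1 a x + 2 * k * \<gamma> * x) has_real_derivative v2 a w + 2 * k * \<gamma>) (at w)"
      by (auto intro!: derivative_eq_intros dv1)
    then show "\<exists>D. ((\<lambda>x. v1 a x + 2 * k * \<gamma> * x) has_real_derivative D) (at w) \<and> 0 \<le> D"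
      using v2low[of w] by (intro exI conjI) auto
  qed
  have p2: "v1 a (2 * pi) = 0" using per1 init unfolding per_def by (metis add_0)
  have "\<bar>v1 a x\<bar> \<le> K" for x
  proof (rule per_bound[OF per1, where P = "\<lambda>y. \<bar>y\<bar> \<le> K" and a = 0])
    fix x assume x: "x \<in> {0..0 + 2 * pi}"
    have "2 * k * \<gamma> * x \<le> 2 * k * \<gamma> * (2 * pi)" using x pos by (intro mult_left_mono) auto
    moreover have "0 \<le> 2 * k * \<gamma> * x" using x pos by auto
    moreover have "0 \<le> v1 a x + 2 * k * \<gamma> * x" using incr[of 0 x] x init by simp
    moreover have "v1 a x + 2 * k * \<gamma> * x \<le> 2 * k * \<gamma> * (2 * pi)" using incr[of x "2 * pi"] x p2 by simp
    ultimately show "\<bar>v1 a x\<bar> \<le> K" by (simp add: K_def algebra_simps abs_le_iff)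
  qed
  then have clamp: "clamp_sq K (v1 a x) = (v1 a x)\<^sup>2 / 2" for x by (simp add: clamp_sq_def min_absorb2)
  have "hjb \<beta> k (\<lambda>x. \<gamma> * cos x) (v a) (v1 a)"
    unfolding hjb_def using per dv dv1[of a, unfolded v2_def clamp] by blast
  then show thesis by (rule that)
qed

section \<open>The self-consistent amplitude of the cosine potential\<close>

lemma exp_lipschitz_below:
  fixes a b M :: real
  assumes "a \<le> M" "b \<le> M"
  shows "\<bar>exp a - exp b\<bar> \<le> exp M * \<bar>a - b\<bar>"
proof -
  have *: "exp x - exp y \<le> exp M * \<bar>x - y\<bar>" if "x \<le> M" for x y :: real
  proof -
    have "exp x * (1 + (y - x)) \<le> exp x * exp (y - x)"
      by (intro mult_left_mono exp_ge_add_one_self) simp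
    also have "\<dots> = exp y" by (simp add: exp_diff)
    finally have "exp x - exp y \<le> exp x * (x - y)" by (simp add: algebra_simps)
    also have "\<dots> \<le> exp x * \<bar>x - y\<bar>" by (intro mult_left_mono) auto
    also have "\<dots> \<le> exp M * \<bar>x - y\<bar>" using that by (intro mult_right_mono) auto
    finally show ?thesis .
  qed
  show ?thesis using *[OF assms(1), of b] *[OF assms(2), of a] by (simp add: abs_le_iff abs_minus_commute)
qed

text \<open>For negative \<open>y\<close> the upper bound comes from
  \<open>(1 + y + y\<^sup>2) * (1 - y) = 1 - y ^ 3 \<ge> 1\<close> together with
  \<open>1 - y \<le> exp (- y)\<close>.\<close>

lemma exp_quadratic_bound:
  fixes y :: real
  assumes "\<bar>y\<bar> \<le> 1" shows "\<bar>exp y - 1 - y\<bar> \<le> y\<^sup>2"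
proof -
  have "exp y \<le> 1 + y + y\<^sup>2"
  proof (cases "y \<ge> 0")
    case True then show ?thesis using exp_bound[of y] assms by simp
  next
    case False
    have "(1 - y) \<le> exp (- y)" using exp_ge_add_one_self[of "- y"] by simp
    moreover have "(1 + y + y\<^sup>2) * (1 - y) = 1 + y * y * (- y)" by (simp add: power2_eq_square algebra_simps)
    moreover have "y * y * (- y) \<ge> 0" using False by (intro mult_nonneg_nonneg mult_nonpos_nonpos) auto
    moreover have "1 + y + y\<^sup>2 \<ge> 0" using assms zero_le_power2[of y] by linarith
    ultimately have "1 \<le> (1 + y + y\<^sup>2) * exp (- y)"
      using mult_left_mono[of "1 - y" "exp (- y)" "1 + y + y\<^sup>2"] by linarith
    then have "1 * exp y \<le> (1 + y + y\<^sup>2) * exp (- y) * exp y" by (intro mult_right_mono) auto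
    also have "\<dots> = 1 + y + y\<^sup>2" by (simp add: exp_minus)
    finally show ?thesis by simp
  qed
  then show ?thesis using exp_ge_add_one_self[of y] zero_le_power2[of y]
    unfolding abs_le_iff by linarith
qed

text \<open>With \<open>k = 2 / \<sigma>\<^sup>2\<close> the hypothesis on \<open>\<kappa>\<close>
  says that \<open>\<kappa>\<close> exceeds the critical value. The equation for
  \<open>\<gamma>\<close> is kept free of division by the normalising integral, so that the defect
  \<open>h\<close> is a difference of continuous functions. The solutions \<open>V g\<close> come
  from the axiom of choice; comparison makes every such selection Lipschitz in
  \<open>g\<close>.\<close>

lemma hjb_gibbs_selfconsistent:
  fixes \<beta> k \<kappa> :: real
  assumes pos: "\<beta> > 0" "k > 0" and \<kappa>: "\<kappa> * k > 2 * (\<beta> + 1 / k)"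
  obtains \<gamma> v v1 where "\<gamma> > 0" "hjb \<beta> k (\<lambda>x. \<gamma> * cos x) v v1"
    "\<kappa> * integral {-pi..pi} (\<lambda>x. cos x * exp (- k * v x)) = \<gamma> * integral {-pi..pi} (\<lambda>x. exp (- k * v x))"
proof -
  have "0 < 2 * (\<beta> + 1 / k)" using pos by (intro mult_pos_pos add_pos_pos) auto
  then have "0 < \<kappa> * k" using \<kappa> by linarith
  then have \<kappa>0: "\<kappa> > 0" using pos by (simp add: zero_less_mult_iff)
  have "\<forall>g. \<exists>v. g \<ge> 0 \<longrightarrow> (\<exists>v1. hjb \<beta> k (\<lambda>x. g * cos x) v v1)"
    using hjb_exists[OF pos] by metis
  from choice[OF this] obtain V where V: "\<And>g. g \<ge> 0 \<Longrightarrow> \<exists>v1. hjb \<beta> k (\<lambda>x. g * cos x) (V g) v1" by blast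
  have contV: "continuous_on S (V g)" if g: "g \<ge> 0" for g S
  proof -
    from V[OF g] obtain v1 where "\<And>x. (V g has_real_derivative v1 x) (at x)" unfolding hjb_def by blast
    then show ?thesis by (intro DERIV_continuous_on[OF has_field_derivative_at_within])
  qed
  have cmp: "\<bar>V g x - w x\<bar> \<le> c / \<beta>"
    if g: "g \<ge> 0" and w: "hjb \<beta> k f w w1" and c: "\<And>x. \<bar>g * cos x - f x\<bar> \<le> c" for g w w1 f c x
  proof -
    from V[OF g] obtain v1 where v: "hjb \<beta> k (\<lambda>x. g * cos x) (V g) v1" by blast
    have c': "g * cos x - f x \<le> c" "f x - g * cos x \<le> c" for x using c[of x] by auto
    show ?thesis using hjb_comparison[OF v w pos c'(1), of x] hjb_comparison[OF w v pos c'(2), of x]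
      by (simp add: abs_le_iff)
  qed
  have Vlip: "\<bar>V g x - V h x\<bar> \<le> \<bar>g - h\<bar> / \<beta>" if "g \<ge> 0" "h \<ge> 0" for g h x
  proof -
    from V[OF that(2)] obtain w1 where w: "hjb \<beta> k (\<lambda>x. h * cos x) (V h) w1" by blast
    have "\<bar>g * cos x - h * cos x\<bar> \<le> \<bar>g - h\<bar>" for x
      using mult_left_mono[OF abs_cos_le_one[of x] abs_ge_zero[of "g - h"]]
      by (simp add: left_diff_distrib[symmetric] abs_mult)
    then show ?thesis by (rule cmp[OF that(1) w])
  qed
  have Vbd: "\<bar>V g x\<bar> \<le> g / \<beta>" if "g \<ge> 0" for g x
  proof -
    have w: "hjb \<beta> k (\<lambda>x. 0) (\<lambda>x. 0) (\<lambda>x. 0)" by (simp add: hjb_def per_def)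
    have "\<bar>g * cos x - 0\<bar> \<le> g" for x
      using mult_left_mono[OF abs_cos_le_one[of x] that] that by (simp add: abs_mult)
    from cmp[OF that w this] show ?thesis by simp
  qed
  define C where "C g = integral {-pi..pi} (\<lambda>x. cos x * exp (- k * V g x))" for g
  define Z where "Z g = integral {-pi..pi} (\<lambda>x. exp (- k * V g x))" for g
  have intC: "(\<lambda>x. cos x * exp (- k * V g x)) integrable_on {-pi..pi}"
    and intZ: "(\<lambda>x. exp (- k * V g x)) integrable_on {-pi..pi}" if "g \<ge> 0" for g
    by (intro integrable_continuous_real continuous_intros contV that)+
  define E where "E = exp (k * (\<kappa> / \<beta>)) * k / \<beta>"
  have E0: "E \<ge> 0" using pos by (simp add: E_def)
  have elip: "\<bar>exp (- k * V g x) - exp (- k * V h x)\<bar> \<le> E * \<bar>g - h\<bar>"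
    if "g \<in> {0..\<kappa>}" "h \<in> {0..\<kappa>}" for g h x
  proof -
    have le: "- k * V g x \<le> k * (\<kappa> / \<beta>)" if "g \<in> {0..\<kappa>}" for g
    proof -
      have "- V g x \<le> g / \<beta>" using Vbd[of g x] that by (simp add: abs_le_iff)
      also have "g / \<beta> \<le> \<kappa> / \<beta>" using that pos by (intro divide_right_mono) auto
      finally show ?thesis using mult_left_mono[of "- V g x" "\<kappa> / \<beta>" k] pos by simp
    qed
    have "\<bar>exp (- k * V g x) - exp (- k * V h x)\<bar> \<le> exp (k * (\<kappa> / \<beta>)) * \<bar>- k * V g x - - k * V h x\<bar>"
      by (intro exp_lipschitz_below le that)
    also have "- k * V g x - - k * V h x = - (k * (V g x - V h x))" by (simp add: algebra_simps)
    also have "\<bar>- (k * (V g x - V h x))\<bar> = k * \<bar>V g x - V h x\<bar>" using pos by (simp only: abs_minus_cancel abs_mult abs_of_pos)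
    also have "exp (k * (\<kappa> / \<beta>)) * (k * \<bar>V g x - V h x\<bar>) \<le> exp (k * (\<kappa> / \<beta>)) * (k * (\<bar>g - h\<bar> / \<beta>))"
      using pos that by (intro mult_left_mono Vlip) auto
    finally show ?thesis by (simp add: E_def)
  qed
  have lipint: "\<bar>integral {-pi..pi} F - integral {-pi..pi} G\<bar> \<le> e * (2 * pi)"
    if "F integrable_on {-pi..pi}" "G integrable_on {-pi..pi}" "\<And>x. \<bar>F x - G x\<bar> \<le> e" for F G :: "real \<Rightarrow> real" and e
  proof -
    have e0: "0 \<le> e" using that(3)[of 0] abs_ge_zero[of "F 0 - G 0"] by linarith
    have "norm (integral (cbox (-pi) pi) (\<lambda>x. F x - G x)) \<le> e * measure lborel (cbox (-pi) pi)"
      by (intro integrable_bound integrable_diff e0) (use that in \<open>auto simp: real_norm_def\<close>)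
    then show ?thesis using that by (simp add: integral_diff)
  qed
  have Zlip: "\<bar>Z g - Z h\<bar> \<le> E * \<bar>g - h\<bar> * (2 * pi)" if "g \<in> {0..\<kappa>}" "h \<in> {0..\<kappa>}" for g h
    unfolding Z_def by (rule lipint) (use elip that intZ in auto)
  have Clip: "\<bar>C g - C h\<bar> \<le> E * \<bar>g - h\<bar> * (2 * pi)" if "g \<in> {0..\<kappa>}" "h \<in> {0..\<kappa>}" for g h
    unfolding C_def
  proof (rule lipint)
    fix x
    have "\<bar>cos x\<bar> * \<bar>exp (- k * V g x) - exp (- k * V h x)\<bar> \<le> 1 * (E * \<bar>g - h\<bar>)"
      by (intro mult_mono elip that) auto
    then show "\<bar>cos x * exp (- k * V g x) - cos x * exp (- k * V h x)\<bar> \<le> E * \<bar>g - h\<bar>"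
      by (simp only: abs_mult[symmetric] right_diff_distrib mult_1)
  qed (use intC that in auto)
  have contCZ: "continuous_on {0..\<kappa>} Z" "continuous_on {0..\<kappa>} C"
    by (rule lipschitz_on_continuous_on[of "E * (2 * pi)"], rule lipschitz_onI;
        use Zlip Clip E0 in \<open>simp add: dist_real_def mult_ac\<close>)+
  define h where "h g = \<kappa> * C g - g * Z g" for g
  have conth: "continuous_on {g0..\<kappa>} h" if "g0 \<ge> 0" for g0
    unfolding h_def using that
    by (intro continuous_intros contCZ[THEN continuous_on_subset]) auto
  have hk: "h \<kappa> \<le> 0"
  proof -
    have "C \<kappa> \<le> Z \<kappa>" unfolding C_def Z_def
      by (rule integral_le) (use intC intZ \<kappa>0 in auto)
    then show ?thesis using \<kappa>0 by (simp add: h_def)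
  qed
  \<comment> \<open>Response coefficient: \<open>- g * c * cos x\<close> solves the equation
    linearised at \<open>v = 0\<close>, because the second derivative turns the equation into
    \<open>c / k = 1 - \<beta> * c\<close>.\<close>
  define c where "c = 1 / (\<beta> + 1 / k)"
  have c0: "c > 0" "c * (\<beta> + 1 / k) = 1" using pos by (auto simp: c_def intro: add_pos_pos) (metis add_pos_pos divide_pos_pos less_irrefl zero_less_one)
  \<comment> \<open>Leading coefficient of the lower bound for the defect: for small
    \<open>g\<close> the expansions give
    \<open>h g \<ge> g * pi * (\<delta> - g * (2 * D * (\<kappa> + g)))\<close>. It is positive
    exactly above the threshold.\<close>
  define \<delta> where "\<delta> = k * c * \<kappa> - 2"
  have \<delta>: "\<delta> > 0"
  proof -
    have "c * (2 * (\<beta> + 1 / k)) < c * (\<kappa> * k)" using \<kappa> c0(1) by (rule mult_strict_left_mono)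
    also have "c * (2 * (\<beta> + 1 / k)) = 2" using c0(2) by (simp only: mult.left_commute[of c 2])
    finally show ?thesis by (simp add: \<delta>_def mult_ac)
  qed
  \<comment> \<open>For \<open>g \<le> 1\<close>: \<open>R * g\<^sup>2\<close> bounds the deviation
    of the exponent \<open>- k * V g\<close> from its linear part, \<open>Q * g\<close> bounds the
    exponent itself, and \<open>D * g\<^sup>2\<close> bounds the error in the exponential once
    \<open>Q * g \<le> 1\<close>.\<close>
  define R where "R = k * c\<^sup>2 / (2 * \<beta>)"
  define Q where "Q = k * c + R"
  define D where "D = R + Q\<^sup>2"
  have R0: "R > 0" and Q0: "Q > 0" and D0: "D > 0"
    using pos c0 by (auto simp: R_def Q_def D_def intro!: add_pos_pos add_pos_nonneg)
  have hsmall: "h g \<ge> 0" if g: "0 < g" "g \<le> 1" "g * Q \<le> 1" "g * (2 * D * (\<kappa> + 1)) \<le> \<delta>" for g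
  proof -
    \<comment> \<open>The linear profile is an exact solution for a cost altered by half its squared
      slope, a change of order \<open>g\<^sup>2\<close>. Comparison then yields the expansion of
      \<open>V g\<close> without a linearisation theorem.\<close>
    have w: "hjb \<beta> k (\<lambda>x. g * cos x - (g * c)\<^sup>2 * (sin x)\<^sup>2 / 2) (\<lambda>x. - g * c * cos x) (\<lambda>x. g * c * sin x)"
    proof -
      have "k * (\<beta> * (- g * c * cos x) + (g * c * sin x)\<^sup>2 / 2 + (g * cos x - (g * c)\<^sup>2 * (sin x)\<^sup>2 / 2)) = g * c * cos x" for x
      proof -
        have "k * (\<beta> * (- g * c * cos x) + (g * c * sin x)\<^sup>2 / 2 + (g * cos x - (g * c)\<^sup>2 * (sin x)\<^sup>2 / 2))
          = g * cos x * (k * (1 - c * \<beta>))" by (simp add: power_mult_distrib algebra_simps)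
        also have "1 - c * \<beta> = c / k" using c0(2) by (simp add: distrib_left)
        finally show ?thesis using pos by simp
      qed
      then show ?thesis unfolding hjb_def
        by (auto simp: per_def intro!: derivative_eq_intros)
    qed
    have "\<bar>g * cos x - (g * cos x - (g * c)\<^sup>2 * (sin x)\<^sup>2 / 2)\<bar> \<le> (g * c)\<^sup>2 / 2" for x
      using mult_left_mono[of "(sin x)\<^sup>2" 1 "(g * c)\<^sup>2"] abs_square_le_1[of "sin x"] by simp
    from cmp[OF less_imp_le[OF g(1)] w this]
    have near: "\<bar>V g x + g * c * cos x\<bar> \<le> (g * c)\<^sup>2 / 2 / \<beta>" for x by simp
    have y: "\<bar>- k * V g x - k * c * g * cos x\<bar> \<le> R * g\<^sup>2" for x
    proof -
      have "- k * V g x - k * c * g * cos x = - (k * (V g x + g * c * cos x))" by (simp add: algebra_simps)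
      then have "\<bar>- k * V g x - k * c * g * cos x\<bar> = k * \<bar>V g x + g * c * cos x\<bar>" using pos by (simp only: abs_minus_cancel abs_mult abs_of_pos)
      also have "\<dots> \<le> k * ((g * c)\<^sup>2 / 2 / \<beta>)" using pos by (intro mult_left_mono near) auto
      also have "\<dots> = R * g\<^sup>2" by (simp add: R_def power_mult_distrib)
      finally show ?thesis .
    qed
    have yQ: "\<bar>- k * V g x\<bar> \<le> Q * g" for x
    proof -
      have "R * g\<^sup>2 \<le> R * g" using g R0 by (simp add: power2_eq_square mult_left_le)
      moreover have "\<bar>k * c * g * cos x\<bar> \<le> k * c * g"
        using mult_left_mono[OF abs_cos_le_one[of x], of "k * c * g"] pos c0 g by (simp add: abs_mult)
      ultimately show ?thesis using y[of x] by (simp add: Q_def distrib_right)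
    qed
    have ey: "\<bar>exp (- k * V g x) - (1 + k * c * g * cos x)\<bar> \<le> D * g\<^sup>2" for x
    proof -
      have "\<bar>- k * V g x\<bar> \<le> 1" using yQ[of x] g(3) by (simp add: mult.commute)
      from exp_quadratic_bound[OF this] 
      have "\<bar>exp (- k * V g x) - 1 - (- k * V g x)\<bar> \<le> \<bar>- k * V g x\<bar>\<^sup>2" by simp
      also have "\<dots> \<le> (Q * g)\<^sup>2" by (intro power_mono yQ) simp
      finally show ?thesis using y[of x] by (simp add: D_def power_mult_distrib distrib_right)
    qed
    let ?a = "k * c * g" and ?d = "D * g\<^sup>2"
    have "((\<lambda>x. cos x * (1 + ?a * cos x) - ?d) has_integral
        (sin pi + ?a * (pi + sin pi * cos pi) / 2 - ?d * pi) - (sin (-pi) + ?a * (- pi + sin (-pi) * cos (-pi)) / 2 - ?d * (- pi))) {-pi..pi}"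
    proof (rule fundamental_theorem_of_calculus)
      fix x
      have "((\<lambda>x. sin x + ?a * (x + sin x * cos x) / 2 - ?d * x) has_real_derivative
          cos x + ?a * (1 + (cos x * cos x - sin x * sin x)) / 2 - ?d) (at x)"
        by (auto intro!: derivative_eq_intros)
      also have "cos x + ?a * (1 + (cos x * cos x - sin x * sin x)) / 2 - ?d = cos x * (1 + ?a * cos x) - ?d"
        using sin_cos_squared_add[of x] by algebra
      finally show "((\<lambda>x. sin x + ?a * (x + sin x * cos x) / 2 - ?d * x) has_vector_derivative cos x * (1 + ?a * cos x) - ?d) (at x within {-pi..pi})"
        by (simp add: has_real_derivative_iff_has_vector_derivative has_vector_derivative_at_within)
    qed simp
    then have I1: "((\<lambda>x. cos x * (1 + ?a * cos x) - ?d) has_integral ?a * pi - 2 * pi * ?d) {-pi..pi}"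
      by (simp add: algebra_simps)
    have "((\<lambda>x. 1 + ?a * cos x + ?d) has_integral
        (pi + ?a * sin pi + ?d * pi) - (- pi + ?a * sin (-pi) + ?d * (- pi))) {-pi..pi}"
    proof (rule fundamental_theorem_of_calculus)
      fix x
      have "((\<lambda>x. x + ?a * sin x + ?d * x) has_real_derivative 1 + ?a * cos x + ?d) (at x)"
        by (auto intro!: derivative_eq_intros)
      then show "((\<lambda>x. x + ?a * sin x + ?d * x) has_vector_derivative 1 + ?a * cos x + ?d) (at x within {-pi..pi})"
        by (simp add: has_real_derivative_iff_has_vector_derivative has_vector_derivative_at_within)
    qed simp
    then have I2: "((\<lambda>x. 1 + ?a * cos x + ?d) has_integral 2 * pi + 2 * pi * ?d) {-pi..pi}"
      by (simp add: algebra_simps)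
    have "?a * pi - 2 * pi * ?d \<le> C g"
      unfolding C_def
    proof (rule has_integral_le[OF I1 integrable_integral[OF intC]])
      fix x
      have "\<bar>cos x * (exp (- k * V g x) - (1 + ?a * cos x))\<bar> \<le> 1 * ?d"
        unfolding abs_mult by (intro mult_mono ey) auto
      then show "cos x * (1 + ?a * cos x) - ?d \<le> cos x * exp (- k * V g x)"
        by (simp add: abs_le_iff right_diff_distrib)
    qed (use g in simp)
    then have "\<kappa> * (?a * pi - 2 * pi * ?d) \<le> \<kappa> * C g" using \<kappa>0 by simp
    moreover have "Z g \<le> 2 * pi + 2 * pi * ?d"
      unfolding Z_def
    proof (rule has_integral_le[OF integrable_integral[OF intZ] I2])
      fix x show "exp (- k * V g x) \<le> 1 + ?a * cos x + ?d" using ey[of x] by (simp add: abs_le_iff)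
    qed (use g in simp)
    then have "g * Z g \<le> g * (2 * pi + 2 * pi * ?d)" using g by simp
    moreover have "\<kappa> * (?a * pi - 2 * pi * ?d) - g * (2 * pi + 2 * pi * ?d)
        = g * pi * (\<delta> - g * (2 * D * (\<kappa> + g)))"
      by (simp add: \<delta>_def power2_eq_square algebra_simps)
    moreover have "g * (2 * D * (\<kappa> + g)) \<le> \<delta>"
    proof -
      have "g * (2 * D * (\<kappa> + g)) \<le> g * (2 * D * (\<kappa> + 1))" using g D0 by simp
      then show ?thesis using g(4) by (rule order_trans)
    qed
    then have "0 \<le> g * pi * (\<delta> - g * (2 * D * (\<kappa> + g)))" using g by simp
    ultimately show ?thesis unfolding h_def by linarith
  qed
  \<comment> \<open>The first three entries are the smallness conditions of \<open>hsmall\<close>;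
    the last keeps \<open>g0\<close> in the interval that ends at \<open>\<kappa>\<close>, where the
    defect is nonpositive because \<open>cos\<close> is at most 1.\<close>
  define g0 where "g0 = Min {1, 1 / Q, \<delta> / (2 * D * (\<kappa> + 1)), \<kappa>}"
  have g0: "0 < g0" "g0 \<le> 1" "g0 \<le> 1 / Q" "g0 \<le> \<delta> / (2 * D * (\<kappa> + 1))" "g0 \<le> \<kappa>"
    using Q0 D0 \<delta> \<kappa>0 by (auto simp: g0_def)
  have DD: "0 < 2 * D * (\<kappa> + 1)" using D0 \<kappa>0 by simp
  have "0 \<le> h g0"
    by (rule hsmall) (use g0 Q0 DD in \<open>auto simp: pos_le_divide_eq\<close>)
  then obtain g where g: "g0 \<le> g" "g \<le> \<kappa>" "h g = 0"
    using IVT2'[of h \<kappa> 0 g0] hk g0 conth[of g0] by auto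
  then have "g > 0" using g0 by simp
  moreover from V[of g] this obtain v1 where "hjb \<beta> k (\<lambda>x. g * cos x) (V g) v1" by auto
  moreover have "\<kappa> * integral {-pi..pi} (\<lambda>x. cos x * exp (- k * V g x)) = g * integral {-pi..pi} (\<lambda>x. exp (- k * V g x))"
    using g(3) by (simp add: h_def C_def Z_def)
  ultimately show thesis by (rule that)
qed

section \<open>Weak convergence of the Euler scheme\<close>

text \<open>Test functions for the generator. One constant governs all four bounds, so that an Euler
  step can be tracked by a single factor \<open>1 + C * h\<close>. A Lipschitz second derivative
  already gives a cubic Taylor remainder, and uniform bounds survive averaging over
  translations.\<close>

definition c21 :: "real \<Rightarrow> (real \<Rightarrow> real) \<Rightarrow> (real \<Rightarrow> real) \<Rightarrow> (real \<Rightarrow> real) \<Rightarrow> bool" where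
  "c21 K f f1 f2 \<longleftrightarrow> (\<forall>x. (f has_real_derivative f1 x) (at x)) \<and> (\<forall>x. (f1 has_real_derivative f2 x) (at x)) \<and>
    (\<forall>x. \<bar>f x\<bar> \<le> K) \<and> (\<forall>x. \<bar>f1 x\<bar> \<le> K) \<and> (\<forall>x. \<bar>f2 x\<bar> \<le> K) \<and> (\<forall>x y. \<bar>f2 x - f2 y\<bar> \<le> K * \<bar>x - y\<bar>)"

lemma c21D:
  assumes "c21 K f f1 f2"
  shows "(f has_real_derivative f1 x) (at x)" "(f1 has_real_derivative f2 x) (at x)"
    "\<bar>f x\<bar> \<le> K" "\<bar>f1 x\<bar> \<le> K" "\<bar>f2 x\<bar> \<le> K" "\<bar>f2 x - f2 y\<bar> \<le> K * \<bar>x - y\<bar>"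
  using assms by (auto simp: c21_def)

lemma c21_nonneg: "c21 K f f1 f2 \<Longrightarrow> 0 \<le> K"
  using c21D(3)[of K f f1 f2 0] by simp

section \<open>Taylor estimates with Lipschitz remainders\<close>

lemma mvt_abs:
  fixes f :: "real \<Rightarrow> real"
  assumes "\<And>x. (f has_real_derivative f1 x) (at x)"
  obtains \<xi> where "\<bar>\<xi> - x\<bar> \<le> \<bar>y - x\<bar>" "f y - f x = f1 \<xi> * (y - x)"
proof -
  consider "x < y" | "x = y" | "y < x" by linarith
  then show thesis
  proof cases
    case 1
    from MVT2[OF 1 assms] obtain z where "x < z" "z < y" "f y - f x = (y - x) * f1 z" by blast
    then show thesis by (intro that[of z]) (auto simp: mult.commute)
  next
    case 2 then show thesis by (intro that[of x]) auto
  next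
    case 3
    from MVT2[OF 3 assms] obtain z where "y < z" "z < x" "f x - f y = (x - y) * f1 z" by blast
    then show thesis by (intro that[of z]) (auto simp: algebra_simps)
  qed
qed

lemma bounded_deriv_lipschitz:
  fixes f :: "real \<Rightarrow> real"
  assumes "\<And>x. (f has_real_derivative f1 x) (at x)" "\<And>x. \<bar>f1 x\<bar> \<le> K"
  shows "\<bar>f x - f y\<bar> \<le> K * \<bar>x - y\<bar>"
proof -
  obtain z where "f x - f y = f1 z * (x - y)" using mvt_abs[OF assms(1), of y x] by metis
  then show ?thesis using assms(2)[of z] by (simp add: abs_mult mult_right_mono)
qed

lemma c21_lipschitz:
  assumes "c21 K f f1 f2"
  shows "\<bar>f x - f y\<bar> \<le> K * \<bar>x - y\<bar>" "\<bar>f1 x - f1 y\<bar> \<le> K * \<bar>x - y\<bar>"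
  using bounded_deriv_lipschitz[of f f1 K x y] bounded_deriv_lipschitz[of f1 f2 K x y] c21D[OF assms] by auto

lemma lipschitz_deriv_taylor:
  fixes f :: "real \<Rightarrow> real"
  assumes "\<And>x. (f has_real_derivative f1 x) (at x)" "\<And>x y. \<bar>f1 x - f1 y\<bar> \<le> K * \<bar>x - y\<bar>"
  shows "\<bar>f (x + d) - f x - f1 x * d\<bar> \<le> K * d\<^sup>2"
proof -
  have K: "K \<ge> 0" using assms(2)[of 0 1] abs_ge_zero[of "f1 0 - f1 1"] by simp
  obtain z where z: "\<bar>z - x\<bar> \<le> \<bar>x + d - x\<bar>" "f (x + d) - f x = f1 z * (x + d - x)"
    using mvt_abs[OF assms(1), of x "x + d"] by metis
  then have "\<bar>f (x + d) - f x - f1 x * d\<bar> = \<bar>f1 z - f1 x\<bar> * \<bar>d\<bar>"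
    by (simp add: abs_mult[symmetric] left_diff_distrib)
  also have "\<dots> \<le> (K * \<bar>d\<bar>) * \<bar>d\<bar>"
    using z(1) K by (intro mult_right_mono order_trans[OF assms(2)] mult_left_mono) auto
  finally show ?thesis by (simp add: power2_eq_square)
qed

lemma c21_taylor1:
  assumes "c21 K f f1 f2"
  shows "\<bar>f (x + d) - f x - f1 x * d\<bar> \<le> K * d\<^sup>2" "\<bar>f1 (x + d) - f1 x - f2 x * d\<bar> \<le> K * d\<^sup>2"
  by (rule lipschitz_deriv_taylor; use c21D[OF assms] c21_lipschitz[OF assms] in blast)+

text \<open>The mean value theorem is applied to the remainder as a function of the displacement,
  whose derivative is the first-order remainder of \<open>f1\<close>.\<close>

lemma c21_taylor2:
  assumes "c21 K f f1 f2"
  shows "\<bar>f (x + d) - f x - f1 x * d - f2 x * d\<^sup>2 / 2\<bar> \<le> K * \<bar>d\<bar> ^ 3"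
proof -
  let ?g = "\<lambda>e. f (x + e) - f x - f1 x * e - f2 x * e\<^sup>2 / 2"
  have "((\<lambda>e. f (x + e)) has_real_derivative f1 (x + e)) (at e)" for e
    using c21D(1)[OF assms, of "e + x"] unfolding DERIV_shift by (simp add: add.commute)
  then have D: "(?g has_real_derivative f1 (x + e) - f1 x - f2 x * e) (at e)" for e
    by (auto intro!: derivative_eq_intros)
  obtain z where z: "\<bar>z - 0\<bar> \<le> \<bar>d - 0\<bar>" "?g d - ?g 0 = (f1 (x + z) - f1 x - f2 x * z) * (d - 0)"
    by (rule mvt_abs[OF D, of 0 d])
  have "\<bar>?g d\<bar> = \<bar>f1 (x + z) - f1 x - f2 x * z\<bar> * \<bar>d\<bar>" using z(2) by (simp add: abs_mult)
  also have "\<dots> \<le> (K * z\<^sup>2) * \<bar>d\<bar>" by (intro mult_right_mono c21_taylor1[OF assms]) auto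
  also have "\<dots> \<le> (K * \<bar>d\<bar>\<^sup>2) * \<bar>d\<bar>"
    using z(1) c21_nonneg[OF assms] by (intro mult_right_mono mult_left_mono) (auto simp: abs_le_square_iff)
  finally show ?thesis by (simp add: power2_eq_square power3_eq_cube mult.assoc)
qed

text \<open>A uniform quadratic Taylor estimate passes through an integral by mere monotonicity;
  this criterion turns it back into a derivative. It replaces differentiation under the Gaussian
  integral.\<close>

lemma DERIV_from_quadratic_bound:
  fixes F :: "real \<Rightarrow> real"
  assumes "\<And>d. \<bar>F (x + d) - F x - D * d\<bar> \<le> K * d\<^sup>2"
  shows "(F has_real_derivative D) (at x)"
  unfolding DERIV_def
proof (rule LIM_I)
  fix r :: real assume r: "r > 0"
  have K: "0 \<le> K" using assms[of 1] abs_ge_zero order_trans by fastforce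
  show "\<exists>s>0. \<forall>d. d \<noteq> 0 \<and> norm (d - 0) < s \<longrightarrow> norm ((F (x + d) - F x) / d - D) < r"
  proof (intro exI conjI allI impI)
    show "0 < r / (K + 1)" using r K by simp
    fix d :: real assume d: "d \<noteq> 0 \<and> norm (d - 0) < r / (K + 1)"
    then have "(F (x + d) - F x) / d - D = (F (x + d) - F x - D * d) / d" by (simp add: diff_divide_distrib)
    then have "norm ((F (x + d) - F x) / d - D) = \<bar>F (x + d) - F x - D * d\<bar> / \<bar>d\<bar>" by (simp add: abs_divide)
    also have "\<dots> \<le> K * d\<^sup>2 / \<bar>d\<bar>" by (intro divide_right_mono assms) auto
    also have "K * d\<^sup>2 / \<bar>d\<bar> = K * \<bar>d\<bar>" using d by (simp add: power2_eq_square divide_simps)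
    also have "\<dots> \<le> (K + 1) * \<bar>d\<bar>" by (intro mult_right_mono) auto
    also have "\<dots> < r" using d K by (simp add: pos_less_divide_eq mult.commute)
    finally show "norm ((F (x + d) - F x) / d - D) < r" .
  qed
qed

section \<open>Averages over the standard normal law\<close>

definition stdN :: "real measure" where "stdN = density lborel (\<lambda>x. ennreal (std_normal_density x))"

lemma prob_space_stdN: "prob_space stdN"
  unfolding stdN_def by (rule prob_space_normal_density) simp

lemma sets_stdN [measurable_cong, simp]: "sets stdN = sets borel" and space_stdN [simp]: "space stdN = UNIV"
  by (simp_all add: stdN_def)

lemma integrable_stdN_power: "integrable stdN (\<lambda>z. z ^ k)"
  unfolding stdN_def using integrable_std_normal_moment[of k]
  by (subst integrable_density) auto

lemma stdN_moments: "(\<integral>z. z \<partial>stdN) = 0" "(\<integral>z. z\<^sup>2 \<partial>stdN) = 1" "(\<integral>z. z ^ 4 \<partial>stdN) = 3"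
proof -
  show "(\<integral>z. z \<partial>stdN) = 0"
    unfolding stdN_def using has_bochner_integral_integral_eq[OF std_normal_moment_odd[of 0]]
    by (subst integral_density) auto
  show "(\<integral>z. z\<^sup>2 \<partial>stdN) = 1"
    unfolding stdN_def using has_bochner_integral_integral_eq[OF std_normal_moment_even[of 1]]
    by (subst integral_density) auto
  show "(\<integral>z. z ^ 4 \<partial>stdN) = 3"
    unfolding stdN_def using has_bochner_integral_integral_eq[OF std_normal_moment_even[of 2]]
    by (subst integral_density) (auto simp: fact_numeral)
qed

text \<open>The odd absolute moment is bounded by its even neighbours,
  \<open>|z| ^ 3 \<le> (z\<^sup>2 + z ^ 4) / 2\<close>, whose means 1 and 3 give the bound
  2.\<close>

lemma stdN_abs_cube: "integrable stdN (\<lambda>z. \<bar>z\<bar> ^ 3)" "(\<integral>z. \<bar>z\<bar> ^ 3 \<partial>stdN) \<le> 2"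
proof -
  have le: "\<bar>z\<bar> ^ 3 \<le> (z\<^sup>2 + z ^ 4) / 2" for z :: real
  proof -
    have "0 \<le> \<bar>z\<bar>\<^sup>2 * (\<bar>z\<bar> - 1)\<^sup>2" by simp
    also have "\<dots> = \<bar>z\<bar>\<^sup>2 + \<bar>z\<bar> ^ 4 - 2 * \<bar>z\<bar> ^ 3" by (simp only: power2_eq_square power3_eq_cube power4_eq_xxxx) algebra
    finally show ?thesis by simp
  qed
  have i: "integrable stdN (\<lambda>z. (z\<^sup>2 + z ^ 4) / 2)" by (intro integrable_stdN_power Bochner_Integration.integrable_add integrable_divide)
  show j: "integrable stdN (\<lambda>z. \<bar>z\<bar> ^ 3)"
    by (rule Bochner_Integration.integrable_bound[OF i]) (use le in \<open>auto simp: abs_le_iff intro: order_trans\<close>)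
  have "(\<integral>z. \<bar>z\<bar> ^ 3 \<partial>stdN) \<le> (\<integral>z. (z\<^sup>2 + z ^ 4) / 2 \<partial>stdN)"
    by (rule integral_mono[OF j i le])
  also have "\<dots> = 2" using integrable_stdN_power by (simp add: stdN_moments)
  finally show "(\<integral>z. \<bar>z\<bar> ^ 3 \<partial>stdN) \<le> 2" .
qed

lemma (in prob_space) integrable_bounded:
  fixes f :: "'a \<Rightarrow> real"
  assumes "f \<in> borel_measurable M" "\<And>x. \<bar>f x\<bar> \<le> K" shows "integrable M f"
  by (rule integrable_const_bound[where B = K]) (use assms in auto)

lemma (in prob_space) abs_integral_le_const:
  fixes f :: "'a \<Rightarrow> real"
  assumes f: "f \<in> borel_measurable M" and le: "\<And>x. \<bar>f x\<bar> \<le> K" shows "\<bar>\<integral>x. f x \<partial>M\<bar> \<le> K"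
proof -
  have i: "integrable M f" by (rule integrable_bounded[OF assms])
  have "(\<integral>x. f x \<partial>M) \<le> K" by (rule integral_le_const[OF i]) (use le in \<open>auto simp: abs_le_iff\<close>)
  moreover have "- K \<le> (\<integral>x. f x \<partial>M)" by (rule integral_ge_const[OF i]) (use le in \<open>auto simp: abs_le_iff minus_le_iff\<close>)
  ultimately show ?thesis by simp
qed

lemma (in prob_space) integral_diff_le_const:
  fixes f g :: "'a \<Rightarrow> real"
  assumes "integrable M f" "integrable M g" "\<And>x. \<bar>f x - g x\<bar> \<le> K"
  shows "\<bar>(\<integral>x. f x \<partial>M) - (\<integral>x. g x \<partial>M)\<bar> \<le> K"
  using abs_integral_le_const[of "\<lambda>x. f x - g x" K] assms by simp

definition gauss_avg :: "real \<Rightarrow> (real \<Rightarrow> real) \<Rightarrow> real \<Rightarrow> real" where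
  "gauss_avg s f x = (\<integral>z. f (x + s * z) \<partial>stdN)"

lemma c21_measurable:
  assumes "c21 K f f1 f2"
  shows "f \<in> borel_measurable borel" "f1 \<in> borel_measurable borel" "f2 \<in> borel_measurable borel"
    and "continuous_on UNIV f" "continuous_on UNIV f1" "continuous_on UNIV f2"
proof -
  show c: "continuous_on UNIV f" "continuous_on UNIV f1"
    by (rule DERIV_continuous_on[OF has_field_derivative_at_within], rule c21D[OF assms])+
  show c2: "continuous_on UNIV f2"
    by (rule lipschitz_on_continuous_on[of K], rule lipschitz_onI)
       (use c21D(6)[OF assms] c21_nonneg[OF assms] in \<open>auto simp: dist_real_def\<close>)
  show "f \<in> borel_measurable borel" "f1 \<in> borel_measurable borel" "f2 \<in> borel_measurable borel"
    using c c2 by (auto intro: borel_measurable_continuous_onI)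
qed

text \<open>All bounds of the class are invariant under translation, so averaging over translates
  keeps the constant \<open>K\<close> unchanged, whatever the size of the noise.\<close>

lemma c21_gauss_avg:
  assumes f: "c21 K f f1 f2"
  shows "c21 K (gauss_avg s f) (gauss_avg s f1) (gauss_avg s f2)"
proof -
  interpret N: prob_space stdN by (rule prob_space_stdN)
  note [measurable] = c21_measurable(1-3)[OF f]
  have i: "integrable stdN (\<lambda>z. f (x + s * z))" "integrable stdN (\<lambda>z. f1 (x + s * z))" "integrable stdN (\<lambda>z. f2 (x + s * z))" for x
    using c21D(3-5)[OF f] by (auto intro!: N.integrable_bounded)
  have d: "\<bar>gauss_avg s f (x + d) - gauss_avg s f x - gauss_avg s f1 x * d\<bar> \<le> K * d\<^sup>2" for x d
  proof -
    have "\<bar>(\<integral>z. f (x + d + s * z) - f (x + s * z) - f1 (x + s * z) * d \<partial>stdN)\<bar> \<le> K * d\<^sup>2"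
    proof (rule N.abs_integral_le_const)
      fix z show "\<bar>f (x + d + s * z) - f (x + s * z) - f1 (x + s * z) * d\<bar> \<le> K * d\<^sup>2"
        using c21_taylor1(1)[OF f, of "x + s * z" d] by (simp add: add_ac)
    qed measurable
    then show ?thesis using i by (simp add: gauss_avg_def)
  qed
  have d1: "\<bar>gauss_avg s f1 (x + d) - gauss_avg s f1 x - gauss_avg s f2 x * d\<bar> \<le> K * d\<^sup>2" for x d
  proof -
    have "\<bar>(\<integral>z. f1 (x + d + s * z) - f1 (x + s * z) - f2 (x + s * z) * d \<partial>stdN)\<bar> \<le> K * d\<^sup>2"
    proof (rule N.abs_integral_le_const)
      fix z show "\<bar>f1 (x + d + s * z) - f1 (x + s * z) - f2 (x + s * z) * d\<bar> \<le> K * d\<^sup>2"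
        using c21_taylor1(2)[OF f, of "x + s * z" d] by (simp add: add_ac)
    qed measurable
    then show ?thesis using i by (simp add: gauss_avg_def)
  qed
  have l: "\<bar>gauss_avg s f2 x - gauss_avg s f2 y\<bar> \<le> K * \<bar>x - y\<bar>" for x y
    unfolding gauss_avg_def
  proof (rule N.integral_diff_le_const[OF i(3) i(3)])
    fix z show "\<bar>f2 (x + s * z) - f2 (y + s * z)\<bar> \<le> K * \<bar>x - y\<bar>"
      using c21D(6)[OF f, of "x + s * z" "y + s * z"] by simp
  qed
  show ?thesis
    unfolding c21_def
  proof (intro conjI allI)
    show "(gauss_avg s f has_real_derivative gauss_avg s f1 x) (at x)" for x
      by (rule DERIV_from_quadratic_bound[OF d])
    show "(gauss_avg s f1 has_real_derivative gauss_avg s f2 x) (at x)" for x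
      by (rule DERIV_from_quadratic_bound[OF d1])
    show "\<bar>gauss_avg s f x\<bar> \<le> K" "\<bar>gauss_avg s f1 x\<bar> \<le> K" "\<bar>gauss_avg s f2 x\<bar> \<le> K" for x
      unfolding gauss_avg_def by (rule N.abs_integral_le_const, measurable, rule c21D[OF f])+
  qed (rule l)
qed

text \<open>In the second-order Taylor polynomial the linear term has mean 0 and the quadratic one
  has mean \<open>s\<^sup>2 / 2 * f2 x\<close>; the cubic remainder is paid for by the third
  absolute moment.\<close>

lemma gauss_avg_expansion:
  assumes f: "c21 K f f1 f2"
  shows "\<bar>gauss_avg s f x - f x - s\<^sup>2 / 2 * f2 x\<bar> \<le> 2 * K * \<bar>s\<bar> ^ 3"
proof -
  interpret N: prob_space stdN by (rule prob_space_stdN)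
  note [measurable] = c21_measurable(1-3)[OF f]
  have i: "integrable stdN (\<lambda>z. f (x + s * z))"
    using c21D(3)[OF f] by (auto intro!: N.integrable_bounded)
  have z1: "integrable stdN (\<lambda>z. z)" using integrable_stdN_power[of 1] by simp
  let ?F = "\<lambda>z. f (x + s * z) - f x - f1 x * (s * z) - f2 x * (s * z)\<^sup>2 / 2"
  have F: "integrable stdN ?F"
    using i z1 integrable_stdN_power[of 2] by (simp add: power_mult_distrib)
  have eq: "(\<integral>z. ?F z \<partial>stdN) = gauss_avg s f x - f x - s\<^sup>2 / 2 * f2 x"
    using i z1 integrable_stdN_power[of 2] by (simp add: power_mult_distrib stdN_moments gauss_avg_def N.prob_space[unfolded space_stdN] mult.commute)
  have "\<bar>\<integral>z. ?F z \<partial>stdN\<bar> \<le> (\<integral>z. \<bar>?F z\<bar> \<partial>stdN)" by (rule integral_abs_bound)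
  also have "\<dots> \<le> (\<integral>z. K * \<bar>s\<bar> ^ 3 * \<bar>z\<bar> ^ 3 \<partial>stdN)"
  proof (rule integral_mono)
    fix z show "\<bar>?F z\<bar> \<le> K * \<bar>s\<bar> ^ 3 * \<bar>z\<bar> ^ 3"
      using c21_taylor2[OF f, of x "s * z"] by (simp add: abs_mult power_mult_distrib mult.assoc)
  qed (use F stdN_abs_cube in auto)
  also have "\<dots> = K * \<bar>s\<bar> ^ 3 * (\<integral>z. \<bar>z\<bar> ^ 3 \<partial>stdN)" by simp
  also have "\<dots> \<le> K * \<bar>s\<bar> ^ 3 * 2"
    using stdN_abs_cube(2) c21_nonneg[OF f] by (intro mult_left_mono) auto
  finally show ?thesis unfolding eq by simp
qed

text \<open>Transition operator of one Euler step of length \<open>h\<close> for the equation with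
  drift \<open>b\<close> and noise intensity \<open>s\<close>: a deterministic move by
  \<open>h * b x\<close> followed by a centred normal displacement of variance
  \<open>s\<^sup>2 * h\<close>.\<close>

definition euler_op :: "(real \<Rightarrow> real) \<Rightarrow> real \<Rightarrow> real \<Rightarrow> (real \<Rightarrow> real) \<Rightarrow> real \<Rightarrow> real" where
  "euler_op b s h f x = gauss_avg (s * sqrt h) f (x + h * b x)"

text \<open>What matters is the form \<open>K * (1 + C * h)\<close> of the new constant, with
  \<open>C\<close> depending on the drift only: over \<open>n = T / h\<close> steps such factors
  multiply to at most \<open>exp (C * T)\<close>. Any fixed loss per step would ruin the
  iteration.\<close>

lemma c21_compose_near_id:
  assumes f: "c21 K f f1 f2" and b: "c21 L b b1 b2" and h: "0 \<le> h" "h \<le> 1"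
  shows "c21 (K * (1 + L * (7 + 6 * L + L\<^sup>2) * h)) (\<lambda>x. f (x + h * b x))
    (\<lambda>x. f1 (x + h * b x) * (1 + h * b1 x)) (\<lambda>x. f2 (x + h * b x) * (1 + h * b1 x)\<^sup>2 + f1 (x + h * b x) * (h * b2 x))"
proof -
  \<comment> \<open>\<open>u\<close> bounds \<open>h * b1\<close> and \<open>h * b2\<close>. The
    Lipschitz constant of the new second derivative is \<open>K\<close> times the polynomial in
    \<open>u\<close> below, which also covers the other three bounds; \<open>u \<le> L\<close> then
    makes the polynomial linear in \<open>h\<close>.\<close>
  define u where "u = L * h"
  note K = c21_nonneg[OF f] and L = c21_nonneg[OF b]
  have u: "0 \<le> u" "u \<le> L" using L h by (auto simp: u_def mult_left_le)
  have uu: "(1 + u) ^ 3 + 3 * u * (1 + u) + u \<le> 1 + L * (7 + 6 * L + L\<^sup>2) * h"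
  proof -
    have "(1 + u) ^ 3 + 3 * u * (1 + u) + u = 1 + u * (7 + 6 * u + u\<^sup>2)"
      by (simp add: power2_eq_square power3_eq_cube algebra_simps)
    also have "\<dots> \<le> 1 + u * (7 + 6 * L + L\<^sup>2)"
      using u by (intro add_left_mono mult_left_mono add_mono power_mono) auto
    finally show ?thesis by (simp add: u_def mult_ac)
  qed
  define K' where "K' = K * ((1 + u) ^ 3 + 3 * u * (1 + u) + u)"
  have K': "K' \<le> K * (1 + L * (7 + 6 * L + L\<^sup>2) * h)" unfolding K'_def using uu K by (rule mult_left_mono)
  define \<theta> where "\<theta> x = x + h * b x" for x
  define \<theta>1 where "\<theta>1 x = 1 + h * b1 x" for x
  have d\<theta>: "(\<theta> has_real_derivative \<theta>1 x) (at x)" for x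
    unfolding \<theta>_def[abs_def] \<theta>1_def by (auto intro!: derivative_eq_intros c21D[OF b])
  have d\<theta>1: "(\<theta>1 has_real_derivative h * b2 x) (at x)" for x
    unfolding \<theta>1_def[abs_def] by (auto intro!: derivative_eq_intros c21D[OF b])
  have hb: "\<bar>h * b1 x\<bar> \<le> u" "\<bar>h * b2 x\<bar> \<le> u" for x
    using mult_left_mono[OF c21D(4)[OF b, of x] h(1)] mult_left_mono[OF c21D(5)[OF b, of x] h(1)] h
    by (simp_all add: abs_mult u_def mult.commute)
  have t1: "\<bar>\<theta>1 x\<bar> \<le> 1 + u" for x using hb(1)[of x] by (simp add: \<theta>1_def)
  have t1l: "\<bar>\<theta>1 x - \<theta>1 y\<bar> \<le> u * \<bar>x - y\<bar>" for x y
    by (rule bounded_deriv_lipschitz[OF d\<theta>1 hb(2)])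
  have tl: "\<bar>\<theta> x - \<theta> y\<bar> \<le> (1 + u) * \<bar>x - y\<bar>" for x y
    by (rule bounded_deriv_lipschitz[OF d\<theta> t1])
  have b2l: "\<bar>h * b2 x - h * b2 y\<bar> \<le> u * \<bar>x - y\<bar>" for x y
    using mult_left_mono[OF c21D(6)[OF b, of x y] h(1)] h
    by (simp add: right_diff_distrib[symmetric] abs_mult u_def mult_ac)
  define F1 where "F1 x = f1 (\<theta> x) * \<theta>1 x" for x
  define F2 where "F2 x = f2 (\<theta> x) * (\<theta>1 x)\<^sup>2 + f1 (\<theta> x) * (h * b2 x)" for x
  have dF: "((\<lambda>x. f (\<theta> x)) has_real_derivative F1 x) (at x)" for x
    unfolding F1_def by (rule DERIV_chain2[OF c21D(1)[OF f] d\<theta>])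
  have dF1: "(F1 has_real_derivative F2 x) (at x)" for x
    unfolding F1_def[abs_def] F2_def
    using DERIV_mult[OF DERIV_chain2[OF c21D(2)[OF f] d\<theta>] d\<theta>1, of x]
    by (simp add: power2_eq_square mult_ac add_ac)
  have ge1: "1 \<le> (1 + u) ^ 3 + 3 * u * (1 + u) + u" "1 + u \<le> (1 + u) ^ 3 + 3 * u * (1 + u) + u"
    "(1 + u)\<^sup>2 + u \<le> (1 + u) ^ 3 + 3 * u * (1 + u) + u"
    using u by (auto simp: power2_eq_square power3_eq_cube algebra_simps)
  have bd0: "\<bar>f (\<theta> x)\<bar> \<le> K'" for x
  proof -
    have "\<bar>f (\<theta> x)\<bar> \<le> K * 1" using c21D(3)[OF f] by simp
    also have "\<dots> \<le> K'" unfolding K'_def using ge1(1) K by (rule mult_left_mono)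
    finally show ?thesis .
  qed
  have bd1: "\<bar>F1 x\<bar> \<le> K'" for x
  proof -
    have "\<bar>F1 x\<bar> \<le> K * (1 + u)" unfolding F1_def abs_mult using K by (intro mult_mono c21D(4)[OF f] t1) auto
    also have "\<dots> \<le> K'" unfolding K'_def using ge1(2) K by (rule mult_left_mono)
    finally show ?thesis .
  qed
  have t1s: "\<bar>(\<theta>1 x)\<^sup>2\<bar> \<le> (1 + u)\<^sup>2" for x using power_mono[OF t1[of x], of 2] by simp
  have bd2: "\<bar>F2 x\<bar> \<le> K'" for x
  proof -
    have "\<bar>F2 x\<bar> \<le> \<bar>f2 (\<theta> x)\<bar> * \<bar>(\<theta>1 x)\<^sup>2\<bar> + \<bar>f1 (\<theta> x)\<bar> * \<bar>h * b2 x\<bar>"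
      unfolding F2_def abs_mult[symmetric] by (rule abs_triangle_ineq)
    also have "\<dots> \<le> K * (1 + u)\<^sup>2 + K * u"
      using K by (intro add_mono mult_mono c21D(4,5)[OF f] t1s hb) auto
    also have "\<dots> = K * ((1 + u)\<^sup>2 + u)" by (simp add: distrib_left)
    also have "\<dots> \<le> K'" unfolding K'_def using ge1(3) K by (rule mult_left_mono)
    finally show ?thesis .
  qed
  have lip2: "\<bar>F2 x - F2 y\<bar> \<le> K' * \<bar>x - y\<bar>" for x y
  proof -
    let ?r = "\<bar>x - y\<bar>"
    have f2l: "\<bar>f2 (\<theta> x) - f2 (\<theta> y)\<bar> \<le> K * ((1 + u) * ?r)"
      by (rule order_trans[OF c21D(6)[OF f]]) (intro mult_left_mono tl K)
    have f1l: "\<bar>f1 (\<theta> x) - f1 (\<theta> y)\<bar> \<le> K * ((1 + u) * ?r)"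
      by (rule order_trans[OF c21_lipschitz(2)[OF f]]) (intro mult_left_mono tl K)
    have sql: "\<bar>(\<theta>1 x)\<^sup>2 - (\<theta>1 y)\<^sup>2\<bar> \<le> (2 * (1 + u)) * (u * ?r)"
    proof -
      have "(\<theta>1 x)\<^sup>2 - (\<theta>1 y)\<^sup>2 = (\<theta>1 x + \<theta>1 y) * (\<theta>1 x - \<theta>1 y)" by (simp add: power2_eq_square algebra_simps)
      moreover have "\<bar>\<theta>1 x + \<theta>1 y\<bar> \<le> 2 * (1 + u)" using t1[of x] t1[of y] abs_triangle_ineq[of "\<theta>1 x" "\<theta>1 y"] by (simp add: distrib_left)
      ultimately show ?thesis unfolding abs_mult using t1l[of x y] u by (auto simp: abs_mult intro!: mult_mono)
    qed
    have tri: "\<bar>(p + q) + (r + t)\<bar> \<le> (\<bar>p\<bar> + \<bar>q\<bar>) + (\<bar>r\<bar> + \<bar>t\<bar>)" for p q r t :: real by linarith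
    have "F2 x - F2 y = ((f2 (\<theta> x) - f2 (\<theta> y)) * (\<theta>1 x)\<^sup>2 + f2 (\<theta> y) * ((\<theta>1 x)\<^sup>2 - (\<theta>1 y)\<^sup>2))
        + ((f1 (\<theta> x) - f1 (\<theta> y)) * (h * b2 x) + f1 (\<theta> y) * (h * b2 x - h * b2 y))"
      by (simp add: F2_def algebra_simps)
    then have "\<bar>F2 x - F2 y\<bar> \<le> (\<bar>f2 (\<theta> x) - f2 (\<theta> y)\<bar> * \<bar>(\<theta>1 x)\<^sup>2\<bar> + \<bar>f2 (\<theta> y)\<bar> * \<bar>(\<theta>1 x)\<^sup>2 - (\<theta>1 y)\<^sup>2\<bar>)
        + (\<bar>f1 (\<theta> x) - f1 (\<theta> y)\<bar> * \<bar>h * b2 x\<bar> + \<bar>f1 (\<theta> y)\<bar> * \<bar>h * b2 x - h * b2 y\<bar>)"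
      unfolding abs_mult[symmetric] by (simp only: tri)
    also have "\<dots> \<le> (K * ((1 + u) * ?r) * (1 + u)\<^sup>2 + K * ((2 * (1 + u)) * (u * ?r)))
        + (K * ((1 + u) * ?r) * u + K * (u * ?r))"
      using K u by (intro add_mono mult_mono f2l f1l t1s sql hb b2l c21D(4,5)[OF f]) auto
    also have "\<dots> = K' * ?r"
      by (simp add: K'_def power2_eq_square power3_eq_cube algebra_simps)
    finally show ?thesis .
  qed
  have "c21 (K * (1 + L * (7 + 6 * L + L\<^sup>2) * h)) (\<lambda>x. f (\<theta> x)) F1 F2"
    unfolding c21_def using dF dF1 order_trans[OF bd0 K'] order_trans[OF bd1 K'] order_trans[OF bd2 K']
      order_trans[OF lip2 mult_right_mono[OF K' abs_ge_zero]] by blast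
  then show ?thesis by (simp add: \<theta>_def F1_def[abs_def] F2_def[abs_def] \<theta>1_def)
qed

text \<open>The order \<open>h * sqrt h\<close> stems from the cubic remainder at noise size
  \<open>s * sqrt h\<close>. The two errors from the drift are of order \<open>h * h\<close>, which
  is smaller because \<open>h \<le> 1\<close>.\<close>

lemma euler_op_expansion:
  assumes f: "c21 K f f1 f2" and b: "c21 L b b1 b2" and h: "0 \<le> h" "h \<le> 1"
  shows "\<bar>euler_op b s h f x - f x - h * (b x * f1 x + s\<^sup>2 / 2 * f2 x)\<bar>
    \<le> K * (2 * \<bar>s\<bar> ^ 3 + L\<^sup>2 + s\<^sup>2 / 2 * L) * (h * sqrt h)"
proof -
  note K = c21_nonneg[OF f] and L = c21_nonneg[OF b]
  let ?y = "x + h * b x"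
  have sh: "sqrt h * sqrt h = h" using h by simp
  have hh: "h * h \<le> h * sqrt h"
    using h by (intro mult_left_mono) (auto intro: real_le_rsqrt simp: power2_eq_square mult_left_le)
  have e1: "\<bar>gauss_avg (s * sqrt h) f ?y - f ?y - s\<^sup>2 * h / 2 * f2 ?y\<bar> \<le> 2 * K * \<bar>s\<bar> ^ 3 * (h * sqrt h)"
    using gauss_avg_expansion[OF f, of "s * sqrt h" ?y] h
    by (simp add: power_mult_distrib abs_mult power3_eq_cube mult_ac)
  have e2: "\<bar>f ?y - f x - f1 x * (h * b x)\<bar> \<le> K * L\<^sup>2 * (h * sqrt h)"
  proof -
    have "\<bar>f ?y - f x - f1 x * (h * b x)\<bar> \<le> K * (h * b x)\<^sup>2" by (rule c21_taylor1(1)[OF f])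
    also have "(h * b x)\<^sup>2 = (h * h) * \<bar>b x\<bar>\<^sup>2" by (simp add: power2_eq_square mult_ac)
    also have "K * ((h * h) * \<bar>b x\<bar>\<^sup>2) \<le> K * ((h * sqrt h) * L\<^sup>2)"
      using K h by (intro mult_left_mono mult_mono hh power_mono c21D(3)[OF b]) auto
    finally show ?thesis by (simp add: mult_ac)
  qed
  have e3: "\<bar>s\<^sup>2 * h / 2 * f2 ?y - s\<^sup>2 * h / 2 * f2 x\<bar> \<le> K * (s\<^sup>2 / 2 * L) * (h * sqrt h)"
  proof -
    have "\<bar>s\<^sup>2 * h / 2 * f2 ?y - s\<^sup>2 * h / 2 * f2 x\<bar> = s\<^sup>2 * h / 2 * \<bar>f2 ?y - f2 x\<bar>"
      using h by (simp only: right_diff_distrib[symmetric] abs_mult) simp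
    also have "\<dots> \<le> s\<^sup>2 * h / 2 * (K * \<bar>?y - x\<bar>)" using h by (intro mult_left_mono c21D(6)[OF f]) auto
    also have "\<bar>?y - x\<bar> = h * \<bar>b x\<bar>" using h by (simp add: abs_mult)
    also have "s\<^sup>2 * h / 2 * (K * (h * \<bar>b x\<bar>)) = K * (s\<^sup>2 / 2) * \<bar>b x\<bar> * (h * h)" by (simp add: mult_ac)
    also have "\<dots> \<le> K * (s\<^sup>2 / 2) * L * (h * sqrt h)"
      using K h L by (intro mult_mono hh c21D(3)[OF b]) auto
    finally show ?thesis by (simp add: mult_ac)
  qed
  have "euler_op b s h f x - f x - h * (b x * f1 x + s\<^sup>2 / 2 * f2 x)
      = (gauss_avg (s * sqrt h) f ?y - f ?y - s\<^sup>2 * h / 2 * f2 ?y) + (f ?y - f x - f1 x * (h * b x))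
        + (s\<^sup>2 * h / 2 * f2 ?y - s\<^sup>2 * h / 2 * f2 x)"
    by (simp add: euler_op_def algebra_simps)
  then have "\<bar>euler_op b s h f x - f x - h * (b x * f1 x + s\<^sup>2 / 2 * f2 x)\<bar>
      \<le> 2 * K * \<bar>s\<bar> ^ 3 * (h * sqrt h) + K * L\<^sup>2 * (h * sqrt h) + K * (s\<^sup>2 / 2 * L) * (h * sqrt h)"
    using e1 e2 e3 by linarith
  also have "\<dots> = K * (2 * \<bar>s\<bar> ^ 3 + L\<^sup>2 + s\<^sup>2 / 2 * L) * (h * sqrt h)" by (simp add: algebra_simps)
  finally show ?thesis .
qed

lemma per_euler_op:
  assumes "per b" "per g"
  shows "per (euler_op b s h g)"
  unfolding per_def
proof
  fix x
  have "g (x + 2 * pi + h * b (x + 2 * pi) + s * sqrt h * z) = g (x + h * b x + s * sqrt h * z)" for z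
  proof -
    have "x + 2 * pi + h * b (x + 2 * pi) + s * sqrt h * z = (x + h * b x + s * sqrt h * z) + 2 * pi"
      using assms(1) by (simp add: per_def)
    then show ?thesis using assms(2) by (simp only: per_def)
  qed
  then show "euler_op b s h g (x + 2 * pi) = euler_op b s h g x" by (simp add: euler_op_def gauss_avg_def)
qed

text \<open>The hypothesis \<open>stat\<close> is the stationary Fokker-Planck equation in weak
  form; it cancels the term of order \<open>h\<close> in \<open>euler_op_expansion\<close>. The
  remaining error is proportional to the constant of the iterate reached so far, and that constant
  stays below \<open>K * exp (C * T)\<close> throughout.\<close>

lemma euler_op_iterates_tendsto:
  assumes f: "c21 K f f1 f2" "per f" and b: "c21 L b b1 b2" "per b"
    and m: "prob_space m" "sets m = sets borel"
    and stat: "\<And>K f f1 f2. c21 K f f1 f2 \<Longrightarrow> per f \<Longrightarrow> (\<integral>x. b x * f1 x + s\<^sup>2 / 2 * f2 x \<partial>m) = 0"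
    and T: "T > 0"
  shows "(\<lambda>n. \<integral>x. (euler_op b s (T / real n) ^^ n) f x \<partial>m) \<longlonglongrightarrow> (\<integral>x. f x \<partial>m)"
proof -
  interpret m: prob_space m by (rule m(1))
  have [measurable_cong]: "sets m = sets borel" by (rule m(2))
  define C where "C = L * (7 + 6 * L + L\<^sup>2)"
  define D where "D = 2 * \<bar>s\<bar> ^ 3 + L\<^sup>2 + s\<^sup>2 / 2 * L"
  note K = c21_nonneg[OF f(1)] and L = c21_nonneg[OF b(1)]
  have C: "C \<ge> 0" and D: "D \<ge> 0" using L by (auto simp: C_def D_def)
  have step: "\<exists>g1 g2. c21 (K' * (1 + C * h)) (euler_op b s h g) g1 g2" "per (euler_op b s h g)"
    "\<bar>(\<integral>x. euler_op b s h g x \<partial>m) - (\<integral>x. g x \<partial>m)\<bar> \<le> K' * D * (h * sqrt h)"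
    if g: "c21 K' g g1 g2" "per g" and h: "0 \<le> h" "h \<le> 1" for g g1 g2 K' h
  proof -
    have e: "euler_op b s h g = (\<lambda>x. gauss_avg (s * sqrt h) g (x + h * b x))" by (simp add: euler_op_def fun_eq_iff)
    show ex: "\<exists>g1 g2. c21 (K' * (1 + C * h)) (euler_op b s h g) g1 g2"
      unfolding e C_def using c21_compose_near_id[OF c21_gauss_avg[OF g(1)] b(1) h] by blast
    show "per (euler_op b s h g)" by (rule per_euler_op[OF b(2) g(2)])
    note [measurable] = c21_measurable(1-3)[OF g(1)] c21_measurable(1)[OF b(1)]
    from ex have "euler_op b s h g \<in> borel_measurable borel" using c21_measurable(1) by blast
    then have [measurable]: "euler_op b s h g \<in> borel_measurable m" by simp
    have i: "integrable m g" "integrable m g2"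
      using c21D(3,5)[OF g(1)] by (auto intro!: m.integrable_bounded)
    have i1: "integrable m (\<lambda>x. b x * g1 x)"
      using L by (intro m.integrable_bounded[of _ "L * K'"])
        (auto simp: abs_mult intro!: mult_mono c21D(3)[OF b(1)] c21D(4)[OF g(1)])
    have ie: "integrable m (euler_op b s h g)"
      using ex c21D(3) by (blast intro: m.integrable_bounded[OF \<open>euler_op b s h g \<in> borel_measurable m\<close>])
    have "\<bar>\<integral>x. euler_op b s h g x - g x - h * (b x * g1 x + s\<^sup>2 / 2 * g2 x) \<partial>m\<bar> \<le> K' * D * (h * sqrt h)"
      unfolding D_def by (rule m.abs_integral_le_const, measurable, rule euler_op_expansion[OF g(1) b(1) h])
    also have "(\<integral>x. euler_op b s h g x - g x - h * (b x * g1 x + s\<^sup>2 / 2 * g2 x) \<partial>m)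
        = (\<integral>x. euler_op b s h g x \<partial>m) - (\<integral>x. g x \<partial>m) - h * (\<integral>x. b x * g1 x + s\<^sup>2 / 2 * g2 x \<partial>m)"
      using i i1 ie by simp
    finally show "\<bar>(\<integral>x. euler_op b s h g x \<partial>m) - (\<integral>x. g x \<partial>m)\<bar> \<le> K' * D * (h * sqrt h)"
      unfolding stat[OF g] by simp
  qed
  have iter: "(\<exists>g1 g2. c21 (K * (1 + C * h) ^ j) ((euler_op b s h ^^ j) f) g1 g2) \<and> per ((euler_op b s h ^^ j) f)"
    if h: "0 \<le> h" "h \<le> 1" for h j
  proof (induction j)
    case 0 then show ?case using f by auto
  next
    case (Suc j)
    then obtain g1 g2 where "c21 (K * (1 + C * h) ^ j) ((euler_op b s h ^^ j) f) g1 g2" and p: "per ((euler_op b s h ^^ j) f)" by blast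
    from step(1,2)[OF this h] show ?case by (simp add: mult_ac)
  qed
  have tele: "\<bar>(\<integral>x. (euler_op b s h ^^ j) f x \<partial>m) - (\<integral>x. f x \<partial>m)\<bar> \<le> real j * (K * (1 + C * h) ^ n * D * (h * sqrt h))"
    if h: "0 \<le> h" "h \<le> 1" and j: "j \<le> n" for h j n
    using j
  proof (induction j)
    case (Suc j)
    from iter[OF h, of j] obtain g1 g2 where g: "c21 (K * (1 + C * h) ^ j) ((euler_op b s h ^^ j) f) g1 g2" "per ((euler_op b s h ^^ j) f)" by blast
    have "\<bar>(\<integral>x. (euler_op b s h ^^ Suc j) f x \<partial>m) - (\<integral>x. (euler_op b s h ^^ j) f x \<partial>m)\<bar>
        \<le> K * (1 + C * h) ^ j * D * (h * sqrt h)"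
      using step(3)[OF g h] by simp
    also have "\<dots> \<le> K * (1 + C * h) ^ n * D * (h * sqrt h)"
      using Suc K C D h by (intro mult_right_mono mult_left_mono power_increasing) auto
    finally show ?case using Suc by (simp add: distrib_right)
  qed simp
  \<comment> \<open>The number of steps \<open>T / h\<close> times the error
    \<open>h * sqrt h\<close> leaves \<open>T * sqrt h\<close>. The condition
    \<open>T \<le> real n\<close> is the bound \<open>h \<le> 1\<close> on the step length.\<close>
  have bound: "\<bar>(\<integral>x. (euler_op b s (T / real n) ^^ n) f x \<partial>m) - (\<integral>x. f x \<partial>m)\<bar>
      \<le> T * K * exp (C * T) * D * sqrt (T / real n)" if n: "n \<ge> 1" "T \<le> real n" for n
  proof -
    define h where "h = T / real n"
    have h: "0 \<le> h" "h \<le> 1" using T n by (auto simp: h_def)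
    have nh: "real n * h = T" using n by (simp add: h_def)
    have "(1 + C * h) ^ n \<le> exp (C * h) ^ n" using C h by (intro power_mono exp_ge_add_one_self) auto
    also have "\<dots> = exp (C * T)" unfolding exp_of_nat_mult[symmetric] by (simp add: nh[symmetric] mult_ac)
    finally have "(1 + C * h) ^ n \<le> exp (C * T)" .
    then have "real n * (K * (1 + C * h) ^ n * D * (h * sqrt h)) \<le> real n * (K * exp (C * T) * D * (h * sqrt h))"
      using K D h by (intro mult_left_mono mult_right_mono) auto
    also have "\<dots> = (real n * h) * K * exp (C * T) * D * sqrt h" by (simp add: mult_ac)
    finally have "real n * (K * (1 + C * h) ^ n * D * (h * sqrt h)) \<le> T * K * exp (C * T) * D * sqrt h" unfolding nh .
    then show ?thesis using tele[OF h order_refl, of n] unfolding h_def by linarith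
  qed
  have "(\<lambda>n. T * K * exp (C * T) * D * sqrt (T / real n)) \<longlonglongrightarrow> T * K * exp (C * T) * D * sqrt 0"
    by (intro tendsto_mult tendsto_const tendsto_real_sqrt lim_const_over_n)
  then have lim: "(\<lambda>n. T * K * exp (C * T) * D * sqrt (T / real n)) \<longlonglongrightarrow> 0" by simp
  have "(\<lambda>n. (\<integral>x. (euler_op b s (T / real n) ^^ n) f x \<partial>m) - (\<integral>x. f x \<partial>m)) \<longlonglongrightarrow> 0"
  proof (rule Lim_null_comparison[OF _ lim])
    show "\<forall>\<^sub>F n in sequentially. norm ((\<integral>x. (euler_op b s (T / real n) ^^ n) f x \<partial>m) - (\<integral>x. f x \<partial>m))
        \<le> T * K * exp (C * T) * D * sqrt (T / real n)"
      using eventually_ge_at_top[of "max 1 (nat \<lceil>T\<rceil>)"]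
    proof eventually_elim
      case (elim n)
      then have "n \<ge> 1" "T \<le> real n" by (auto simp: nat_le_iff ceiling_le_iff)
      then show ?case using bound by simp
    qed
  qed
  then show ?thesis by (rule Lim_null[THEN iffD2])
qed

section \<open>The torus\<close>

lemma to_torus_eq_iff: "to_torus x = to_torus y \<longleftrightarrow> (\<exists>k::int. x - y = 2 * pi * of_int k)"
  by (rule torus.abs_eq_iff)

lemma to_torus_plus: "to_torus x + to_torus y = to_torus (x + y)"
  by (rule plus_torus.abs_eq)

lemma cos_to_torus [simp]: "cos_torus (to_torus x) = cos x"
  by (rule cos_torus.abs_eq)

lemma sin_to_torus [simp]: "sin_torus (to_torus x) = sin x"
  by (rule sin_torus.abs_eq)

lemma measurable_to_torus [measurable]: "to_torus \<in> borel \<rightarrow>\<^sub>M borel"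
  by (rule borel_measurableI) (simp add: open_torus_def borel_open)

lemma continuous_on_cos_torus: "continuous_on UNIV cos_torus"
  and continuous_on_sin_torus: "continuous_on UNIV sin_torus"
proof -
  have "continuous_on UNIV f" if "\<And>x. f (to_torus x) = g x" "continuous_on UNIV g"
    for f :: "torus \<Rightarrow> real" and g
  proof -
    have "to_torus -` f -` S = g -` S" for S using that(1) by auto
    moreover have "open (g -` S)" if "open S" for S using \<open>continuous_on UNIV g\<close> that by (simp add: open_vimage)
    ultimately show ?thesis by (simp add: continuous_on_open_vimage open_torus_def)
  qed
  from this[of cos_torus cos] this[of sin_torus sin]
  show "continuous_on UNIV cos_torus" "continuous_on UNIV sin_torus"
    by (simp_all add: continuous_on_cos continuous_on_sin continuous_on_id)
qed

lemma measurable_cos_torus [measurable]: "cos_torus \<in> borel_measurable borel"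
  and measurable_sin_torus [measurable]: "sin_torus \<in> borel_measurable borel"
  using continuous_on_cos_torus continuous_on_sin_torus by (auto intro: borel_measurable_continuous_onI)

lemma torus_cases: obtains x where "y = to_torus x"
proof -
  have "\<exists>x. y = to_torus x" by (induct y rule: torus.abs_induct) blast
  then show thesis using that by blast
qed

text \<open>A measurable section of the quotient map with values between \<open>- pi\<close> and
  \<open>pi\<close>; it jumps at the angle \<open>pi\<close>. It lifts an initial state to the line,
  where the dynamics is solved, and lets periodic functions on the line act as functions on the
  torus.\<close>

definition torus_angle :: "torus \<Rightarrow> real" where
  "torus_angle y = (if sin_torus y \<ge> 0 then arccos (cos_torus y) else - arccos (cos_torus y))"

lemma measurable_torus_angle [measurable]: "torus_angle \<in> borel_measurable borel"
proof -
  have "\<bar>cos_torus y\<bar> \<le> 1" for y by (cases y rule: torus_cases) simp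
  then have "continuous_on UNIV (\<lambda>y. arccos (cos_torus y))"
    by (intro continuous_on_arccos continuous_on_cos_torus) (auto simp: abs_le_iff minus_le_iff)
  then have [measurable]: "(\<lambda>y. arccos (cos_torus y)) \<in> borel_measurable borel"
    by (rule borel_measurable_continuous_onI)
  show ?thesis unfolding torus_angle_def[abs_def] by measurable
qed

lemma to_torus_angle [simp]: "to_torus (torus_angle y) = y"
proof (cases y rule: torus_cases)
  case (1 x)
  have c: "cos (torus_angle y) = cos x" by (simp add: 1 torus_angle_def)
  have s: "sin (torus_angle y) = sin x"
    by (auto simp: 1 torus_angle_def sin_arccos_abs sin_squared_eq[symmetric])
  from s c obtain n :: int where "torus_angle y = x + 2 * pi * n" using sin_cos_eq_iff by blast
  then show ?thesis unfolding 1 to_torus_eq_iff by (intro exI[of _ n]) simp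
qed

lemma per_torus_angle: "per f \<Longrightarrow> f (torus_angle (to_torus x)) = f x"
proof -
  assume f: "per f"
  have "to_torus (torus_angle (to_torus x)) = to_torus x" by simp
  then obtain k :: int where "torus_angle (to_torus x) - x = 2 * pi * of_int k" unfolding to_torus_eq_iff by blast
  then have "torus_angle (to_torus x) = x + 2 * pi * of_int k" by simp
  then show ?thesis by (simp only: per_int[OF f])
qed

section \<open>Trigonometric polynomials as test functions\<close>

lemma c21_add:
  assumes "c21 K f f1 f2" "c21 L g g1 g2"
  shows "c21 (K + L) (\<lambda>x. f x + g x) (\<lambda>x. f1 x + g1 x) (\<lambda>x. f2 x + g2 x)"
proof -
  have t: "\<bar>a + b\<bar> \<le> K' + L'" if "\<bar>a\<bar> \<le> K'" "\<bar>b\<bar> \<le> L'" for a b K' L' :: real using that by linarith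
  have "\<bar>f2 x + g2 x - (f2 y + g2 y)\<bar> \<le> (K + L) * \<bar>x - y\<bar>" for x y
    using t[OF c21D(6)[OF assms(1)] c21D(6)[OF assms(2)], of x y x y] by (simp add: distrib_right algebra_simps)
  then show ?thesis using assms unfolding c21_def by (auto intro!: DERIV_add t)
qed

lemma lipschitz_mult:
  fixes f g :: "real \<Rightarrow> real"
  assumes "\<And>x. \<bar>f x\<bar> \<le> K" "\<And>x. \<bar>g x\<bar> \<le> L" "\<And>x y. \<bar>f x - f y\<bar> \<le> K * \<bar>x - y\<bar>" "\<And>x y. \<bar>g x - g y\<bar> \<le> L * \<bar>x - y\<bar>"
  shows "\<bar>f x * g x - f y * g y\<bar> \<le> 2 * K * L * \<bar>x - y\<bar>"
proof -
  have nn: "0 \<le> K" "0 \<le> L" using assms(1)[of 0] assms(2)[of 0] by linarith+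
  have "f x * g x - f y * g y = (f x - f y) * g x + f y * (g x - g y)" by (simp add: algebra_simps)
  then have "\<bar>f x * g x - f y * g y\<bar> \<le> \<bar>f x - f y\<bar> * \<bar>g x\<bar> + \<bar>f y\<bar> * \<bar>g x - g y\<bar>"
    by (simp only: abs_mult[symmetric] abs_triangle_ineq)
  also have "\<dots> \<le> (K * \<bar>x - y\<bar>) * L + K * (L * \<bar>x - y\<bar>)"
    using nn by (intro add_mono mult_mono assms) auto
  finally show ?thesis by (simp add: algebra_simps)
qed

text \<open>The factor 8 counts the four products in the second derivative, each with Lipschitz
  constant \<open>2 * K * L\<close> by \<open>lipschitz_mult\<close>.\<close>

lemma c21_mult:
  assumes f: "c21 K f f1 f2" and g: "c21 L g g1 g2"
  shows "c21 (8 * K * L) (\<lambda>x. f x * g x) (\<lambda>x. f1 x * g x + f x * g1 x) (\<lambda>x. (f2 x * g x + f1 x * g1 x) + (f1 x * g1 x + f x * g2 x))"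
proof -
  note nn = c21_nonneg[OF f] c21_nonneg[OF g]
  have KL: "0 \<le> K * L" using nn by simp
  have b: "\<bar>a * b\<bar> \<le> K * L" if "\<bar>a\<bar> \<le> K" "\<bar>b\<bar> \<le> L" for a b
    unfolding abs_mult using that nn by (intro mult_mono) auto
  note F = c21D[OF f] c21_lipschitz[OF f] and G = c21D[OF g] c21_lipschitz[OF g]
  have l: "\<bar>(f2 x * g x + f1 x * g1 x) + (f1 x * g1 x + f x * g2 x) - ((f2 y * g y + f1 y * g1 y) + (f1 y * g1 y + f y * g2 y))\<bar>
      \<le> 8 * K * L * \<bar>x - y\<bar>" for x y
    using lipschitz_mult[OF F(5) G(3) F(6) G(7), of x y] lipschitz_mult[OF F(4) G(4) F(8) G(8), of x y]
      lipschitz_mult[OF F(3) G(5) F(7) G(6), of x y] by linarith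
  have d: "((\<lambda>x. f x * g x) has_real_derivative f1 x * g x + f x * g1 x) (at x)" for x
    using DERIV_mult[OF F(1) G(1), of x] by (simp add: mult_ac)
  have d1: "((\<lambda>x. f1 x * g x + f x * g1 x) has_real_derivative (f2 x * g x + f1 x * g1 x) + (f1 x * g1 x + f x * g2 x)) (at x)" for x
    using DERIV_add[OF DERIV_mult[OF F(2) G(1), of x] DERIV_mult[OF F(1) G(2), of x]] by (simp add: mult_ac)
  have "\<bar>f x * g x\<bar> \<le> 8 * K * L" "\<bar>f1 x * g x + f x * g1 x\<bar> \<le> 8 * K * L"
    "\<bar>(f2 x * g x + f1 x * g1 x) + (f1 x * g1 x + f x * g2 x)\<bar> \<le> 8 * K * L" for x
    using b[OF F(3) G(3), of x x] b[OF F(4) G(3), of x x] b[OF F(3) G(4), of x x] b[OF F(5) G(3), of x x]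
      b[OF F(4) G(4), of x x] b[OF F(3) G(5), of x x] KL by linarith+
  then show ?thesis unfolding c21_def using d d1 l by blast
qed

lemma c21_const: "c21 \<bar>c\<bar> (\<lambda>x. c) (\<lambda>x. 0) (\<lambda>x. 0)"
  by (auto simp: c21_def)

lemma c21_cos: "c21 1 cos (\<lambda>x. - sin x) (\<lambda>x. - cos x)" and c21_sin: "c21 1 sin cos (\<lambda>x. - sin x)"
proof -
  have l: "\<bar>sin x - sin y\<bar> \<le> 1 * \<bar>x - y\<bar>" "\<bar>cos x - cos y\<bar> \<le> 1 * \<bar>x - y\<bar>" for x y :: real
    by (rule bounded_deriv_lipschitz[of _ cos], auto intro!: derivative_eq_intros)
       (rule bounded_deriv_lipschitz[of _ "\<lambda>x. - sin x" 1, simplified], auto intro!: derivative_eq_intros)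
  show "c21 1 cos (\<lambda>x. - sin x) (\<lambda>x. - cos x)" "c21 1 sin cos (\<lambda>x. - sin x)"
    using l l[of y x for x y] by (auto simp: c21_def abs_minus_commute intro!: derivative_eq_intros)
qed

text \<open>Supplies the approximants of Stone-Weierstrass on the circle. A real linear function on
  the plane becomes a combination of \<open>cos\<close> and \<open>sin\<close> along
  \<open>cis\<close>, and the class is closed under sums and products.\<close>

lemma c21_polynomial_cis:
  fixes q :: "complex \<Rightarrow> real"
  assumes "real_polynomial_function q"
  shows "\<exists>K f1 f2. c21 K (\<lambda>x. q (cis x)) f1 f2"
  using assms
proof (induction rule: real_polynomial_function.induct)
  case (linear q)
  have q: "q (cis x) = cos x * q 1 + sin x * q \<i>" for x
  proof -
    have "cis x = cos x *\<^sub>R 1 + sin x *\<^sub>R \<i>" by (simp add: complex_eq_iff)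
    then show ?thesis using linear by (simp add: linear_simps)
  qed
  show ?case unfolding q
    using c21_add[OF c21_mult[OF c21_cos c21_const[of "q 1"]] c21_mult[OF c21_sin c21_const[of "q \<i>"]]] by blast
next
  case (const c) then show ?case using c21_const by blast
next
  case (add f g) then show ?case using c21_add by blast
next
  case (mult f g) then show ?case using c21_mult by blast
qed

text \<open>Every open set of the torus is the preimage of the complement of a compact set \<open>C\<close> in the
  plane, so its indicator is a pointwise limit of functions continuous on the circle, which in turn are uniform
  limits of trigonometric polynomials.\<close>

lemma torus_measure_eqI:
  assumes m: "prob_space m" "sets m = sets (borel :: torus measure)" and n: "prob_space n" "sets n = sets (borel :: torus measure)"
    and eq: "\<And>K f f1 f2. c21 K f f1 f2 \<Longrightarrow> per f \<Longrightarrow> (\<integral>y. f (torus_angle y) \<partial>m) = (\<integral>y. f (torus_angle y) \<partial>n)"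
  shows "m = n"
proof -
  interpret m: prob_space m by fact
  interpret n: prob_space n by fact
  have [measurable_cong]: "sets m = sets borel" "sets n = sets borel" by fact+
  define e where "e y = cis (torus_angle y)" for y
  have e_to: "e (to_torus x) = cis x" for x
    unfolding e_def by (rule per_torus_angle) (simp add: per_def complex_eq_iff)
  have "continuous_on UNIV cis" by (intro continuous_intros)
  then have [measurable]: "cis \<in> borel_measurable borel" by (rule borel_measurable_continuous_onI)
  have [measurable]: "e \<in> borel_measurable borel" unfolding e_def[abs_def] by measurable
  have enorm: "e y \<in> sphere 0 1" for y by (simp add: e_def)
  \<comment> \<open>The map \<open>e\<close> takes values on the unit circle only, so a polynomial
    that is uniformly close to \<open>G\<close> there changes either integral by at most
    \<open>\<epsilon>\<close>.\<close>
  have cont_eq: "(\<integral>y. G (e y) \<partial>m) = (\<integral>y. G (e y) \<partial>n)"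
    if G: "continuous_on UNIV G" and Gb: "\<And>z. \<bar>G z\<bar> \<le> 1" for G :: "complex \<Rightarrow> real"
  proof -
    have [measurable]: "G \<in> borel_measurable borel" using G by (rule borel_measurable_continuous_onI)
    have iG: "integrable m (\<lambda>y. G (e y))" "integrable n (\<lambda>y. G (e y))"
      using Gb by (auto intro!: m.integrable_bounded n.integrable_bounded)
    have close: "\<bar>(\<integral>y. G (e y) \<partial>m) - (\<integral>y. G (e y) \<partial>n)\<bar> \<le> 2 * \<epsilon>" if \<epsilon>: "\<epsilon> > 0" for \<epsilon>
    proof -
      obtain q where q: "real_polynomial_function q" "\<And>z. z \<in> sphere 0 1 \<Longrightarrow> \<bar>G z - q z\<bar> < \<epsilon>"
        using Stone_Weierstrass_real_polynomial_function[OF compact_sphere[of "0::complex" 1] continuous_on_subset[OF G subset_UNIV] \<epsilon>]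
        by blast
      obtain K f1 f2 where c: "c21 K (\<lambda>x. q (cis x)) f1 f2" using c21_polynomial_cis[OF q(1)] by blast
      have p: "per (\<lambda>x. q (cis x))" unfolding per_def
        by (simp add: cis_mult[symmetric])
      note [measurable] = c21_measurable(1)[OF c]
      have qe: "q (e y) = (\<lambda>x. q (cis x)) (torus_angle y)" for y by (simp add: e_def)
      have mq: "(\<lambda>y. q (e y)) \<in> borel_measurable borel" unfolding qe by measurable
      have iq: "integrable m (\<lambda>y. q (e y))" "integrable n (\<lambda>y. q (e y))"
        using mq c21D(3)[OF c] unfolding e_def
        by (auto intro!: m.integrable_bounded n.integrable_bounded simp: measurable_cong_sets[OF m(2) refl] measurable_cong_sets[OF n(2) refl])
      have "\<bar>(\<integral>y. G (e y) \<partial>m) - (\<integral>y. q (e y) \<partial>m)\<bar> \<le> \<epsilon>"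
        by (rule m.integral_diff_le_const[OF iG(1) iq(1)]) (use q(2)[OF enorm] in \<open>auto intro: less_imp_le\<close>)
      moreover have "\<bar>(\<integral>y. G (e y) \<partial>n) - (\<integral>y. q (e y) \<partial>n)\<bar> \<le> \<epsilon>"
        by (rule n.integral_diff_le_const[OF iG(2) iq(2)]) (use q(2)[OF enorm] in \<open>auto intro: less_imp_le\<close>)
      moreover have "(\<integral>y. q (e y) \<partial>m) = (\<integral>y. q (e y) \<partial>n)" using eq[OF c p] by (simp add: e_def)
      ultimately show ?thesis by linarith
    qed
    have "\<bar>(\<integral>y. G (e y) \<partial>m) - (\<integral>y. G (e y) \<partial>n)\<bar> \<le> 0 + d" if "d > 0" for d
      using close[of "d / 2"] that by simp
    then have "\<bar>(\<integral>y. G (e y) \<partial>m) - (\<integral>y. G (e y) \<partial>n)\<bar> \<le> 0" by (rule field_le_epsilon)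
    then show ?thesis by simp
  qed
  have open_eq: "emeasure m S = emeasure n S" if S: "open S" for S
  proof (cases "S = UNIV")
    case True then show ?thesis using m.emeasure_space_1 n.emeasure_space_1 sets_eq_imp_space_eq[OF m(2)] sets_eq_imp_space_eq[OF n(2)] by simp
  next
    case False
    \<comment> \<open>The image under \<open>e\<close> of the complement of \<open>S\<close>. One
      closed period reaches every point of the torus, and its compactness makes \<open>C\<close>
      closed.\<close>
    define C where "C = cis ` ({-pi..-pi + 2 * pi} - to_torus -` S)"
    have O: "open (to_torus -` S)" using S by (simp add: open_torus_def)
    have "compact C" unfolding C_def
      by (intro compact_continuous_image compact_diff compact_Icc O continuous_intros)
    then have Ccl: "closed C" by (rule compact_imp_closed)
    have mem: "e y \<in> C \<longleftrightarrow> y \<notin> S" for y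
    proof (cases y rule: torus_cases)
      case (1 x)
      have "y \<notin> S" if "e y \<in> C"
      proof -
        from that obtain z where z: "cis x = cis z" "to_torus z \<notin> S" unfolding C_def 1 e_to by auto
        then have "sin x = sin z \<and> cos x = cos z" by (metis cis.sel)
        then obtain k :: int where "x = z + 2 * pi * k" using sin_cos_eq_iff by blast
        then have "to_torus x = to_torus z" unfolding to_torus_eq_iff by (intro exI[of _ k]) simp
        then show ?thesis using z 1 by simp
      qed
      moreover have "e y \<in> C" if "y \<notin> S"
      proof -
        obtain j :: int where j: "x + 2 * pi * of_int j \<in> {-pi..-pi + 2 * pi}" using shift_into_period[of x "-pi"] by blast
        have "to_torus (x + 2 * pi * of_int j) = y" unfolding 1 to_torus_eq_iff by (intro exI[of _ j]) simp
        then have "e y = cis (x + 2 * pi * of_int j)" using e_to by metis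
        then show ?thesis unfolding C_def using j that \<open>to_torus (x + 2 * pi * of_int j) = y\<close> by blast
      qed
      ultimately show ?thesis by blast
    qed
    from False obtain y0 where "y0 \<notin> S" by blast
    then have Cne: "C \<noteq> {}" using mem by blast
    \<comment> \<open>Truncated multiples of the distance to \<open>C\<close>. The distance to the
      empty set is 0 by convention, which is why \<open>S = UNIV\<close> is treated apart.\<close>
    define G where "G i z = min 1 (real i * infdist z C)" for i z
    have Gc: "continuous_on UNIV (G i)" for i unfolding G_def[abs_def] by (intro continuous_intros)
    have Gb: "\<bar>G i z\<bar> \<le> 1" for i z by (auto simp: G_def infdist_nonneg)
    have lim: "(\<lambda>i. G i (e y)) \<longlonglongrightarrow> indicator S y" for y
    proof (cases "y \<in> S")
      case True
      then have "infdist (e y) C > 0" using mem Cne Ccl infdist_pos_not_in_closed by blast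
      moreover define d where "d = infdist (e y) C"
      ultimately have d: "d > 0" by simp
      have "\<forall>\<^sub>F i in sequentially. G i (e y) = 1"
        using eventually_ge_at_top[of "nat \<lceil>1 / d\<rceil>"]
      proof eventually_elim
        case (elim i)
        then have "1 / d \<le> real i" by linarith
        then show ?case using d by (simp add: G_def d_def[symmetric] pos_divide_le_eq)
      qed
      then have "(\<lambda>i. G i (e y)) \<longlonglongrightarrow> 1" by (rule tendsto_eventually)
      then show ?thesis using True by simp
    next
      case False
      then have "G i (e y) = 0" for i using mem by (simp add: G_def)
      then show ?thesis using False by simp
    qed
    have Sm [measurable]: "S \<in> sets borel" using S by simp
    have Gm [measurable]: "G i \<in> borel_measurable borel" for i using Gc by (rule borel_measurable_continuous_onI)
    have "(\<lambda>i. \<integral>y. G i (e y) \<partial>m) \<longlonglongrightarrow> (\<integral>y. indicator S y \<partial>m)"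
      by (rule integral_dominated_convergence[where w = "\<lambda>_. 1"]) (use lim Gb in auto)
    moreover have "(\<lambda>i. \<integral>y. G i (e y) \<partial>n) \<longlonglongrightarrow> (\<integral>y. indicator S y \<partial>n)"
      by (rule integral_dominated_convergence[where w = "\<lambda>_. 1"]) (use lim Gb in auto)
    ultimately have "(\<integral>y. indicator S y \<partial>m) = (\<integral>y. indicator S y \<partial>n :: real)"
      using cont_eq[OF Gc Gb] by (simp add: LIMSEQ_unique)
    then have "measure m S = measure n S"
      using sets_eq_imp_space_eq[OF m(2)] sets_eq_imp_space_eq[OF n(2)] by simp
    then show ?thesis by (simp add: m.emeasure_eq_measure n.emeasure_eq_measure)
  qed
  show ?thesis
  proof (rule measure_eqI_generator_eq[of "Collect open" UNIV])
    show "Int_stable (Collect open)" by (auto simp: Int_stable_def)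
    show "sets m = sigma_sets UNIV (Collect open)" "sets n = sigma_sets UNIV (Collect open)"
      using m(2) n(2) by (simp_all add: borel_def)
    show "range (\<lambda>_::nat. UNIV :: torus set) \<subseteq> Collect open" by simp
    show "(\<Union>i::nat. UNIV :: torus set) = UNIV" by simp
    show "emeasure m UNIV \<noteq> \<infinity>" for i :: nat by simp
  qed (use open_eq in auto)
qed

section \<open>Brownian motion and stochastic differential equations with additive noise\<close>

text \<open>With additive noise, \<open>y = X - x - w\<close> solves an ordinary equation with
  continuous right-hand side, for each path separately. Freezing \<open>w\<close> at its initial
  value for negative times extends the equation to the whole line, where \<open>ode_exists\<close>
  works.\<close>

lemma path_ode:
  assumes b: "c21 L b b1 b2" and w: "continuous_on {0..} w"
  obtains y where "y 0 = 0" "\<And>t. (y has_real_derivative b (x + y t + w (max t 0))) (at t)"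
proof -
  have wc: "continuous_on UNIV (\<lambda>t. w (max t 0))"
    by (rule continuous_on_compose2[OF w]) (auto intro!: continuous_intros)
  have bc: "continuous_on UNIV b" by (rule c21_measurable(4)[OF b])
  let ?f = "\<lambda>t y. b (x + y + w (max t 0))"
  have 1: "continuous_on UNIV (\<lambda>t. ?f t (z t))" if "continuous_on UNIV z" for z
    by (rule continuous_on_compose2[OF bc]) (auto intro!: continuous_intros that wc)
  have 2: "norm (?f t p - ?f t q) \<le> L * norm (p - q)" for t p q
    using c21_lipschitz(1)[OF b, of "x + p + w (max t 0)" "x + q + w (max t 0)"] by simp
  have 3: "norm (?f t 0) \<le> L" for t using c21D(3)[OF b] by simp
  obtain y where "y 0 = 0" "\<And>t. (y has_vector_derivative ?f t (y t)) (at t)"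
    using ode_exists[of ?f L L 0, OF 1 2 3] by blast
  then show thesis using that unfolding has_real_derivative_iff_has_vector_derivative by blast
qed

primrec euler :: "(real \<Rightarrow> real) \<Rightarrow> real \<Rightarrow> (real \<Rightarrow> real) \<Rightarrow> real \<Rightarrow> nat \<Rightarrow> real" where
  "euler b h w x 0 = x"
| "euler b h w x (Suc k) = euler b h w x k + h * b (euler b h w x k) + (w (real (Suc k) * h) - w (real k * h))"

text \<open>The noise path is merely continuous, so there is no rate: the modulus of uniform
  continuity of the solution on \<open>{0..T}\<close> takes its place. The limit transfers
  adaptedness and laws from the scheme to the solution.\<close>

lemma euler_tendsto:
  assumes b: "c21 L b b1 b2" and w: "continuous_on {0..} w" "w 0 = 0"
    and y: "y 0 = 0" "\<And>t. (y has_real_derivative b (x + y t + w (max t 0))) (at t)"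
    and T: "T > 0"
  shows "(\<lambda>n. euler b (T / real n) w x n) \<longlonglongrightarrow> x + y T + w T"
proof -
  define X where "X t = x + y t + w t" for t
  note L = c21_nonneg[OF b]
  have yc: "continuous_on UNIV y" by (rule DERIV_continuous_on[OF has_field_derivative_at_within[OF y(2)]])
  have Xc: "continuous_on {0..T} X" unfolding X_def
    by (intro continuous_intros continuous_on_subset[OF yc] continuous_on_subset[OF w(1)]) auto
  have unif: "uniformly_continuous_on {0..T} X" by (rule compact_uniformly_continuous[OF Xc compact_Icc])
  show ?thesis
  proof (rule metric_LIMSEQ_I)
    fix r :: real assume r: "r > 0"
    \<comment> \<open>The discrete Gronwall argument inflates \<open>\<epsilon>\<close> by at most
      \<open>exp (L * T)\<close>.\<close>
    define \<epsilon> where "\<epsilon> = r / exp (L * T)"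
    have \<epsilon>: "\<epsilon> > 0" using r by (simp add: \<epsilon>_def)
    obtain d where d: "d > 0" "\<And>s t. s \<in> {0..T} \<Longrightarrow> t \<in> {0..T} \<Longrightarrow> dist t s < d \<Longrightarrow> dist (X t) (X s) < \<epsilon>"
      using uniformly_continuous_onE[OF unif \<epsilon>] by metis
    have "\<forall>n\<ge>max 1 (nat \<lceil>T / d\<rceil> + 1). dist (euler b (T / real n) w x n) (X T) < r"
    proof (intro allI impI)
      fix n assume n: "max 1 (nat \<lceil>T / d\<rceil> + 1) \<le> n"
      define h where "h = T / real n"
      have n1: "real n > 0" "T / d < real n" using n by linarith+
      have h: "h > 0" "h < d" "real n * h = T" using T n1 d(1) by (auto simp: h_def field_simps)
      define e where "e k = \<bar>X (real k * h) - euler b h w x k\<bar>" for k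
      \<comment> \<open>Adding \<open>\<epsilon>\<close> to the error absorbs the oscillation of the
        solution within a step and makes the recursion homogeneous.\<close>
      have step: "e (Suc k) + \<epsilon> \<le> (1 + L * h) * (e k + \<epsilon>)" if k: "Suc k \<le> n" for k
      proof -
        have kh: "real (Suc k) * h \<le> T" using k h by (metis less_imp_le mult_right_mono of_nat_le_iff)
        have lt: "real k * h < real (Suc k) * h" using h by simp
        obtain z where z: "real k * h < z" "z < real (Suc k) * h"
          "y (real (Suc k) * h) - y (real k * h) = (real (Suc k) * h - real k * h) * b (x + y z + w (max z 0))"
          using MVT2[OF lt y(2)] by blast
        have z0: "0 \<le> real k * h" using h by simp
        then have zm: "b (x + y z + w (max z 0)) = b (X z)" using z(1) by (simp add: X_def max_absorb1)
        have hk: "real (Suc k) * h - real k * h = h" by (simp add: algebra_simps)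
        have "0 \<le> z" "z \<le> T" "real k * h \<le> T" "\<bar>z - real k * h\<bar> < d" using z(1,2) z0 kh lt hk h(2) by linarith+
        then have "dist (X z) (X (real k * h)) < \<epsilon>"
          using z0 by (intro d(2)) (simp_all add: dist_real_def)
        then have "\<bar>b (X z) - b (X (real k * h))\<bar> \<le> L * \<epsilon>"
          using L by (intro order_trans[OF c21_lipschitz(1)[OF b]] mult_left_mono) (auto simp: dist_real_def)
        moreover have "\<bar>b (X (real k * h)) - b (euler b h w x k)\<bar> \<le> L * e k"
          unfolding e_def by (rule c21_lipschitz(1)[OF b])
        ultimately have "\<bar>b (X z) - b (euler b h w x k)\<bar> \<le> L * (e k + \<epsilon>)" by (simp add: distrib_left)
        then have bb: "h * \<bar>b (X z) - b (euler b h w x k)\<bar> \<le> h * (L * (e k + \<epsilon>))" using h by (intro mult_left_mono) auto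
        have "X (real (Suc k) * h) - euler b h w x (Suc k)
            = (X (real k * h) - euler b h w x k) + h * (b (X z) - b (euler b h w x k))"
          using z(3) unfolding zm hk by (simp add: X_def algebra_simps)
        then have "e (Suc k) \<le> e k + h * \<bar>b (X z) - b (euler b h w x k)\<bar>"
          unfolding e_def using h abs_triangle_ineq[of "X (real k * h) - euler b h w x k" "h * (b (X z) - b (euler b h w x k))"]
          by (simp only: abs_mult abs_of_pos)
        then show ?thesis using bb by (simp add: algebra_simps)
      qed
      have ind: "e k + \<epsilon> \<le> (1 + L * h) ^ k * \<epsilon>" if "k \<le> n" for k
        using that
      proof (induction k)
        case 0 then show ?case by (simp add: e_def X_def y(1) w(2))
      next
        case (Suc k)
        have "e (Suc k) + \<epsilon> \<le> (1 + L * h) * (e k + \<epsilon>)" by (rule step[OF Suc.prems])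
        also have "\<dots> \<le> (1 + L * h) * ((1 + L * h) ^ k * \<epsilon>)" using Suc L h by (intro mult_left_mono) auto
        finally show ?case by (simp add: mult.assoc)
      qed
      have "(1 + L * h) ^ n \<le> exp (L * h) ^ n" using L h by (intro power_mono exp_ge_add_one_self) auto
      also have "\<dots> = exp (L * T)" unfolding exp_of_nat_mult[symmetric] using h(3) by (simp add: mult_ac)
      finally have "(1 + L * h) ^ n * \<epsilon> \<le> exp (L * T) * \<epsilon>" using \<epsilon> by (intro mult_right_mono) auto
      then have "e n + \<epsilon> \<le> r" using ind[of n] by (simp add: \<epsilon>_def)
      then have "e n < r" using \<epsilon> by simp
      then show "dist (euler b (T / real n) w x n) (X T) < r"
        unfolding e_def h(3) by (simp add: dist_real_def h_def[symmetric] abs_minus_commute)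
    qed
    then show "\<exists>no. \<forall>n\<ge>no. dist (euler b (T / real n) w x n) (x + y T + w T) < r" unfolding X_def by blast
  qed
qed

lemma measurable_gauss_avg:
  assumes [measurable]: "g \<in> borel_measurable borel"
  shows "gauss_avg s g \<in> borel_measurable borel"
proof -
  interpret N: prob_space stdN by (rule prob_space_stdN)
  show ?thesis unfolding gauss_avg_def[abs_def] by measurable
qed

lemma euler_op_bounded_measurable:
  assumes b: "c21 L b b1 b2" and g: "g \<in> borel_measurable borel" "\<And>x. \<bar>g x\<bar> \<le> K"
  shows "euler_op b s h g \<in> borel_measurable borel" "\<bar>euler_op b s h g x\<bar> \<le> K"
proof -
  interpret N: prob_space stdN by (rule prob_space_stdN)
  note [measurable] = c21_measurable(1)[OF b] measurable_gauss_avg[OF g(1)] g(1)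
  show "euler_op b s h g \<in> borel_measurable borel" unfolding euler_op_def[abs_def] by measurable
  show "\<bar>euler_op b s h g x\<bar> \<le> K" unfolding euler_op_def gauss_avg_def
    by (rule N.abs_integral_le_const) (use g in auto)
qed

lemma distributed_normal_eq_stdN:
  assumes "distributed M lborel X (normal_density 0 s)" "s > 0"
  shows "distr M borel X = distr stdN borel (\<lambda>z. s * z)"
proof -
  interpret N: prob_space stdN by (rule prob_space_stdN)
  have "distributed stdN lborel (\<lambda>z. z) (normal_density 0 1)"
    unfolding distributed_def by (auto simp: stdN_def distr_id2[of lborel] intro!: distr_id2)
  from N.normal_density_affine[OF this, of s 0] assms(2)
  have "distributed stdN lborel (\<lambda>z. s * z) (normal_density 0 s)" by simp
  then have "distr stdN lborel (\<lambda>z. s * z) = distr M lborel X"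
    using assms(1) by (simp add: distributed_def)
  moreover have "distr stdN lborel (\<lambda>z. s * z) = distr stdN borel (\<lambda>z. s * z)" "distr M lborel X = distr M borel X"
    by (auto intro!: distr_cong)
  ultimately show ?thesis by simp
qed

text \<open>Every path is continuous and starts at 0, since the state equation is solved path by
  path. Independence is stated for real variables measurable at time \<open>s\<close>, and
  increments have the law of a scaled standard normal variable, which is how both are used
  below.\<close>

locale cont_brownian = prob_space M + filtration "space M" F
  for M :: "'w measure" and F :: "real \<Rightarrow> 'w measure" +
  fixes B :: "real \<Rightarrow> 'w \<Rightarrow> real"
  assumes sub_F: "\<And>t. 0 \<le> t \<Longrightarrow> subalgebra M (F t)"
    and B_adapted: "\<And>t. 0 \<le> t \<Longrightarrow> B t \<in> borel_measurable (F t)"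
    and B_zero: "\<And>\<omega>. B 0 \<omega> = 0"
    and B_cont: "\<And>\<omega>. continuous_on {0..} (\<lambda>t. B t \<omega>)"
    and B_indep: "\<And>s t Y. 0 \<le> s \<Longrightarrow> s < t \<Longrightarrow> Y \<in> borel_measurable (F s) \<Longrightarrow>
      indep_var borel Y borel (\<lambda>\<omega>. B t \<omega> - B s \<omega>)"
    and B_law: "\<And>s t. 0 \<le> s \<Longrightarrow> s < t \<Longrightarrow>
      distr M borel (\<lambda>\<omega>. B t \<omega> - B s \<omega>) = distr stdN borel (\<lambda>z. sqrt (t - s) * z)"
begin

lemma F_mono: "s \<le> t \<Longrightarrow> Y \<in> measurable (F s) N \<Longrightarrow> Y \<in> measurable (F t) N"
  using sets_F_mono[of s t] space_F unfolding measurable_def by auto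

lemma F_into_M: "0 \<le> t \<Longrightarrow> Y \<in> measurable (F t) N \<Longrightarrow> Y \<in> measurable M N"
  using sub_F[of t] unfolding measurable_def subalgebra_def by auto

lemma measurable_B [measurable]: "0 \<le> t \<Longrightarrow> B t \<in> borel_measurable M"
  by (rule F_into_M[OF _ B_adapted])

text \<open>Conditioning on the past without conditional expectations: the joint law of
  \<open>Y\<close> and the increment is a product measure, so Fubini integrates the increment out
  with \<open>Y\<close> fixed.\<close>

lemma indep_expectation:
  fixes g :: "real \<Rightarrow> real \<Rightarrow> real"
  assumes st: "0 \<le> s" "s < t" and Y: "Y \<in> borel_measurable (F s)"
    and g: "(\<lambda>(x, z). g x z) \<in> borel_measurable (borel \<Otimes>\<^sub>M borel)" "\<And>x z. \<bar>g x z\<bar> \<le> K"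
  shows "(\<integral>\<omega>. g (Y \<omega>) (B t \<omega> - B s \<omega>) \<partial>M) = (\<integral>\<omega>. (\<integral>z. g (Y \<omega>) (sqrt (t - s) * z) \<partial>stdN) \<partial>M)"
proof -
  let ?D = "\<lambda>\<omega>. B t \<omega> - B s \<omega>"
  interpret N: prob_space stdN by (rule prob_space_stdN)
  have YM [measurable]: "Y \<in> borel_measurable M" by (rule F_into_M[OF st(1) Y])
  have [measurable]: "B s \<in> borel_measurable M" "B t \<in> borel_measurable M"
    using measurable_B[of s] measurable_B[of t] st by simp_all
  have DM [measurable]: "?D \<in> borel_measurable M" by measurable
  note [measurable] = g(1)
  interpret PY: prob_space "distr M borel Y" by (rule prob_space_distr) simp
  interpret PD: prob_space "distr M borel ?D" by (rule prob_space_distr) simp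
  interpret P: pair_prob_space "distr M borel Y" "distr M borel ?D" ..
  have eq: "distr M borel Y \<Otimes>\<^sub>M distr M borel ?D = distr M (borel \<Otimes>\<^sub>M borel) (\<lambda>\<omega>. (Y \<omega>, ?D \<omega>))"
    using B_indep[OF st Y] unfolding indep_var_distribution_eq by blast
  have int: "integrable (distr M borel Y \<Otimes>\<^sub>M distr M borel ?D) (\<lambda>(x, z). g x z)"
    using g(2) by (intro P.integrable_bounded) (auto simp: split_beta)
  have "(\<integral>\<omega>. g (Y \<omega>) (?D \<omega>) \<partial>M) = (\<integral>p. (\<lambda>(x, z). g x z) p \<partial>distr M (borel \<Otimes>\<^sub>M borel) (\<lambda>\<omega>. (Y \<omega>, ?D \<omega>)))"
    by (subst integral_distr) auto
  also have "\<dots> = (\<integral>x. (\<integral>z. g x z \<partial>distr M borel ?D) \<partial>distr M borel Y)"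
    unfolding eq[symmetric] using P.integral_fst'[OF int] by simp
  also have "\<dots> = (\<integral>x. (\<integral>z. g x (sqrt (t - s) * z) \<partial>stdN) \<partial>distr M borel Y)"
    unfolding B_law[OF st] by (subst integral_distr) auto
  also have "\<dots> = (\<integral>\<omega>. (\<integral>z. g (Y \<omega>) (sqrt (t - s) * z) \<partial>stdN) \<partial>M)"
    by (subst integral_distr) auto
  finally show ?thesis .
qed

lemma increment_power:
  assumes st: "0 \<le> s" "s < t"
  shows "integrable M (\<lambda>\<omega>. (B t \<omega> - B s \<omega>) ^ k)"
    and "(\<integral>\<omega>. (B t \<omega> - B s \<omega>) ^ k \<partial>M) = sqrt (t - s) ^ k * (\<integral>z. z ^ k \<partial>stdN)"
proof -
  have [measurable]: "B s \<in> borel_measurable M" "B t \<in> borel_measurable M"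
    using measurable_B[of s] measurable_B[of t] st by simp_all
  have DM [measurable]: "(\<lambda>\<omega>. B t \<omega> - B s \<omega>) \<in> borel_measurable M" by measurable
  have "integrable stdN (\<lambda>z. (sqrt (t - s) * z) ^ k)"
    unfolding power_mult_distrib using integrable_stdN_power by simp
  then have "integrable (distr M borel (\<lambda>\<omega>. B t \<omega> - B s \<omega>)) (\<lambda>x. x ^ k)"
    unfolding B_law[OF st] by (subst integrable_distr_eq) auto
  then show "integrable M (\<lambda>\<omega>. (B t \<omega> - B s \<omega>) ^ k)" by (subst (asm) integrable_distr_eq) auto
  have "(\<integral>\<omega>. (B t \<omega> - B s \<omega>) ^ k \<partial>M) = (\<integral>x. x ^ k \<partial>distr M borel (\<lambda>\<omega>. B t \<omega> - B s \<omega>))"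
    by (subst integral_distr) auto
  also have "\<dots> = (\<integral>z. (sqrt (t - s) * z) ^ k \<partial>stdN)"
    unfolding B_law[OF st] by (subst integral_distr) auto
  finally show "(\<integral>\<omega>. (B t \<omega> - B s \<omega>) ^ k \<partial>M) = sqrt (t - s) ^ k * (\<integral>z. z ^ k \<partial>stdN)"
    by (simp add: power_mult_distrib)
qed

lemma increment_moments:
  assumes st: "0 \<le> s" "s < t"
  shows "(\<integral>\<omega>. (B t \<omega> - B s \<omega>) \<partial>M) = 0" "(\<integral>\<omega>. (B t \<omega> - B s \<omega>)\<^sup>2 \<partial>M) = t - s"
    "(\<integral>\<omega>. (B t \<omega> - B s \<omega>) ^ 4 \<partial>M) = 3 * (t - s)\<^sup>2"
proof -
  have s4: "sqrt (t - s) ^ 4 = (t - s)\<^sup>2" using st power_mult[of "sqrt (t - s)" 2 2] by simp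
  show "(\<integral>\<omega>. (B t \<omega> - B s \<omega>) \<partial>M) = 0" "(\<integral>\<omega>. (B t \<omega> - B s \<omega>)\<^sup>2 \<partial>M) = t - s"
    "(\<integral>\<omega>. (B t \<omega> - B s \<omega>) ^ 4 \<partial>M) = 3 * (t - s)\<^sup>2"
    using increment_power(2)[OF st, of 1] increment_power(2)[OF st, of 2] increment_power(2)[OF st, of 4] st
    by (simp_all add: stdN_moments s4)
qed

lemma increment_power_product:
  assumes st: "0 \<le> s" "s < t" and Y: "Y \<in> borel_measurable (F s)" "\<And>\<omega>. \<bar>Y \<omega>\<bar> \<le> K"
  shows "integrable M (\<lambda>\<omega>. Y \<omega> * (B t \<omega> - B s \<omega>) ^ k)"
    and "(\<integral>\<omega>. Y \<omega> * (B t \<omega> - B s \<omega>) ^ k \<partial>M) = (\<integral>\<omega>. Y \<omega> \<partial>M) * (\<integral>\<omega>. (B t \<omega> - B s \<omega>) ^ k \<partial>M)"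
proof -
  have "indep_var borel ((\<lambda>x. x) \<circ> Y) borel ((\<lambda>x. x ^ k) \<circ> (\<lambda>\<omega>. B t \<omega> - B s \<omega>))"
    by (rule indep_var_compose[OF B_indep[OF st Y(1)]]) auto
  then have i: "indep_var borel Y borel (\<lambda>\<omega>. (B t \<omega> - B s \<omega>) ^ k)" by (simp add: o_def)
  have iY: "integrable M Y" by (rule integrable_bounded[OF F_into_M[OF st(1) Y(1)] Y(2)])
  show "integrable M (\<lambda>\<omega>. Y \<omega> * (B t \<omega> - B s \<omega>) ^ k)"
    and "(\<integral>\<omega>. Y \<omega> * (B t \<omega> - B s \<omega>) ^ k \<partial>M) = (\<integral>\<omega>. Y \<omega> \<partial>M) * (\<integral>\<omega>. (B t \<omega> - B s \<omega>) ^ k \<partial>M)"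
    by (rule indep_var_integrable[OF i iY increment_power(1)[OF st]], rule indep_var_lebesgue_integral[OF i iY increment_power(1)[OF st]])
qed

lemma euler_adapted:
  assumes b: "c21 L b b1 b2" and x0: "x0 \<in> borel_measurable (F 0)" and h: "h > 0"
  shows "(\<lambda>\<omega>. euler b h (\<lambda>t. s * B t \<omega>) (x0 \<omega>) k) \<in> borel_measurable (F (real k * h))"
proof (induction k)
  case 0 then show ?case using x0 by simp
next
  case (Suc k)
  have le: "real k * h \<le> real (Suc k) * h" "0 \<le> real k * h" "0 \<le> real (Suc k) * h" using h by (auto simp: algebra_simps)
  note [measurable] = F_mono[OF le(1) Suc] F_mono[OF le(1) B_adapted[OF le(2)]] B_adapted[OF le(3)] c21_measurable(1)[OF b]
  show ?case unfolding euler.simps by measurable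
qed

text \<open>The last step is integrated out first, replacing \<open>g\<close> by
  \<open>euler_op b s h g\<close>; the induction therefore runs over all bounded measurable
  \<open>g\<close>.\<close>

lemma euler_expectation:
  assumes b: "c21 L b b1 b2" and x0: "x0 \<in> borel_measurable (F 0)" and h: "h > 0"
    and g: "g \<in> borel_measurable borel" "\<And>x. \<bar>g x\<bar> \<le> K"
  shows "(\<integral>\<omega>. g (euler b h (\<lambda>t. s * B t \<omega>) (x0 \<omega>) k) \<partial>M) = (\<integral>\<omega>. (euler_op b s h ^^ k) g (x0 \<omega>) \<partial>M)"
  using g
proof (induction k arbitrary: g)
  case (Suc k)
  have lt: "0 \<le> real k * h" "real k * h < real (Suc k) * h" using h by (auto simp: algebra_simps)
  have d: "real (Suc k) * h - real k * h = h" by (simp add: algebra_simps)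
  note [measurable] = Suc.prems(1) c21_measurable(1)[OF b]
  let ?E = "\<lambda>\<omega>. euler b h (\<lambda>t. s * B t \<omega>) (x0 \<omega>) k"
  have "(\<integral>\<omega>. g (euler b h (\<lambda>t. s * B t \<omega>) (x0 \<omega>) (Suc k)) \<partial>M)
      = (\<integral>\<omega>. (\<lambda>x z. g (x + h * b x + s * z)) (?E \<omega>) (B (real (Suc k) * h) \<omega> - B (real k * h) \<omega>) \<partial>M)"
    by (simp add: right_diff_distrib)
  also have "\<dots> = (\<integral>\<omega>. (\<integral>z. g (?E \<omega> + h * b (?E \<omega>) + s * (sqrt (real (Suc k) * h - real k * h) * z)) \<partial>stdN) \<partial>M)"
    by (rule indep_expectation[OF lt euler_adapted[OF b x0 h], where g = "\<lambda>x z. g (x + h * b x + s * z)" and K = K])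
       (auto simp: Suc.prems(2))
  also have "\<dots> = (\<integral>\<omega>. euler_op b s h g (?E \<omega>) \<partial>M)"
    unfolding d by (simp add: euler_op_def gauss_avg_def mult.assoc)
  also have "\<dots> = (\<integral>\<omega>. (euler_op b s h ^^ k) (euler_op b s h g) (x0 \<omega>) \<partial>M)"
    by (rule Suc.IH) (rule euler_op_bounded_measurable[OF b Suc.prems])+
  finally show ?case by (simp only: funpow_Suc_right o_apply)
qed simp

text \<open>The Euler scheme links the pathwise solution with the measure \<open>m\<close>: its
  limit is adapted, and its expectations are integrals of iterated transition operators, which
  converge by \<open>euler_op_iterates_tendsto\<close>. The law of the initial value is compared
  with \<open>m\<close> only on periodic functions, that is, on the torus; iterates of a periodic
  function stay periodic.\<close>

lemma sde_solution:
  assumes b: "c21 L b b1 b2" "per b" and x0: "x0 \<in> borel_measurable (F 0)"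
    and m: "prob_space m" "sets m = sets borel"
    and stat: "\<And>K f f1 f2. c21 K f f1 f2 \<Longrightarrow> per f \<Longrightarrow> (\<integral>x. b x * f1 x + s\<^sup>2 / 2 * f2 x \<partial>m) = 0"
    and law0: "\<And>(g :: real \<Rightarrow> real) K. g \<in> borel_measurable borel \<Longrightarrow> per g \<Longrightarrow> (\<And>x. \<bar>g x\<bar> \<le> K) \<Longrightarrow> (\<integral>\<omega>. g (x0 \<omega>) \<partial>M) = (\<integral>x. g x \<partial>m)"
  obtains X where "\<And>\<omega>. X 0 \<omega> = x0 \<omega>"
    "\<And>\<omega>. continuous_on {0..} (\<lambda>t. X t \<omega>)"
    "\<And>t. 0 \<le> t \<Longrightarrow> X t \<in> borel_measurable (F t)"
    "\<And>t \<omega>. 0 \<le> t \<Longrightarrow> X t \<omega> = x0 \<omega> + (LINT u:{0..t}|lborel. b (X u \<omega>)) + s * B t \<omega>"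
    "\<And>t K f f1 f2. 0 \<le> t \<Longrightarrow> c21 K f f1 f2 \<Longrightarrow> per f \<Longrightarrow> (\<integral>\<omega>. f (X t \<omega>) \<partial>M) = (\<integral>x. f x \<partial>m)"
proof -
  have wc: "continuous_on {0..} (\<lambda>t. s * B t \<omega>)" for \<omega> by (intro continuous_intros B_cont)
  have "\<forall>\<omega>. \<exists>y. y 0 = 0 \<and> (\<forall>t. (y has_real_derivative b (x0 \<omega> + y t + s * B (max t 0) \<omega>)) (at t))"
  proof
    fix \<omega>
    show "\<exists>y. y 0 = 0 \<and> (\<forall>t. (y has_real_derivative b (x0 \<omega> + y t + s * B (max t 0) \<omega>)) (at t))"
      using path_ode[OF b(1) wc[of \<omega>], of "x0 \<omega>"] by blast
  qed
  from choice[OF this] obtain Y where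
    Y: "\<forall>\<omega>. Y \<omega> 0 = 0 \<and> (\<forall>t. (Y \<omega> has_real_derivative b (x0 \<omega> + Y \<omega> t + s * B (max t 0) \<omega>)) (at t))" by blast
  then have Y0: "\<And>\<omega>. Y \<omega> 0 = 0" and Yd: "\<And>\<omega> t. (Y \<omega> has_real_derivative b (x0 \<omega> + Y \<omega> t + s * B (max t 0) \<omega>)) (at t)"
    by blast+
  define X where "X t \<omega> = x0 \<omega> + Y \<omega> t + s * B t \<omega>" for t \<omega>
  have Yc: "continuous_on S (Y \<omega>)" for \<omega> S
    by (rule DERIV_continuous_on[OF has_field_derivative_at_within[OF Yd]])
  have Xc: "continuous_on {0..} (\<lambda>t. X t \<omega>)" for \<omega>
    unfolding X_def by (intro continuous_intros Yc B_cont)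
  have lim: "(\<lambda>n. euler b (t / real n) (\<lambda>t. s * B t \<omega>) (x0 \<omega>) n) \<longlonglongrightarrow> X t \<omega>" if "t > 0" for t \<omega>
    unfolding X_def by (rule euler_tendsto[OF b(1) wc _ Y0 Yd that]) (simp add: B_zero)
  have X0: "X 0 \<omega> = x0 \<omega>" for \<omega> by (simp add: X_def Y0 B_zero)
  have Xm: "X t \<in> borel_measurable (F t)" if t: "0 \<le> t" for t
  proof (cases "t = 0")
    case True
    have "X 0 = x0" using X0 by blast
    then show ?thesis using x0 True by simp
  next
    case False
    then have t: "t > 0" using t by simp
    show ?thesis
    proof (rule borel_measurable_LIMSEQ_real)
      \<comment> \<open>The index is shifted because at \<open>n = 0\<close> the step length
        \<open>t / 0\<close> is 0, whereas \<open>euler_adapted\<close> needs a positive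
        one.\<close>
      show "(\<lambda>n. euler b (t / real (Suc n)) (\<lambda>t. s * B t \<omega>) (x0 \<omega>) (Suc n)) \<longlonglongrightarrow> X t \<omega>" for \<omega>
        using LIMSEQ_Suc[OF lim[OF t]] by simp
      have eq: "real (Suc n) * (t / real (Suc n)) = t" for n by simp
      show "(\<lambda>\<omega>. euler b (t / real (Suc n)) (\<lambda>t. s * B t \<omega>) (x0 \<omega>) (Suc n)) \<in> borel_measurable (F t)" for n
        using euler_adapted[OF b(1) x0, of "t / real (Suc n)" s "Suc n"] t unfolding eq by simp
    qed
  qed
  have Xint: "X t \<omega> = x0 \<omega> + (LINT u:{0..t}|lborel. b (X u \<omega>)) + s * B t \<omega>" if t: "0 \<le> t" for t \<omega>
  proof -
    let ?f = "\<lambda>u. b (x0 \<omega> + Y \<omega> u + s * B (max u 0) \<omega>)"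
    have bc: "continuous_on UNIV b" by (rule c21_measurable(4)[OF b(1)])
    have Bc: "continuous_on UNIV (\<lambda>u. B (max u 0) \<omega>)"
      by (rule continuous_on_compose2[OF B_cont]) (auto intro!: continuous_intros)
    have fc: "continuous_on UNIV ?f"
      by (rule continuous_on_compose2[OF bc]) (auto intro!: continuous_intros Yc Bc)
    have "(LINT u:{0..t}|lborel. b (X u \<omega>)) = (LINT u:{0..t}|lborel. ?f u)"
      by (rule set_lebesgue_integral_cong) (auto simp: X_def max_absorb1)
    also have "\<dots> = (\<integral>u. ?f u * indicator {0..t} u \<partial>lborel)"
      by (simp add: set_lebesgue_integral_def mult.commute)
    also have "\<dots> = Y \<omega> t - Y \<omega> 0"
      by (rule integral_FTC_Icc_real[OF t Yd]) (use fc in \<open>auto simp: continuous_on_eq_continuous_at\<close>)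
    finally show ?thesis by (simp add: X_def Y0)
  qed
  have law: "(\<integral>\<omega>. f (X t \<omega>) \<partial>M) = (\<integral>x. f x \<partial>m)" if t: "0 \<le> t" and f: "c21 K f f1 f2" "per f" for t K f f1 f2
  proof (cases "t = 0")
    case True
    show ?thesis unfolding True X0
      by (rule law0[of f K]) (rule c21_measurable(1)[OF f(1)] f(2) c21D(3)[OF f(1)])+
  next
    case False
    then have t: "t > 0" using t by simp
    note [measurable] = c21_measurable(1)[OF f(1)]
    have step: "(\<integral>\<omega>. f (euler b (t / real n) (\<lambda>t. s * B t \<omega>) (x0 \<omega>) n) \<partial>M) = (\<integral>x. (euler_op b s (t / real n) ^^ n) f x \<partial>m)"
      if n: "n > 0" for n
    proof -
      have h: "t / real n > 0" using t n by simp
      have bm: "(euler_op b s h ^^ j) f \<in> borel_measurable borel \<and> (\<forall>x. \<bar>(euler_op b s h ^^ j) f x\<bar> \<le> K)" for j h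
      proof (induction j)
        case 0 then show ?case using c21_measurable(1)[OF f(1)] c21D(3)[OF f(1)] by simp
      next
        case (Suc j)
        then show ?case using euler_op_bounded_measurable[OF b(1), of "(euler_op b s h ^^ j) f" K s h] by simp
      qed
      have pp: "per ((euler_op b s h ^^ j) f)" for j h
      proof (induction j)
        case (Suc j)
        then show ?case by (simp add: per_euler_op[OF b(2)])
      qed (simp add: f(2))
      have "(\<integral>\<omega>. f (euler b (t / real n) (\<lambda>t. s * B t \<omega>) (x0 \<omega>) n) \<partial>M) = (\<integral>\<omega>. (euler_op b s (t / real n) ^^ n) f (x0 \<omega>) \<partial>M)"
        by (rule euler_expectation[OF b(1) x0 h, where K = K]) (rule c21_measurable(1)[OF f(1)] c21D(3)[OF f(1)])+
      also have "\<dots> = (\<integral>x. (euler_op b s (t / real n) ^^ n) f x \<partial>m)"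
        using bm by (intro law0[of "(euler_op b s (t / real n) ^^ n) f" K] pp) auto
      finally show ?thesis .
    qed
    have fc: "continuous_on UNIV f" by (rule c21_measurable(4)[OF f(1)])
    have fX: "(\<lambda>n. f (euler b (t / real n) (\<lambda>t. s * B t \<omega>) (x0 \<omega>) n)) \<longlonglongrightarrow> f (X t \<omega>)" for \<omega>
      by (rule continuous_on_tendsto_compose[OF fc lim[OF t]]) auto
    have em: "(\<lambda>\<omega>. euler b (t / real n) (\<lambda>t. s * B t \<omega>) (x0 \<omega>) n) \<in> borel_measurable M" if "n > 0" for n
      using F_into_M[OF _ euler_adapted[OF b(1) x0, of "t / real n" s n]] t that by simp
    have "(\<lambda>n. \<integral>\<omega>. f (euler b (t / real (Suc n)) (\<lambda>t. s * B t \<omega>) (x0 \<omega>) (Suc n)) \<partial>M) \<longlonglongrightarrow> (\<integral>\<omega>. f (X t \<omega>) \<partial>M)"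
    proof (rule integral_dominated_convergence[where w = "\<lambda>_. K"])
      show "AE \<omega> in M. (\<lambda>n. f (euler b (t / real (Suc n)) (\<lambda>t. s * B t \<omega>) (x0 \<omega>) (Suc n))) \<longlonglongrightarrow> f (X t \<omega>)"
        using LIMSEQ_Suc[OF fX] by simp
      show "(\<lambda>\<omega>. f (euler b (t / real (Suc n)) (\<lambda>t. s * B t \<omega>) (x0 \<omega>) (Suc n))) \<in> borel_measurable M" for n
        using measurable_compose[OF em[of "Suc n"] c21_measurable(1)[OF f(1)]] by simp
      show "(\<lambda>\<omega>. f (X t \<omega>)) \<in> borel_measurable M"
        using measurable_compose[OF F_into_M[OF less_imp_le[OF t] Xm[OF less_imp_le[OF t]]] c21_measurable(1)[OF f(1)]] .
      show "AE \<omega> in M. norm (f (euler b (t / real (Suc n)) (\<lambda>t. s * B t \<omega>) (x0 \<omega>) (Suc n))) \<le> K" for n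
        using c21D(3)[OF f(1)] by simp
    qed simp
    then have "(\<lambda>n. \<integral>x. (euler_op b s (t / real (Suc n)) ^^ Suc n) f x \<partial>m) \<longlonglongrightarrow> (\<integral>\<omega>. f (X t \<omega>) \<partial>M)"
      using step by (simp del: funpow.simps euler.simps of_nat_Suc)
    moreover have "(\<lambda>n. \<integral>x. (euler_op b s (t / real (Suc n)) ^^ Suc n) f x \<partial>m) \<longlonglongrightarrow> (\<integral>x. f x \<partial>m)"
      by (rule LIMSEQ_Suc[OF euler_op_iterates_tendsto[OF f b m stat t]])
    ultimately show ?thesis by (rule LIMSEQ_unique)
  qed
  show thesis by (rule that[of X, OF X0 Xc Xm Xint law])
qed

text \<open>The process is sampled at the grid point to the left of the current time. The sampled
  process is jointly measurable, as a countable patchwork, and converges by continuity of the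
  paths.\<close>

lemma progressive_continuous:
  fixes X :: "real \<Rightarrow> 'w \<Rightarrow> real"
  assumes c: "\<And>\<omega>. continuous_on {0..} (\<lambda>t. X t \<omega>)" and a: "\<And>t. 0 \<le> t \<Longrightarrow> X t \<in> borel_measurable (F t)"
  shows "progressive F X"
  unfolding progressive_def
proof (intro allI impI)
  fix T :: real assume T: "0 \<le> T"
  let ?P = "restrict_space borel {0..T} \<Otimes>\<^sub>M F T"
  \<comment> \<open>Capping the grid time at \<open>T\<close> keeps every \<open>G n i\<close>
    measurable with respect to \<open>F T\<close>, for all indices \<open>i\<close>.\<close>
  define G where "G n i p = X (min T (real i / real (Suc n))) (snd p)" for n i and p :: "real \<times> 'w"
  define k where "k n p = nat \<lfloor>real (Suc n) * fst p\<rfloor>" for n and p :: "real \<times> 'w"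
  have G: "G n i \<in> borel_measurable ?P" for n i
    unfolding G_def
    by (rule measurable_compose[OF measurable_snd F_mono[OF _ a]]) (use T in auto)
  have fm: "(\<lambda>p. fst p) \<in> borel_measurable ?P"
    by (rule measurable_compose[OF measurable_fst, where g = "\<lambda>x. x"]) (rule measurable_restrict_space1, simp)
  have k: "k n \<in> measurable ?P (count_space UNIV)" for n
    unfolding k_def using fm by measurable
  show "(\<lambda>(t, \<omega>). X t \<omega>) \<in> borel_measurable ?P"
  proof (rule borel_measurable_LIMSEQ_real)
    show "(\<lambda>p. G n (k n p) p) \<in> borel_measurable ?P" for n
      by (rule measurable_compose_countable'[OF G k]) auto
    fix p assume p: "p \<in> space ?P"
    obtain t \<omega> where tw: "p = (t, \<omega>)" by (cases p)
    have t: "0 \<le> t" "t \<le> T" using p by (auto simp: tw space_pair_measure)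
    have lim: "(\<lambda>n. real (nat \<lfloor>real (Suc n) * t\<rfloor>) / real (Suc n)) \<longlonglongrightarrow> t"
    proof (rule tendsto_sandwich[of "\<lambda>n. t - 1 / real (Suc n)" _ _ "\<lambda>n. t"])
      have fl: "real (nat \<lfloor>real (Suc n) * t\<rfloor>) = of_int \<lfloor>real (Suc n) * t\<rfloor>" for n using t by simp
      show "\<forall>\<^sub>F n in sequentially. t - 1 / real (Suc n) \<le> real (nat \<lfloor>real (Suc n) * t\<rfloor>) / real (Suc n)"
      proof (rule always_eventually, rule allI)
        fix n
        have "real (Suc n) * t - 1 \<le> of_int \<lfloor>real (Suc n) * t\<rfloor>" by linarith
        then have "(real (Suc n) * t - 1) / real (Suc n) \<le> of_int \<lfloor>real (Suc n) * t\<rfloor> / real (Suc n)"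
          by (intro divide_right_mono) auto
        then show "t - 1 / real (Suc n) \<le> real (nat \<lfloor>real (Suc n) * t\<rfloor>) / real (Suc n)"
          unfolding fl by (simp add: diff_divide_distrib del: of_nat_Suc)
      qed
      show "\<forall>\<^sub>F n in sequentially. real (nat \<lfloor>real (Suc n) * t\<rfloor>) / real (Suc n) \<le> t"
      proof (rule always_eventually, rule allI)
        fix n
        have "of_int \<lfloor>real (Suc n) * t\<rfloor> \<le> real (Suc n) * t" by linarith
        then show "real (nat \<lfloor>real (Suc n) * t\<rfloor>) / real (Suc n) \<le> t"
          unfolding fl by (simp add: pos_divide_le_eq mult.commute del: of_nat_Suc)
      qed
      have "(\<lambda>n. t - 1 / real (Suc n)) \<longlonglongrightarrow> t - 0"
        by (intro tendsto_diff tendsto_const LIMSEQ_Suc[OF lim_1_over_n])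
      then show "(\<lambda>n. t - 1 / real (Suc n)) \<longlonglongrightarrow> t" by simp
    qed simp
    have "(\<lambda>n. min T (real (nat \<lfloor>real (Suc n) * t\<rfloor>) / real (Suc n))) \<longlonglongrightarrow> min T t"
      by (intro tendsto_min tendsto_const lim)
    then have "(\<lambda>n. X (min T (real (nat \<lfloor>real (Suc n) * t\<rfloor>) / real (Suc n))) \<omega>) \<longlonglongrightarrow> X (min T t) \<omega>"
      by (rule continuous_on_tendsto_compose[OF c]) (use T t in auto)
    then show "(\<lambda>n. G n (k n p) p) \<longlonglongrightarrow> (case p of (t, \<omega>) \<Rightarrow> X t \<omega>)"
      using t by (simp add: G_def k_def tw min_absorb2)
  qed
qed

end

text \<open>On the exceptional null set the paths are replaced by 0. That set belongs to
  \<open>F 0\<close>, because the filtration contains the null sets, so the modified process is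
  still adapted.\<close>

lemma brownian_basis_cont_version:
  assumes "brownian_basis M F B"
  obtains B' where "cont_brownian M F B'" "AE \<omega> in M. \<forall>t\<ge>0. B' t \<omega> = B t \<omega>"
proof -
  interpret brownian_basis M F B by fact
  have "AE \<omega> in M. B 0 \<omega> = 0 \<and> continuous_on {0..} (\<lambda>t. B t \<omega>)"
    using B_zero B_continuous by eventually_elim simp
  then obtain N where N: "{\<omega>\<in>space M. \<not> (B 0 \<omega> = 0 \<and> continuous_on {0..} (\<lambda>t. B t \<omega>))} \<subseteq> N" "emeasure M N = 0" "N \<in> sets M"
    by (rule AE_E)
  then have Nn: "N \<in> null_sets M" by (simp add: null_setsI)
  define B' where "B' t \<omega> = (if \<omega> \<in> space M - N then B t \<omega> else 0)" for t \<omega>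
  have ae: "AE \<omega> in M. \<forall>t. B' t \<omega> = B t \<omega>"
    using AE_not_in[OF Nn] AE_space by eventually_elim (simp add: B'_def)
  have NF: "N \<in> sets (F t)" if "0 \<le> t" for t
    using null_sets_F0 Nn sets_F_mono[OF that] by blast
  have B'm: "B' t \<in> borel_measurable (F t)" if t: "0 \<le> t" for t
  proof -
    have "(\<lambda>\<omega>. if \<omega> \<in> N then 0 else B t \<omega>) \<in> borel_measurable (F t)"
      using B_adapted[OF t] NF[OF t] by measurable
    then show ?thesis
      by (rule measurable_cong[THEN iffD1, rotated]) (simp add: B'_def space_F)
  qed
  have toM: "Y \<in> measurable M L" if "0 \<le> t" "Y \<in> measurable (F t) L" for t Y and L :: "real measure"
    using sub_F[OF that(1)] that(2) unfolding measurable_def subalgebra_def by auto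
  have indep: "indep_var borel Y borel (\<lambda>\<omega>. B' t \<omega> - B' s \<omega>)"
    if st: "0 \<le> s" "s < t" and Y: "Y \<in> borel_measurable (F s)" for s t and Y :: "'a \<Rightarrow> real"
  proof -
    have m [measurable]: "Y \<in> borel_measurable M" "B s \<in> borel_measurable M" "B t \<in> borel_measurable M"
      "B' s \<in> borel_measurable M" "B' t \<in> borel_measurable M"
      using toM[OF st(1) Y] toM[OF st(1) B_adapted[OF st(1)]] toM[OF _ B_adapted, of t] toM[OF st(1) B'm[OF st(1)]] toM[OF _ B'm, of t] st
      by auto
    have "indep_set (sigma_sets (space M) {Y -` A \<inter> space M |A. A \<in> sets borel})
        (sigma_sets (space M) {(\<lambda>\<omega>. B t \<omega> - B s \<omega>) -` A \<inter> space M |A. A \<in> sets borel})"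
      unfolding indep_set_def
    proof (rule indep_sets_mono_sets[OF B_indep[OF st, unfolded indep_set_def]])
      fix i :: bool
      have "sigma_sets (space M) {Y -` A \<inter> space M |A. A \<in> sets borel} \<subseteq> sets (F s)"
        using Y sets.sigma_sets_subset[of "{Y -` A \<inter> space M |A. A \<in> sets borel}" "F s"]
        by (auto simp: space_F measurable_def)
      then show "case_bool (sigma_sets (space M) {Y -` A \<inter> space M |A. A \<in> sets borel})
          (sigma_sets (space M) {(\<lambda>\<omega>. B t \<omega> - B s \<omega>) -` A \<inter> space M |A. A \<in> sets borel}) i
          \<subseteq> case_bool (sets (F s)) (sets (vimage_algebra (space M) (\<lambda>\<omega>. B t \<omega> - B s \<omega>) borel)) i"
        by (auto simp: sets_vimage_algebra split: bool.split)
    qed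
    then have "indep_var borel Y borel (\<lambda>\<omega>. B t \<omega> - B s \<omega>)"
      unfolding indep_var_eq by simp
    \<comment> \<open>Independence is rephrased through the joint law, which does not see a change
      of the paths on a null set.\<close>
    then have "distr M borel Y \<Otimes>\<^sub>M distr M borel (\<lambda>\<omega>. B t \<omega> - B s \<omega>) = distr M (borel \<Otimes>\<^sub>M borel) (\<lambda>\<omega>. (Y \<omega>, B t \<omega> - B s \<omega>))"
      unfolding indep_var_distribution_eq by blast
    moreover have "distr M borel (\<lambda>\<omega>. B t \<omega> - B s \<omega>) = distr M borel (\<lambda>\<omega>. B' t \<omega> - B' s \<omega>)"
      by (rule distr_cong_AE) (use ae in auto)
    moreover have "distr M (borel \<Otimes>\<^sub>M borel) (\<lambda>\<omega>. (Y \<omega>, B t \<omega> - B s \<omega>)) = distr M (borel \<Otimes>\<^sub>M borel) (\<lambda>\<omega>. (Y \<omega>, B' t \<omega> - B' s \<omega>))"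
      by (rule distr_cong_AE) (use ae in auto)
    ultimately show ?thesis unfolding indep_var_distribution_eq by simp
  qed
  have law: "distr M borel (\<lambda>\<omega>. B' t \<omega> - B' s \<omega>) = distr stdN borel (\<lambda>z. sqrt (t - s) * z)" if st: "0 \<le> s" "s < t" for s t
  proof -
    have m [measurable]: "B s \<in> borel_measurable M" "B t \<in> borel_measurable M"
      "B' s \<in> borel_measurable M" "B' t \<in> borel_measurable M"
      using toM[OF st(1) B_adapted[OF st(1)]] toM[OF _ B_adapted, of t] toM[OF st(1) B'm[OF st(1)]] toM[OF _ B'm, of t] st
      by auto
    have "distr M borel (\<lambda>\<omega>. B' t \<omega> - B' s \<omega>) = distr M borel (\<lambda>\<omega>. B t \<omega> - B s \<omega>)"
      by (rule distr_cong_AE) (use ae in auto)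
    also have "\<dots> = distr stdN borel (\<lambda>z. sqrt (t - s) * z)"
      by (rule distributed_normal_eq_stdN[OF B_normal[OF st]]) (use st in simp)
    finally show ?thesis .
  qed
  have z: "B' 0 \<omega> = 0" for \<omega> using N(1) by (auto simp: B'_def)
  have c: "continuous_on {0..} (\<lambda>t. B' t \<omega>)" for \<omega>
  proof (cases "\<omega> \<in> space M - N")
    case True then show ?thesis using N(1) by (auto simp: B'_def)
  qed (auto simp: B'_def)
  have "cont_brownian M F B'"
    by unfold_locales (use sub_F B'm z c indep law in auto)
  moreover have "AE \<omega> in M. \<forall>t\<ge>0. B' t \<omega> = B t \<omega>" using ae by eventually_elim simp
  ultimately show thesis by (rule that)
qed

section \<open>Expected Ito formula\<close>

lemma set_integral_abs_le:
  fixes f g :: "'a \<Rightarrow> real"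
  assumes "set_integrable M D f" "set_integrable M D g" "\<And>u. u \<in> D \<Longrightarrow> \<bar>f u\<bar> \<le> g u"
  shows "\<bar>LINT u:D|M. f u\<bar> \<le> (LINT u:D|M. g u)"
proof -
  have "(LINT u:D|M. f u) \<le> (LINT u:D|M. g u)"
    by (rule set_integral_mono[OF assms(1,2)]) (use assms(3) in \<open>force simp: abs_le_iff\<close>)
  moreover have "(LINT u:D|M. - f u) \<le> (LINT u:D|M. g u)"
    by (rule set_integral_mono[OF _ assms(2)])
       (use assms(3) set_integrable_mult_right[of "-1" M D f] assms(1) in \<open>force simp: abs_le_iff\<close>)+
  ultimately show ?thesis by (simp add: set_integral_uminus[OF assms(1)] abs_le_iff)
qed

lemma set_integrable_dominated:
  fixes f g :: "real \<Rightarrow> real"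
  assumes "set_integrable lborel D g" "f \<in> borel_measurable borel" "D \<in> sets borel" "\<And>u. u \<in> D \<Longrightarrow> \<bar>f u\<bar> \<le> g u"
  shows "set_integrable lborel D f"
proof (rule set_integrable_bound[OF assms(1)])
  show "set_borel_measurable lborel D f" unfolding set_borel_measurable_def using assms(2,3) by measurable
  show "AE u in lborel. u \<in> D \<longrightarrow> norm (f u) \<le> norm (g u)" using assms(4) by force
qed

lemma set_integrable_const_Icc: "set_integrable lborel {s..t} (\<lambda>u. c :: real)" for s t :: real
  by (intro borel_integrable_atLeastAtMost' continuous_intros)

lemma set_integral_const_Icc: "s \<le> t \<Longrightarrow> (LINT u:{s..t}|lborel. c) = (t - s) * c" for s t c :: real
  unfolding set_lebesgue_integral_def by simp

lemma set_integral_split: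
  fixes f :: "real \<Rightarrow> real"
  assumes "set_integrable lborel {r..t} f" "r \<le> s" "s \<le> t"
  shows "(LINT u:{r..t}|lborel. f u) = (LINT u:{r..s}|lborel. f u) + (LINT u:{s..t}|lborel. f u)"
proof -
  have i: "set_integrable lborel {r..s} f" "set_integrable lborel {s..t} f"
    by (rule set_integrable_subset[OF assms(1)]; use assms(2,3) in auto)+
  have "{r..t} = {r..s} \<union> {s..t}" using assms by auto
  moreover have "(LINT u:{r..s} \<union> {s..t}|lborel. f u) = (LINT u:{r..s}|lborel. f u) + (LINT u:{s..t}|lborel. f u)"
  proof (rule set_integral_Un_AE[OF _ _ _ i])
    have "AE u in lborel. u \<noteq> s" by (rule AE_lborel_singleton)
    then show "AE u in lborel. \<not> (u \<in> {r..s} \<and> u \<in> {s..t})" by eventually_elim auto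
  qed auto
  ultimately show ?thesis by simp
qed

lemma amgm_scaled: "0 < r \<Longrightarrow> 2 * (x * y) \<le> r * x\<^sup>2 + y\<^sup>2 / r" for x y r :: real
proof -
  assume r: "0 < r"
  have "0 \<le> (r * x - y)\<^sup>2 / r" using r by simp
  also have "\<dots> = r * x\<^sup>2 - 2 * (x * y) + y\<^sup>2 / r" using r by (simp add: power2_eq_square field_simps)
  finally show ?thesis by simp
qed

lemma mult_le_sum_squares: "x * y \<le> x\<^sup>2 + y\<^sup>2" for x y :: real
  using amgm_scaled[OF zero_less_one, of x y] zero_le_power2[of x] zero_le_power2[of y]
  unfolding div_by_1 mult_1 by linarith

lemma exp_decay_increment:
  fixes \<beta> s t :: real
  assumes "\<beta> \<ge> 0" "0 \<le> s" "s \<le> t"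
  shows "\<bar>exp (- \<beta> * s) - exp (- \<beta> * t)\<bar> \<le> \<beta> * (t - s)"
  using exp_lipschitz_below[of "- \<beta> * s" 0 "- \<beta> * t"] assms by (simp add: abs_mult right_diff_distrib[symmetric] mult_left_mono)

text \<open>With \<open>h = t - s\<close>, the weights are balanced for the noise
  \<open>w = \<sigma> * B\<close>: the fourth power of its increment and the integral of its squared
  deviation have means of order \<open>h\<^sup>2\<close>, so after division by \<open>sqrt h\<close>
  every term has mean of order \<open>sqrt h * (h + energy)\<close>. Such bounds add up over a
  partition.\<close>

definition step_error :: "real \<Rightarrow> real \<Rightarrow> (real \<Rightarrow> real) \<Rightarrow> (real \<Rightarrow> real) \<Rightarrow> real" where
  "step_error s t a w = sqrt (t - s) * ((t - s) + (LINT u:{s..t}|lborel. (a u)\<^sup>2) + (w t - w s)\<^sup>2)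
    + ((w t - w s) ^ 4 + (LINT u:{s..t}|lborel. (w u - w s)\<^sup>2)) / sqrt (t - s)"

text \<open>The density of the finite variation part in the formula of Ito for
  \<open>exp (- \<beta> * u) * f (X u)\<close>, at position \<open>x\<close> with drift
  \<open>a\<close>.\<close>

definition ito_gen :: "real \<Rightarrow> real \<Rightarrow> (real \<Rightarrow> real) \<Rightarrow> (real \<Rightarrow> real) \<Rightarrow> (real \<Rightarrow> real) \<Rightarrow> real \<Rightarrow> real \<Rightarrow> real \<Rightarrow> real" where
  "ito_gen \<beta> \<sigma> f f1 f2 u x a = exp (- \<beta> * u) * (f1 x * a + \<sigma>\<^sup>2 / 2 * f2 x - \<beta> * f x)"

text \<open>The one-step error of the Ito formula for a path \<open>X\<close> with drift \<open>a\<close> and noise \<open>w\<close>, in terms of quantities whose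
  expectations sum to \<open>O(sqrt (t - s))\<close> over a partition.  The drift is only square integrable, so every product with \<open>a\<close>
  is split by the inequality between arithmetic and geometric means with weight \<open>sqrt (t - s)\<close>.\<close>

lemma ito_step_bound:
  assumes f: "c21 K f f1 f2" and \<beta>: "\<beta> \<ge> 0" and st: "0 \<le> s" "s < t" "t - s \<le> 1"
    and am: "a \<in> borel_measurable borel" and a2: "set_integrable lborel {s..t} (\<lambda>u. (a u)\<^sup>2)"
    and wc: "continuous_on {s..t} w"
    and Xm: "X \<in> borel_measurable borel"
    and wm: "w \<in> borel_measurable borel"
    and X: "\<And>u. u \<in> {s..t} \<Longrightarrow> X u = X s + (LINT v:{s..u}|lborel. a v) + (w u - w s)"
  shows "\<bar>exp (- \<beta> * t) * f (X t) - exp (- \<beta> * s) * f (X s)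
      - (LINT u:{s..t}|lborel. ito_gen \<beta> \<sigma> f f1 f2 u (X u) (a u))
      - exp (- \<beta> * s) * (f1 (X s) * (w t - w s) + f2 (X s) / 2 * ((w t - w s)\<^sup>2 - \<sigma>\<^sup>2 * (t - s)))\<bar>
    \<le> K * (5 + \<sigma>\<^sup>2 + 5 * \<beta> + \<beta> * \<sigma>\<^sup>2) * step_error s t a w"
proof -
  define D where "D = {s..t}"
  define h where "h = t - s"
  define r where "r = sqrt h"
  define \<Delta> where "\<Delta> = w t - w s"
  define W where "W = \<bar>\<Delta>\<bar>"
  define om where "om u = \<bar>w u - w s\<bar>" for u
  define I where "I = (LINT u:D|lborel. \<bar>a u\<bar>)"
  define S where "S = (LINT u:D|lborel. (a u)\<^sup>2)"
  define J where "J = (LINT u:D|lborel. om u)"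
  define Q where "Q = (LINT u:D|lborel. om u * \<bar>a u\<bar>)"
  define V where "V = (LINT u:D|lborel. (om u)\<^sup>2)"
  define P where "P = step_error s t a w"
  note K = c21_nonneg[OF f]
  have Dm [measurable]: "D \<in> sets borel" by (simp add: D_def)
  note [measurable] = am Xm wm c21_measurable(1-3)[OF f]
  have omm [measurable]: "om \<in> borel_measurable borel" unfolding om_def[abs_def] by measurable
  have om0: "0 \<le> om u" for u by (simp add: om_def)
  have h: "0 < h" "h \<le> 1" using st by (auto simp: h_def)
  have r: "0 < r" "r \<le> 1" "r * r = h" using h by (auto simp: r_def)
  have hr: "h \<le> r" using r by (metis mult_left_le less_imp_le)
  have ic: "set_integrable lborel D (\<lambda>u. c)" for c :: real unfolding D_def by (rule set_integrable_const_Icc)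
  have Ic: "(LINT u:D|lborel. c) = h * c" for c :: real unfolding D_def h_def using st by (intro set_integral_const_Icc) auto
  have ia2: "set_integrable lborel D (\<lambda>u. (a u)\<^sup>2)" using a2 by (simp add: D_def)
  have io: "set_integrable lborel D om" "set_integrable lborel D (\<lambda>u. (om u)\<^sup>2)"
    unfolding D_def om_def
    by (intro borel_integrable_atLeastAtMost' continuous_intros wc)+
  have ia: "set_integrable lborel D (\<lambda>u. \<bar>a u\<bar>)"
  proof (rule set_integrable_dominated[OF set_integral_add(1)[OF ic[of 1] ia2]])
    fix u show "\<bar>\<bar>a u\<bar>\<bar> \<le> 1 + (a u)\<^sup>2"
      using amgm_scaled[of 1 1 "\<bar>a u\<bar>"] zero_le_power2[of "a u"] unfolding power2_abs abs_abs div_by_1 mult_1 by simp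
  qed measurable
  have iq: "set_integrable lborel D (\<lambda>u. om u * \<bar>a u\<bar>)"
  proof (rule set_integrable_dominated[OF set_integral_add(1)[OF io(2) ia2]])
    fix u
    have "\<bar>om u * \<bar>a u\<bar>\<bar> = om u * \<bar>a u\<bar>" using om0[of u] by (simp add: abs_mult)
    also have "\<dots> \<le> (om u)\<^sup>2 + (a u)\<^sup>2"
      using mult_le_sum_squares[of "om u" "\<bar>a u\<bar>"] by simp
    finally show "\<bar>om u * \<bar>a u\<bar>\<bar> \<le> (om u)\<^sup>2 + (a u)\<^sup>2" .
  qed measurable
  have nn: "0 \<le> I" "0 \<le> S" "0 \<le> J" "0 \<le> Q" "0 \<le> V" "0 \<le> W"
    unfolding I_def S_def J_def Q_def V_def W_def set_lebesgue_integral_def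
    by (auto intro!: Bochner_Integration.integral_nonneg simp: om0 indicator_def)
  have Pdef: "P = r * (h + S + W\<^sup>2) + (W ^ 4 + V) / r"
  proof -
    have "(om u)\<^sup>2 = (w u - w s)\<^sup>2" for u by (simp add: om_def)
    moreover have "W\<^sup>2 = (w t - w s)\<^sup>2" "W ^ 4 = (w t - w s) ^ 4"
      by (simp_all add: W_def \<Delta>_def power_even_abs)
    ultimately show ?thesis by (simp add: P_def step_error_def r_def h_def S_def V_def D_def)
  qed
  have p: "0 \<le> r * h" "0 \<le> r * S" "0 \<le> r * W\<^sup>2" "0 \<le> W ^ 4 / r" "0 \<le> V / r"
    using r h nn by auto
  have Pexp: "P = r * h + r * S + r * W\<^sup>2 + W ^ 4 / r + V / r"
    by (simp add: Pdef distrib_left add_divide_distrib)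
  have P0: "0 \<le> P" using p by (simp add: Pexp)
  \<comment> \<open>Cauchy-Schwarz, obtained by integrating the square of \<open>|a|\<close> minus
    its mean \<open>I / h\<close> over the interval.\<close>
  have I2: "I\<^sup>2 \<le> h * S"
  proof -
    have i: "set_integrable lborel D (\<lambda>u. (a u)\<^sup>2 - 2 * (I / h) * \<bar>a u\<bar>)"
      by (intro set_integral_diff(1) set_integrable_mult_right ia ia2)
    have "0 \<le> (LINT u:D|lborel. (\<bar>a u\<bar> - I / h)\<^sup>2)"
      unfolding set_lebesgue_integral_def by (rule Bochner_Integration.integral_nonneg) (auto simp: indicator_def)
    also have "(\<lambda>u. (\<bar>a u\<bar> - I / h)\<^sup>2) = (\<lambda>u. ((a u)\<^sup>2 - 2 * (I / h) * \<bar>a u\<bar>) + (I / h)\<^sup>2)"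
      by (auto simp: power2_diff)
    also have "(LINT u:D|lborel. ((a u)\<^sup>2 - 2 * (I / h) * \<bar>a u\<bar>) + (I / h)\<^sup>2) = (S - 2 * (I / h) * I) + h * (I / h)\<^sup>2"
      unfolding set_integral_add(2)[OF i ic] Ic
      using set_integral_diff(2)[OF ia2 set_integrable_mult_right[OF ia], of "2 * (I / h)"] by (simp add: S_def I_def)
    also have "\<dots> = S - I\<^sup>2 / h" using h by (simp add: power2_eq_square field_simps)
    finally show ?thesis using h by (simp add: pos_divide_le_eq mult.commute)
  qed
  have bI2: "I\<^sup>2 \<le> P"
  proof -
    have "h * S \<le> r * S" using hr nn by (intro mult_right_mono) auto
    then show ?thesis using I2 p unfolding Pexp by linarith
  qed
  have bI2r: "I\<^sup>2 / r \<le> r * S"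
  proof -
    have "I\<^sup>2 / r \<le> h * S / r" using I2 r by (intro divide_right_mono) auto
    also have "\<dots> = r * S" using r by (simp add: r(3)[symmetric])
    finally show ?thesis .
  qed
  have bWI: "W * I \<le> P" using amgm_scaled[OF r(1), of W I] bI2r p unfolding Pexp by linarith
  have bQ: "Q \<le> P"
  proof -
    have "Q \<le> (LINT u:D|lborel. (r / 2) * (a u)\<^sup>2 + (1 / (2 * r)) * (om u)\<^sup>2)"
      unfolding Q_def
    proof (rule set_integral_mono[OF iq])
      fix u
      have "2 * (om u * \<bar>a u\<bar>) \<le> r * (a u)\<^sup>2 + (om u)\<^sup>2 / r"
        using amgm_scaled[OF r(1), of "\<bar>a u\<bar>" "om u"] by (simp add: mult.commute)
      then show "om u * \<bar>a u\<bar> \<le> (r / 2) * (a u)\<^sup>2 + (1 / (2 * r)) * (om u)\<^sup>2" by (simp add: add_divide_distrib mult.commute)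
    qed (intro set_integral_add(1) set_integrable_mult_right ia2 io)
    also have "\<dots> = (r / 2) * S + (1 / (2 * r)) * V"
      using set_integral_add(2)[OF set_integrable_mult_right[OF ia2, of "r / 2"] set_integrable_mult_right[OF io(2), of "1 / (2 * r)"]]
      by (simp add: S_def V_def)
    finally have "2 * Q \<le> 2 * ((r / 2) * S + (1 / (2 * r)) * V)" by simp
    also have "\<dots> = r * S + V / r" using r by (simp add: distrib_left)
    finally show ?thesis using p unfolding Pexp by linarith
  qed
  have bW3: "W ^ 3 \<le> P"
  proof -
    have "2 * (W * W\<^sup>2) \<le> r * W\<^sup>2 + (W\<^sup>2)\<^sup>2 / r" by (rule amgm_scaled[OF r(1)])
    then have "2 * W ^ 3 \<le> r * W\<^sup>2 + W ^ 4 / r" by (simp add: power2_eq_square power3_eq_cube power4_eq_xxxx mult.assoc)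
    then show ?thesis using p unfolding Pexp by linarith
  qed
  have bJ: "J \<le> P"
  proof -
    have "J \<le> (LINT u:D|lborel. r / 2 + (1 / (2 * r)) * (om u)\<^sup>2)"
      unfolding J_def
    proof (rule set_integral_mono[OF io(1)])
      fix u
      have "2 * (1 * om u) \<le> r * 1\<^sup>2 + (om u)\<^sup>2 / r" by (rule amgm_scaled[OF r(1)])
      then show "om u \<le> r / 2 + (1 / (2 * r)) * (om u)\<^sup>2" by (simp add: add_divide_distrib mult.commute)
    qed (intro set_integral_add(1) set_integrable_mult_right ic io)
    also have "\<dots> = h * (r / 2) + (1 / (2 * r)) * V"
      using set_integral_add(2)[OF ic[of "r / 2"] set_integrable_mult_right[OF io(2), of "1 / (2 * r)"]]
      by (simp add: Ic V_def)
    finally have "2 * J \<le> 2 * (h * (r / 2) + (1 / (2 * r)) * V)" by simp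
    also have "\<dots> = r * h + V / r" using r by (simp add: distrib_left mult.commute)
    finally show ?thesis using p unfolding Pexp by linarith
  qed
  have bhI: "h * I \<le> P"
  proof -
    have "2 * (1 * I) \<le> r * 1\<^sup>2 + I\<^sup>2 / r" by (rule amgm_scaled[OF r(1)])
    then have "2 * I \<le> r + r * S" using bI2r by simp
    from mult_left_mono[OF this less_imp_le[OF h(1)]]
    have "2 * (h * I) \<le> r * h + h * (r * S)" by (simp add: algebra_simps)
    moreover have "h * (r * S) \<le> 1 * (r * S)" using h p by (intro mult_right_mono) auto
    ultimately show ?thesis using p unfolding Pexp by linarith
  qed
  have bhW: "h * W \<le> P"
  proof -
    have "2 * (1 * W) \<le> r * 1\<^sup>2 + W\<^sup>2 / r" by (rule amgm_scaled[OF r(1)])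
    from mult_left_mono[OF this less_imp_le[OF h(1)]]
    have "2 * (h * W) \<le> r * h + h * (W\<^sup>2 / r)" by (simp add: algebra_simps)
    also have "h * (W\<^sup>2 / r) = r * W\<^sup>2" using r by (simp add: r(3)[symmetric])
    finally show ?thesis using p unfolding Pexp by linarith
  qed
  have bhh: "h * h \<le> P"
  proof -
    have "h * h \<le> r * h" using hr h by (intro mult_right_mono) auto
    then show ?thesis using p unfolding Pexp by linarith
  qed
  have Xs: "\<bar>X u - X s\<bar> \<le> I + om u" if u: "u \<in> D" for u
  proof -
    have ia': "set_integrable lborel {s..u} (\<lambda>v. \<bar>a v\<bar>)"
      by (rule set_integrable_subset[OF ia]) (use u in \<open>auto simp: D_def\<close>)
    have ia'': "set_integrable lborel {s..u} a"
      by (rule set_integrable_dominated[OF ia']) (auto simp: am)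
    have "\<bar>LINT v:{s..u}|lborel. a v\<bar> \<le> (LINT v:{s..u}|lborel. \<bar>a v\<bar>)"
      by (rule set_integral_abs_le[OF ia'' ia']) simp
    also have "\<dots> \<le> I"
      unfolding I_def set_lebesgue_integral_def
      by (rule integral_mono) (use ia ia' u in \<open>auto simp: set_integrable_def D_def indicator_def\<close>)
    finally have "\<bar>LINT v:{s..u}|lborel. a v\<bar> \<le> I" .
    then show ?thesis using X[of u] u by (simp add: D_def om_def)
  qed
  have iaa: "set_integrable lborel D a" by (rule set_integrable_dominated[OF ia]) auto
  define A where "A = (LINT u:D|lborel. a u)"
  have AI: "\<bar>A\<bar> \<le> I" unfolding A_def I_def by (rule set_integral_abs_le[OF iaa ia]) simp
  \<comment> \<open>Intermediate point: the noise acts first, from \<open>X s\<close> to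
    \<open>y\<close>, and is expanded to second order; the drift then leads from \<open>y\<close> to
    \<open>X t\<close>, where first order suffices.\<close>
  define y where "y = X s + \<Delta>"
  have Xt: "X t = y + A" using X[of t] st by (simp add: y_def A_def D_def \<Delta>_def)
  have if1: "set_integrable lborel D (\<lambda>u. f1 (X u) * a u)"
  proof (rule set_integrable_dominated[OF set_integrable_mult_right[OF ia, of K]])
    fix u show "\<bar>f1 (X u) * a u\<bar> \<le> K * \<bar>a u\<bar>" unfolding abs_mult by (intro mult_right_mono c21D(4)[OF f]) auto
  qed measurable
  have if2: "set_integrable lborel D (\<lambda>u. f2 (X u))"
    by (rule set_integrable_dominated[OF ic[of K]]) (auto intro: c21D(5)[OF f])
  have if0: "set_integrable lborel D (\<lambda>u. f (X u))"
    by (rule set_integrable_dominated[OF ic[of K]]) (auto intro: c21D(3)[OF f])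
  \<comment> \<open>\<open>E1\<close> is the error of the drift move, \<open>E2\<close> the cubic
    remainder of the noise move, and \<open>E3\<close> the cost of freezing \<open>f2\<close> at the
    start of the interval.\<close>
  define E1 where "E1 = f (y + A) - f y - (LINT u:D|lborel. f1 (X u) * a u)"
  define E2 where "E2 = f y - f (X s) - f1 (X s) * \<Delta> - f2 (X s) * \<Delta>\<^sup>2 / 2"
  define E3 where "E3 = \<sigma>\<^sup>2 / 2 * ((LINT u:D|lborel. f2 (X u)) - h * f2 (X s))"
  have bE1: "\<bar>E1\<bar> \<le> K * (4 * P)"
  proof -
    have 1: "\<bar>f (y + A) - f y - f1 y * A\<bar> \<le> K * I\<^sup>2"
    proof -
      have "\<bar>f (y + A) - f y - f1 y * A\<bar> \<le> K * A\<^sup>2" by (rule c21_taylor1(1)[OF f])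
      also have "\<dots> \<le> K * I\<^sup>2" using AI K nn by (intro mult_left_mono) (auto simp: abs_le_square_iff[symmetric])
      finally show ?thesis .
    qed
    have ib: "set_integrable lborel D (\<lambda>u. f1 y * a u)" by (rule set_integrable_mult_right[OF iaa])
    have "f1 y * A - (LINT u:D|lborel. f1 (X u) * a u) = (LINT u:D|lborel. f1 y * a u - f1 (X u) * a u)"
      using set_integral_diff(2)[OF ib if1] by (simp add: A_def)
    also have "\<bar>\<dots>\<bar> \<le> (LINT u:D|lborel. (K * (W + I)) * \<bar>a u\<bar> + K * (om u * \<bar>a u\<bar>))"
    proof (rule set_integral_abs_le)
      fix u assume u: "u \<in> D"
      have "\<bar>y - X u\<bar> \<le> W + (I + om u)" using Xs[OF u] unfolding y_def W_def by linarith
      then have "\<bar>f1 y - f1 (X u)\<bar> \<le> K * (W + (I + om u))"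
        using K by (intro order_trans[OF c21_lipschitz(2)[OF f]] mult_left_mono) auto
      then have "\<bar>f1 y - f1 (X u)\<bar> * \<bar>a u\<bar> \<le> K * (W + (I + om u)) * \<bar>a u\<bar>" by (intro mult_right_mono) auto
      then show "\<bar>f1 y * a u - f1 (X u) * a u\<bar> \<le> (K * (W + I)) * \<bar>a u\<bar> + K * (om u * \<bar>a u\<bar>)"
        unfolding left_diff_distrib[symmetric] abs_mult by (simp add: algebra_simps)
    qed (intro set_integral_add(1) set_integral_diff(1) set_integrable_mult_right ia iq ib if1)+
    also have "\<dots> = K * (W + I) * I + K * Q"
      using set_integral_add(2)[OF set_integrable_mult_right[OF ia, of "K * (W + I)"] set_integrable_mult_right[OF iq, of K]]
      by (simp add: I_def Q_def)
    also have "\<dots> = K * (W * I + I\<^sup>2 + Q)" by (simp add: algebra_simps power2_eq_square)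
    finally have "\<bar>f1 y * A - (LINT u:D|lborel. f1 (X u) * a u)\<bar> \<le> K * (W * I + I\<^sup>2 + Q)" .
    then have "\<bar>E1\<bar> \<le> K * I\<^sup>2 + K * (W * I + I\<^sup>2 + Q)" using 1 unfolding E1_def by linarith
    also have "\<dots> = K * (I\<^sup>2 + (W * I + I\<^sup>2 + Q))" by (simp add: distrib_left)
    also have "\<dots> \<le> K * (4 * P)" using bI2 bWI bQ K by (intro mult_left_mono) auto
    finally show ?thesis .
  qed
  have bE2: "\<bar>E2\<bar> \<le> K * P"
  proof -
    have "\<bar>E2\<bar> \<le> K * \<bar>\<Delta>\<bar> ^ 3" unfolding E2_def y_def by (rule c21_taylor2[OF f])
    also have "\<dots> \<le> K * P" using bW3 K by (intro mult_left_mono) (auto simp: W_def)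
    finally show ?thesis .
  qed
  have bE3: "\<bar>E3\<bar> \<le> K * (\<sigma>\<^sup>2 * P)"
  proof -
    have "(LINT u:D|lborel. f2 (X u)) - h * f2 (X s) = (LINT u:D|lborel. f2 (X u) - f2 (X s))"
      using set_integral_diff(2)[OF if2 ic, of "f2 (X s)"] by (simp add: Ic)
    also have "\<bar>\<dots>\<bar> \<le> (LINT u:D|lborel. K * I + K * om u)"
    proof (rule set_integral_abs_le)
      fix u assume u: "u \<in> D"
      have "\<bar>f2 (X u) - f2 (X s)\<bar> \<le> K * (I + om u)"
        using K Xs[OF u] by (intro order_trans[OF c21D(6)[OF f]] mult_left_mono) auto
      then show "\<bar>f2 (X u) - f2 (X s)\<bar> \<le> K * I + K * om u" by (simp add: distrib_left)
    qed (intro set_integral_add(1) set_integral_diff(1) set_integrable_mult_right ic io if2)+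
    also have "\<dots> = h * (K * I) + K * J"
      using set_integral_add(2)[OF ic set_integrable_mult_right[OF io(1), of K], of "K * I"] by (simp add: Ic J_def)
    also have "\<dots> = K * (h * I + J)" by (simp add: algebra_simps)
    also have "\<dots> \<le> K * (2 * P)" using bhI bJ K by (intro mult_left_mono) auto
    finally have "\<sigma>\<^sup>2 / 2 * \<bar>(LINT u:D|lborel. f2 (X u)) - h * f2 (X s)\<bar> \<le> \<sigma>\<^sup>2 / 2 * (K * (2 * P))"
      by (intro mult_left_mono) auto
    then show ?thesis unfolding E3_def abs_mult by (simp add: mult_ac)
  qed
  define \<psi> where "\<psi> u = f1 (X u) * a u + \<sigma>\<^sup>2 / 2 * f2 (X u)" for u
  have i\<psi>: "set_integrable lborel D \<psi>" unfolding \<psi>_def by (intro set_integral_add(1) set_integrable_mult_right if1 if2)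
  have [measurable]: "\<psi> \<in> borel_measurable borel" unfolding \<psi>_def[abs_def] by measurable
  have L\<psi>: "(LINT u:D|lborel. \<psi> u) = (LINT u:D|lborel. f1 (X u) * a u) + \<sigma>\<^sup>2 / 2 * (LINT u:D|lborel. f2 (X u))"
    unfolding \<psi>_def using set_integral_add(2)[OF if1 set_integrable_mult_right[OF if2, of "\<sigma>\<^sup>2 / 2"]] by simp
  define e where "e u = exp (- \<beta> * u)" for u
  have [measurable]: "e \<in> borel_measurable borel" unfolding e_def[abs_def] by measurable
  have e1: "0 \<le> e u" "\<bar>e u\<bar> \<le> 1" if "u \<in> D" for u using that st \<beta> by (auto simp: e_def D_def)
  have es: "\<bar>e s - e u\<bar> \<le> \<beta> * h" if "u \<in> D" for u
  proof -
    have "\<bar>e s - e u\<bar> \<le> \<beta> * (u - s)" unfolding e_def using that st \<beta> by (intro exp_decay_increment) (auto simp: D_def)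
    also have "\<dots> \<le> \<beta> * h" using that \<beta> by (intro mult_left_mono) (auto simp: D_def h_def)
    finally show ?thesis .
  qed
  have Le: "(LINT u:D|lborel. \<beta> * e u) = e s - e t"
  proof -
    have "(\<integral>u. (\<beta> * e u) * indicator {s..t} u \<partial>lborel) = - e t - - e s"
      by (rule integral_FTC_Icc_real) (use st in \<open>auto simp: e_def intro!: derivative_eq_intros continuous_intros\<close>)
    moreover have "(LINT u:D|lborel. \<beta> * e u) = (\<integral>u. (\<beta> * e u) * indicator {s..t} u \<partial>lborel)"
      unfolding set_lebesgue_integral_def D_def by (rule Bochner_Integration.integral_cong) auto
    ultimately show ?thesis by simp
  qed
  have ief: "set_integrable lborel D (\<lambda>u. \<beta> * e u * f (X u))" "set_integrable lborel D (\<lambda>u. \<beta> * e u * f (X t))"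
    "set_integrable lborel D (\<lambda>u. \<beta> * e u)"
  proof -
    have be: "\<bar>\<beta> * e u\<bar> \<le> \<beta>" if "u \<in> D" for u
      using mult_left_mono[OF e1(2)[OF that] \<beta>] \<beta> by (simp add: abs_mult)
    have bef: "\<bar>\<beta> * e u * f x\<bar> \<le> \<beta> * K" if "u \<in> D" for u x
      unfolding abs_mult[of "\<beta> * e u"] using be[OF that] \<beta> by (intro mult_mono c21D(3)[OF f]) auto
    show "set_integrable lborel D (\<lambda>u. \<beta> * e u * f (X u))"
      by (rule set_integrable_dominated[OF ic[of "\<beta> * K"]]) (auto intro: bef)
    show "set_integrable lborel D (\<lambda>u. \<beta> * e u * f (X t))"
      by (rule set_integrable_dominated[OF ic[of "\<beta> * K"]]) (auto intro: bef)
    show "set_integrable lborel D (\<lambda>u. \<beta> * e u)"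
      by (rule set_integrable_dominated[OF ic[of \<beta>]]) (auto intro: be)
  qed
  \<comment> \<open>The increment of the discount factor is minus the integral of
    \<open>\<beta> * e\<close>, so \<open>E4\<close> only compares \<open>f\<close> along the path
    with \<open>f\<close> at its endpoint.\<close>
  define E4 where "E4 = (e t - e s) * f (X t) + (LINT u:D|lborel. \<beta> * e u * f (X u))"
  have bE4: "\<bar>E4\<bar> \<le> K * (\<beta> * (4 * P))"
  proof -
    have "E4 = (LINT u:D|lborel. \<beta> * e u * f (X u)) - (LINT u:D|lborel. \<beta> * e u * f (X t))"
      unfolding E4_def by (simp only: set_integral_mult_left[where f = "\<lambda>u. \<beta> * e u"] Le) algebra
    also have "\<dots> = (LINT u:D|lborel. \<beta> * e u * f (X u) - \<beta> * e u * f (X t))"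
      using set_integral_diff(2)[OF ief(1,2)] by simp
    also have "\<bar>\<dots>\<bar> \<le> (LINT u:D|lborel. \<beta> * K * (2 * I + W) + \<beta> * K * om u)"
    proof (rule set_integral_abs_le)
      fix u assume u: "u \<in> D"
      have "\<bar>X t - X s\<bar> \<le> I + W" using Xs[of t] st by (simp add: D_def om_def W_def \<Delta>_def)
      then have "\<bar>X u - X t\<bar> \<le> 2 * I + W + om u" using Xs[OF u] by linarith
      then have "\<bar>f (X u) - f (X t)\<bar> \<le> K * (2 * I + W + om u)"
        using K by (intro order_trans[OF c21_lipschitz(1)[OF f]] mult_left_mono) auto
      then have "\<beta> * \<bar>e u\<bar> * \<bar>f (X u) - f (X t)\<bar> \<le> \<beta> * 1 * (K * (2 * I + W + om u))"
        using \<beta> e1[OF u] by (intro mult_mono) auto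
      moreover have "\<bar>\<beta> * e u * f (X u) - \<beta> * e u * f (X t)\<bar> = \<beta> * \<bar>e u\<bar> * \<bar>f (X u) - f (X t)\<bar>"
        unfolding right_diff_distrib[symmetric] abs_mult using \<beta> by simp
      ultimately show "\<bar>\<beta> * e u * f (X u) - \<beta> * e u * f (X t)\<bar> \<le> \<beta> * K * (2 * I + W) + \<beta> * K * om u"
        by (simp add: algebra_simps)
    qed (intro set_integral_add(1) set_integral_diff(1) set_integrable_mult_right ic io ief)+
    also have "\<dots> = h * (\<beta> * K * (2 * I + W)) + \<beta> * K * J"
      using set_integral_add(2)[OF ic set_integrable_mult_right[OF io(1), of "\<beta> * K"], of "\<beta> * K * (2 * I + W)"] by (simp add: Ic J_def)
    also have "\<dots> = K * (\<beta> * (2 * (h * I) + h * W + J))" by (simp add: algebra_simps)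
    also have "\<dots> \<le> K * (\<beta> * (4 * P))" using bhI bhW bJ K \<beta> by (intro mult_left_mono) auto
    finally show ?thesis .
  qed
  \<comment> \<open>The cost of evaluating the discount factor at \<open>s\<close> instead of at the
    running time.\<close>
  define E5 where "E5 = (LINT u:D|lborel. (e s - e u) * \<psi> u)"
  have i5: "set_integrable lborel D (\<lambda>u. (e s - e u) * \<psi> u)"
  proof (rule set_integrable_dominated[OF set_integrable_mult_right[OF set_integrable_abs[OF i\<psi>], of "\<beta> * h"]])
    fix u assume "u \<in> D"
    then show "\<bar>(e s - e u) * \<psi> u\<bar> \<le> \<beta> * h * \<bar>\<psi> u\<bar>" unfolding abs_mult by (intro mult_right_mono es) auto
  qed measurable
  have bE5: "\<bar>E5\<bar> \<le> K * (\<beta> * P + \<beta> * \<sigma>\<^sup>2 * P)"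
  proof -
    have "\<bar>E5\<bar> \<le> (LINT u:D|lborel. \<beta> * h * K * (\<sigma>\<^sup>2 / 2) + \<beta> * h * K * \<bar>a u\<bar>)"
      unfolding E5_def
    proof (rule set_integral_abs_le[OF i5])
      fix u assume u: "u \<in> D"
      have "\<bar>\<psi> u\<bar> \<le> \<bar>f1 (X u)\<bar> * \<bar>a u\<bar> + \<sigma>\<^sup>2 / 2 * \<bar>f2 (X u)\<bar>"
        unfolding \<psi>_def by (rule order_trans[OF abs_triangle_ineq]) (simp add: abs_mult)
      also have "\<dots> \<le> K * \<bar>a u\<bar> + \<sigma>\<^sup>2 / 2 * K"
        by (intro add_mono mult_right_mono mult_left_mono c21D(4,5)[OF f]) auto
      finally have "\<bar>e s - e u\<bar> * \<bar>\<psi> u\<bar> \<le> (\<beta> * h) * (K * \<bar>a u\<bar> + \<sigma>\<^sup>2 / 2 * K)"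
        using \<beta> h es[OF u] by (intro mult_mono) auto
      then show "\<bar>(e s - e u) * \<psi> u\<bar> \<le> \<beta> * h * K * (\<sigma>\<^sup>2 / 2) + \<beta> * h * K * \<bar>a u\<bar>"
        unfolding abs_mult by (simp add: algebra_simps)
    qed (intro set_integral_add(1) set_integrable_mult_right ic ia)
    also have "\<dots> = h * (\<beta> * h * K * (\<sigma>\<^sup>2 / 2)) + \<beta> * h * K * I"
      using set_integral_add(2)[OF ic set_integrable_mult_right[OF ia, of "\<beta> * h * K"], of "\<beta> * h * K * (\<sigma>\<^sup>2 / 2)"] by (simp add: Ic I_def)
    also have "\<dots> = K * (\<beta> * (h * I) + \<beta> * \<sigma>\<^sup>2 * (h * h / 2))" by (simp add: algebra_simps)
    also have "\<dots> \<le> K * (\<beta> * P + \<beta> * \<sigma>\<^sup>2 * P)"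
      using bhI bhh P0 h K \<beta> by (intro mult_left_mono add_mono) auto
    finally show ?thesis .
  qed
  have gen: "ito_gen \<beta> \<sigma> f f1 f2 u (X u) (a u) = e s * \<psi> u - (e s - e u) * \<psi> u - \<beta> * e u * f (X u)" for u
  proof -
    have "e s * \<psi> u - (e s - e u) * \<psi> u = e u * \<psi> u" by (simp add: left_diff_distrib)
    then show ?thesis by (simp add: ito_gen_def e_def \<psi>_def right_diff_distrib mult_ac)
  qed
  have Lgen: "(LINT u:D|lborel. ito_gen \<beta> \<sigma> f f1 f2 u (X u) (a u)) =
      e s * (LINT u:D|lborel. \<psi> u) - E5 - (LINT u:D|lborel. \<beta> * e u * f (X u))"
    unfolding gen E5_def
    using set_integral_diff(2)[OF set_integral_diff(1)[OF set_integrable_mult_right[OF i\<psi>, of "e s"] i5] ief(1)]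
      set_integral_diff(2)[OF set_integrable_mult_right[OF i\<psi>, of "e s"] i5] by simp
  \<comment> \<open>The parts of the final constant: 4 from \<open>E1\<close>, 1 from
    \<open>E2\<close>, \<open>\<sigma>\<^sup>2\<close> from \<open>E3\<close>,
    \<open>4 * \<beta>\<close> from \<open>E4\<close>, and
    \<open>\<beta> + \<beta> * \<sigma>\<^sup>2\<close> from \<open>E5\<close>.\<close>
  have "e t * f (X t) - e s * f (X s) - (LINT u:D|lborel. ito_gen \<beta> \<sigma> f f1 f2 u (X u) (a u))
      - e s * (f1 (X s) * \<Delta> + f2 (X s) / 2 * (\<Delta>\<^sup>2 - \<sigma>\<^sup>2 * h)) = e s * (E1 + E2 - E3) + E4 + E5"
    unfolding Lgen L\<psi> E1_def E2_def E3_def E4_def Xt by (simp add: algebra_simps diff_divide_distrib)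
  then have "\<bar>e t * f (X t) - e s * f (X s) - (LINT u:D|lborel. ito_gen \<beta> \<sigma> f f1 f2 u (X u) (a u))
      - e s * (f1 (X s) * \<Delta> + f2 (X s) / 2 * (\<Delta>\<^sup>2 - \<sigma>\<^sup>2 * h))\<bar> \<le> \<bar>e s * (E1 + E2 - E3)\<bar> + \<bar>E4\<bar> + \<bar>E5\<bar>"
    by linarith
  also have "\<bar>e s * (E1 + E2 - E3)\<bar> \<le> 1 * (\<bar>E1\<bar> + \<bar>E2\<bar> + \<bar>E3\<bar>)"
    unfolding abs_mult using e1[of s] st by (intro mult_mono) (auto simp: D_def)
  also have "1 * (\<bar>E1\<bar> + \<bar>E2\<bar> + \<bar>E3\<bar>) + \<bar>E4\<bar> + \<bar>E5\<bar>
      \<le> K * (4 * P) + K * P + K * (\<sigma>\<^sup>2 * P) + K * (\<beta> * (4 * P)) + K * (\<beta> * P + \<beta> * \<sigma>\<^sup>2 * P)"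
    unfolding mult_1 by (intro add_mono bE1 bE2 bE3 bE4 bE5)
  also have "\<dots> = K * (5 + \<sigma>\<^sup>2 + 5 * \<beta> + \<beta> * \<sigma>\<^sup>2) * P" by (simp add: algebra_simps)
  finally show ?thesis unfolding e_def \<Delta>_def h_def P_def D_def by simp
qed

section \<open>Joint measurability in time and chance, and the formula in expectation\<close>

context cont_brownian begin

sublocale T: pair_sigma_finite lborel M ..

lemma nonneg_fubini:
  fixes g :: "real \<times> 'w \<Rightarrow> real"
  assumes g: "g \<in> borel_measurable (lborel \<Otimes>\<^sub>M M)" "\<And>p. 0 \<le> g p"
    and fin: "(\<integral>\<^sup>+u. \<integral>\<^sup>+\<omega>. ennreal (g (u, \<omega>)) \<partial>M \<partial>lborel) \<le> ennreal c" and c: "0 \<le> c"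
  shows "integrable (lborel \<Otimes>\<^sub>M M) g" "integrable M (\<lambda>\<omega>. \<integral>u. g (u, \<omega>) \<partial>lborel)"
    "(\<integral>\<omega>. (\<integral>u. g (u, \<omega>) \<partial>lborel) \<partial>M) \<le> c"
proof -
  have nn: "(\<integral>\<^sup>+p. ennreal (g p) \<partial>(lborel \<Otimes>\<^sub>M M)) \<le> ennreal c"
    using fin g by (subst nn_integral_fst[symmetric]) auto
  have lt: "(\<integral>\<^sup>+p. ennreal (g p) \<partial>(lborel \<Otimes>\<^sub>M M)) < \<infinity>" using nn by (rule le_less_trans) simp
  show i: "integrable (lborel \<Otimes>\<^sub>M M) g"
    by (rule integrableI_nonneg[OF g(1) _ lt]) (simp add: g(2))
  have i': "integrable (lborel \<Otimes>\<^sub>M M) (case_prod (\<lambda>u \<omega>. g (u, \<omega>)))" using i by simp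
  show "integrable M (\<lambda>\<omega>. \<integral>u. g (u, \<omega>) \<partial>lborel)" by (rule T.integrable_snd[OF i'])
  have "(\<integral>\<omega>. (\<integral>u. g (u, \<omega>) \<partial>lborel) \<partial>M) = (\<integral>p. g p \<partial>(lborel \<Otimes>\<^sub>M M))"
    using T.integral_snd[OF i'] by simp
  also have "ennreal \<dots> = (\<integral>\<^sup>+p. ennreal (g p) \<partial>(lborel \<Otimes>\<^sub>M M))"
    by (rule nn_integral_eq_integral[symmetric, OF i]) (use g(2) in auto)
  finally have "ennreal (\<integral>\<omega>. (\<integral>u. g (u, \<omega>) \<partial>lborel) \<partial>M) \<le> ennreal c" using nn by simp
  then show "(\<integral>\<omega>. (\<integral>u. g (u, \<omega>) \<partial>lborel) \<partial>M) \<le> c" using c by (simp add: ennreal_le_iff)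
qed

text \<open>Progressive measurability speaks of one bounded time interval at a time; cutting off at
  integer times and letting the cut-off grow gives measurability on the whole product space, where
  Fubini can be used.\<close>

lemma progressive_joint:
  assumes p: "progressive F \<alpha>"
  shows "(\<lambda>(u, \<omega>). if 0 \<le> u then \<alpha> u \<omega> else 0) \<in> borel_measurable (lborel \<Otimes>\<^sub>M M)"
proof -
  define f where "f = (\<lambda>(u, \<omega>). \<alpha> u \<omega>)"
  have fin: "(\<lambda>p. f p * indicator ({0..real n} \<times> space M) p) \<in> borel_measurable (borel \<Otimes>\<^sub>M M)" for n
  proof -
    let ?R = "restrict_space (borel \<Otimes>\<^sub>M M) ({0..real n} \<times> space M)"
    have sn: "sets (F (real n)) \<subseteq> sets M" "space (F (real n)) = space M"
      using sub_F[of "real n"] by (auto simp: subalgebra_def)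
    have id: "(\<lambda>x. x) \<in> measurable M (F (real n))" using sn by (auto simp: measurable_def dest: sets.sets_into_space)
    have "(\<lambda>p. (fst p, snd p)) \<in> measurable ?R (restrict_space borel {0..real n} \<Otimes>\<^sub>M F (real n))"
    proof (rule measurable_Pair)
      show "(\<lambda>p. fst p) \<in> measurable ?R (restrict_space borel {0..real n})"
        by (rule measurable_restrict_space2) (auto simp: space_restrict_space intro!: measurable_restrict_space1)
      show "(\<lambda>p. snd p) \<in> measurable ?R (F (real n))"
        by (rule measurable_compose[OF _ id]) (auto intro!: measurable_restrict_space1)
    qed
    from measurable_compose[OF this p[unfolded progressive_def, rule_format, of "real n"]]
    have "f \<in> borel_measurable ?R" by (simp add: f_def)
    then show ?thesis
      by (subst (asm) borel_measurable_restrict_space_iff) (auto simp: space_pair_measure mult.commute intro!: pair_measureI)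
  qed
  have "(\<lambda>(u, \<omega>). if 0 \<le> u then \<alpha> u \<omega> else 0) \<in> borel_measurable (borel \<Otimes>\<^sub>M M)"
  proof (rule borel_measurable_LIMSEQ_real[OF _ fin])
    fix p assume "p \<in> space (borel \<Otimes>\<^sub>M M :: (real \<times> 'w) measure)"
    then obtain u \<omega> where p: "p = (u, \<omega>)" "\<omega> \<in> space M" by (auto simp: space_pair_measure)
    have "\<forall>\<^sub>F n in sequentially. f p * indicator ({0..real n} \<times> space M) p = (if 0 \<le> u then \<alpha> u \<omega> else 0)"
      using eventually_ge_at_top[of "nat \<lceil>u\<rceil>"]
    proof eventually_elim
      case (elim n)
      then have "u \<le> real n" by linarith
      then show ?case using p by (simp add: f_def)
    qed
    then show "(\<lambda>n. f p * indicator ({0..real n} \<times> space M) p) \<longlonglongrightarrow> (case p of (u, \<omega>) \<Rightarrow> if 0 \<le> u then \<alpha> u \<omega> else 0)"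
      using p by (simp add: tendsto_eventually)
  qed
  then show ?thesis by (simp cong: measurable_cong_sets)
qed

lemma progressive_integral_adapted:
  assumes p: "progressive F \<alpha>" and t: "0 \<le> t"
  shows "(\<lambda>\<omega>. LINT u:{0..t}|lborel. \<alpha> u \<omega>) \<in> borel_measurable (F t)"
proof -
  have m: "(\<lambda>(u, \<omega>). \<alpha> u \<omega>) \<in> borel_measurable (restrict_space borel {0..t} \<Otimes>\<^sub>M F t)"
    using p t by (simp add: progressive_def)
  interpret R: sigma_finite_measure "restrict_space lborel {0..t}"
    by (rule sigma_finite_measure_restrict_space) (auto intro: sigma_finite_lborel)
  have "(\<lambda>(\<omega>, u). \<alpha> u \<omega>) \<in> borel_measurable (F t \<Otimes>\<^sub>M restrict_space borel {0..t})"
    using measurable_pair_swap'[of "F t" "restrict_space borel {0..t}"] m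
    by (rule measurable_compose[where g = "\<lambda>(u, \<omega>). \<alpha> u \<omega>", simplified case_prod_beta fst_conv snd_conv, THEN measurable_cong[THEN iffD1, rotated]]) (auto simp: case_prod_beta)
  moreover have "sets (F t \<Otimes>\<^sub>M restrict_space lborel {0..t}) = sets (F t \<Otimes>\<^sub>M restrict_space borel {0..t})"
    by (intro sets_pair_measure_cong refl sets_restrict_space_cong) simp
  ultimately have "(\<lambda>(\<omega>, u). \<alpha> u \<omega>) \<in> borel_measurable (F t \<Otimes>\<^sub>M restrict_space lborel {0..t})"
    by (simp cong: measurable_cong_sets)
  then have "(\<lambda>\<omega>. \<integral>u. \<alpha> u \<omega> \<partial>restrict_space lborel {0..t}) \<in> borel_measurable (F t)"
    by (rule R.borel_measurable_lebesgue_integral)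
  then show ?thesis
    by (simp add: integral_restrict_space set_lebesgue_integral_def)
qed

lemma section_measurable:
  assumes "(\<lambda>(u, \<omega>). g u \<omega>) \<in> borel_measurable (lborel \<Otimes>\<^sub>M M)" "\<omega> \<in> space M"
  shows "(\<lambda>u. g u \<omega>) \<in> borel_measurable borel"
  using measurable_compose[OF measurable_Pair[OF measurable_ident measurable_const[OF assms(2)]] assms(1)] by simp

lemma state_joint_measurable:
  assumes a [measurable]: "(\<lambda>(u, \<omega>). a u \<omega>) \<in> borel_measurable (lborel \<Otimes>\<^sub>M M)"
    and x0 [measurable]: "x0 \<in> borel_measurable M"
  shows "(\<lambda>(u, \<omega>). x0 \<omega> + (LINT v:{0..u}|lborel. a v \<omega>) + \<sigma> * (if 0 \<le> u then B u \<omega> else 0)) \<in> borel_measurable (lborel \<Otimes>\<^sub>M M)"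
proof -
  have Bm: "(\<lambda>(u, \<omega>). if 0 \<le> u then B u \<omega> else 0) \<in> borel_measurable (lborel \<Otimes>\<^sub>M M)"
    by (rule progressive_joint[OF progressive_continuous[OF B_cont B_adapted]])
  have "(\<lambda>(p, v). (if 0 \<le> v \<and> v \<le> fst p then 1 else 0) *\<^sub>R a v (snd p)) \<in> borel_measurable ((lborel \<Otimes>\<^sub>M M) \<Otimes>\<^sub>M lborel)"
    by measurable
  from lborel.borel_measurable_lebesgue_integral[OF this]
  have "(\<lambda>p. LINT v:{0..fst p}|lborel. a v (snd p)) \<in> borel_measurable (lborel \<Otimes>\<^sub>M M)"
    unfolding set_lebesgue_integral_def indicator_def by simp
  then show ?thesis using Bm unfolding case_prod_unfold by measurable
qed

text \<open>The mean of \<open>exp (- \<beta> * t) * f (X t)\<close> minus the integrated generator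
  is constant in time. Over a step of length \<open>h\<close> it changes by at most
  \<open>D * sqrt h\<close> times \<open>h\<close> plus the energy of the step; both are additive
  over a partition, so \<open>n\<close> equal steps give a bound of order
  \<open>sqrt (T / n)\<close>.\<close>

lemma ito_expectation:
  assumes f: "c21 K f f1 f2" and \<beta>: "\<beta> \<ge> 0"
    and a: "(\<lambda>(u, \<omega>). a u \<omega>) \<in> borel_measurable (lborel \<Otimes>\<^sub>M M)"
    and X: "\<And>t \<omega>. 0 \<le> t \<Longrightarrow> X t \<omega> = x0 \<omega> + (LINT v:{0..t}|lborel. a v \<omega>) + \<sigma> * B t \<omega>"
    and Xad: "\<And>t. 0 \<le> t \<Longrightarrow> X t \<in> borel_measurable (F t)"
    and energy: "\<And>T. (\<integral>\<^sup>+u. \<integral>\<^sup>+\<omega>. ennreal (indicator {0..T} u * (a u \<omega>)\<^sup>2) \<partial>M \<partial>lborel) < \<infinity>"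
    and T: "0 \<le> T"
  shows "integrable (lborel \<Otimes>\<^sub>M M) (\<lambda>(u, \<omega>). indicator {0..T} u *\<^sub>R ito_gen \<beta> \<sigma> f f1 f2 u (X u \<omega>) (a u \<omega>))"
    and "(\<integral>\<omega>. (LINT u:{0..T}|lborel. ito_gen \<beta> \<sigma> f f1 f2 u (X u \<omega>) (a u \<omega>)) \<partial>M)
      = exp (- \<beta> * T) * (\<integral>\<omega>. f (X T \<omega>) \<partial>M) - (\<integral>\<omega>. f (X 0 \<omega>) \<partial>M)"
proof -
  note K = c21_nonneg[OF f]
  note [measurable] = a c21_measurable(1-3)[OF f]
  have XM: "X t \<in> borel_measurable M" if "0 \<le> t" for t by (rule F_into_M[OF that Xad[OF that]])
  have x0: "x0 = X 0"
  proof
    fix \<omega> show "x0 \<omega> = X 0 \<omega>" using X[of 0 \<omega>] by (simp add: B_zero set_integral_at_point)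
  qed
  have x0m [measurable]: "x0 \<in> borel_measurable M" unfolding x0 by (rule XM) simp
  \<comment> \<open>Versions that are also defined sensibly at negative times, so that they are
    measurable on the full product with the line; they agree with \<open>B\<close> and
    \<open>X\<close> from time 0 on.\<close>
  define Bj where "Bj u \<omega> = (if 0 \<le> u then B u \<omega> else 0)" for u \<omega>
  have Bjm [measurable]: "(\<lambda>(u, \<omega>). Bj u \<omega>) \<in> borel_measurable (lborel \<Otimes>\<^sub>M M)"
    unfolding Bj_def by (rule progressive_joint[OF progressive_continuous[OF B_cont B_adapted]])
  define Xj where "Xj u \<omega> = x0 \<omega> + (LINT v:{0..u}|lborel. a v \<omega>) + \<sigma> * Bj u \<omega>" for u \<omega>
  have XjX: "Xj u \<omega> = X u \<omega>" if "0 \<le> u" for u \<omega> using that by (simp add: Xj_def Bj_def X)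
  have Xjm [measurable]: "(\<lambda>(u, \<omega>). Xj u \<omega>) \<in> borel_measurable (lborel \<Otimes>\<^sub>M M)"
    unfolding Xj_def Bj_def by (rule state_joint_measurable[OF a x0m])
  define gen where "gen u \<omega> = ito_gen \<beta> \<sigma> f f1 f2 u (Xj u \<omega>) (a u \<omega>)" for u \<omega>
  have genm [measurable]: "(\<lambda>(u, \<omega>). gen u \<omega>) \<in> borel_measurable (lborel \<Otimes>\<^sub>M M)"
    unfolding gen_def ito_gen_def by measurable
  have ia2: "integrable (lborel \<Otimes>\<^sub>M M) (\<lambda>(u, \<omega>). indicator {s..t} u * (a u \<omega>)\<^sup>2)"
    and ea2: "integrable M (\<lambda>\<omega>. LINT u:{s..t}|lborel. (a u \<omega>)\<^sup>2)" if "0 \<le> s" for s t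
  proof -
    let ?N = "\<integral>\<^sup>+u. \<integral>\<^sup>+\<omega>. ennreal (indicator {s..t} u * (a u \<omega>)\<^sup>2) \<partial>M \<partial>lborel"
    have "?N \<le> (\<integral>\<^sup>+u. \<integral>\<^sup>+\<omega>. ennreal (indicator {0..t} u * (a u \<omega>)\<^sup>2) \<partial>M \<partial>lborel)"
      using that by (intro nn_integral_mono ennreal_leI) (auto simp: indicator_def)
    also have "\<dots> < \<infinity>" by (rule energy)
    finally have "?N \<noteq> \<top>" by simp
    then obtain c where c: "0 \<le> c" "?N = ennreal c" by (cases ?N) auto
    have m: "(\<lambda>p. indicator {s..t} (fst p) * (a (fst p) (snd p))\<^sup>2) \<in> borel_measurable (lborel \<Otimes>\<^sub>M M)"
      using a unfolding case_prod_unfold by measurable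
    note nf = nonneg_fubini[OF m, of c]
    show "integrable (lborel \<Otimes>\<^sub>M M) (\<lambda>(u, \<omega>). indicator {s..t} u * (a u \<omega>)\<^sup>2)"
      "integrable M (\<lambda>\<omega>. LINT u:{s..t}|lborel. (a u \<omega>)\<^sup>2)"
      using nf(1,2) c by (simp_all add: case_prod_unfold set_lebesgue_integral_def)
  qed
  \<comment> \<open>Finite mean energy makes almost every path square integrable on bounded
    intervals. Integer end points yield one exceptional null set for all intervals.\<close>
  have good: "AE \<omega> in M. \<forall>n::nat. set_integrable lborel {0..real n} (\<lambda>u. (a u \<omega>)\<^sup>2)"
    unfolding AE_all_countable
  proof
    fix n :: nat
    show "AE \<omega> in M. set_integrable lborel {0..real n} (\<lambda>u. (a u \<omega>)\<^sup>2)"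
      using T.AE_integrable_snd[OF ia2[of 0 "real n"]] by (simp add: set_integrable_def)
  qed
  have goodI: "set_integrable lborel {s..t} (\<lambda>u. (a u \<omega>)\<^sup>2)"
    if "\<forall>n::nat. set_integrable lborel {0..real n} (\<lambda>u. (a u \<omega>)\<^sup>2)" "0 \<le> s" for \<omega> s t
  proof (rule set_integrable_subset[OF that(1)[rule_format, of "nat \<lceil>t\<rceil>"]])
    show "{s..t} \<subseteq> {0..real (nat \<lceil>t\<rceil>)}" using that(2) by (auto intro: order_trans[OF _ real_nat_ceiling_ge])
  qed auto
  have igen: "integrable (lborel \<Otimes>\<^sub>M M) (\<lambda>(u, \<omega>). indicator {0..t} u *\<^sub>R gen u \<omega>)" for t
  proof -
    have i1: "integrable (lborel \<Otimes>\<^sub>M M) (\<lambda>(u, \<omega>). indicator {0..t} u * 1 :: real)"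
    proof -
      have m: "(\<lambda>p. indicator {0..t} (fst p) :: real) \<in> borel_measurable (lborel \<Otimes>\<^sub>M M)" by measurable
      have "(\<integral>\<^sup>+u. \<integral>\<^sup>+\<omega>. ennreal (indicator {0..t} u) \<partial>M \<partial>lborel) \<le> ennreal (max 0 t)"
        by (auto simp: emeasure_space_1 ennreal_indicator emeasure_lborel_Icc_eq)
      from nonneg_fubini(1)[OF m _ _, of "max 0 t"] this show ?thesis by (simp add: case_prod_unfold)
    qed
    have i: "integrable (lborel \<Otimes>\<^sub>M M) (\<lambda>p. K * ((1 + \<sigma>\<^sup>2 / 2 + \<beta>) * (case p of (u, \<omega>) \<Rightarrow> indicator {0..t} u * 1) + (case p of (u, \<omega>) \<Rightarrow> indicator {0..t} u * (a u \<omega>)\<^sup>2)))"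
      by (intro integrable_mult_right Bochner_Integration.integrable_add i1 ia2) simp
    show ?thesis
    proof (rule Bochner_Integration.integrable_bound[OF i])
      show "(\<lambda>(u, \<omega>). indicator {0..t} u *\<^sub>R gen u \<omega>) \<in> borel_measurable (lborel \<Otimes>\<^sub>M M)" by measurable
      show "AE p in lborel \<Otimes>\<^sub>M M. norm (case p of (u, \<omega>) \<Rightarrow> indicator {0..t} u *\<^sub>R gen u \<omega>)
          \<le> norm (K * ((1 + \<sigma>\<^sup>2 / 2 + \<beta>) * (case p of (u, \<omega>) \<Rightarrow> indicator {0..t} u * 1) + (case p of (u, \<omega>) \<Rightarrow> indicator {0..t} u * (a u \<omega>)\<^sup>2)))"
      proof (rule AE_I2)
        fix p :: "real \<times> 'w"
        obtain u \<omega> where p: "p = (u, \<omega>)" by (cases p)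
        have "\<bar>gen u \<omega>\<bar> \<le> K * ((1 + \<sigma>\<^sup>2 / 2 + \<beta>) + (a u \<omega>)\<^sup>2)" if u: "0 \<le> u"
        proof -
          let ?x = "Xj u \<omega>"
          have "\<bar>f1 ?x * a u \<omega> + \<sigma>\<^sup>2 / 2 * f2 ?x - \<beta> * f ?x\<bar> \<le> \<bar>f1 ?x\<bar> * \<bar>a u \<omega>\<bar> + \<sigma>\<^sup>2 / 2 * \<bar>f2 ?x\<bar> + \<beta> * \<bar>f ?x\<bar>"
            using abs_triangle_ineq4[of "f1 ?x * a u \<omega> + \<sigma>\<^sup>2 / 2 * f2 ?x" "\<beta> * f ?x"] abs_triangle_ineq[of "f1 ?x * a u \<omega>" "\<sigma>\<^sup>2 / 2 * f2 ?x"] \<beta>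
            by (simp add: abs_mult)
          also have "\<dots> \<le> K * (1 + (a u \<omega>)\<^sup>2) + \<sigma>\<^sup>2 / 2 * K + \<beta> * K"
            using K \<beta> mult_le_sum_squares[of 1 "\<bar>a u \<omega>\<bar>"] by (intro add_mono mult_mono c21D(3-5)[OF f]) auto
          finally have "\<bar>f1 ?x * a u \<omega> + \<sigma>\<^sup>2 / 2 * f2 ?x - \<beta> * f ?x\<bar> \<le> K * ((1 + \<sigma>\<^sup>2 / 2 + \<beta>) + (a u \<omega>)\<^sup>2)" by (simp add: algebra_simps)
          moreover have "exp (- \<beta> * u) \<le> 1" using u \<beta> by simp
          ultimately have "exp (- \<beta> * u) * \<bar>f1 ?x * a u \<omega> + \<sigma>\<^sup>2 / 2 * f2 ?x - \<beta> * f ?x\<bar> \<le> 1 * (K * ((1 + \<sigma>\<^sup>2 / 2 + \<beta>) + (a u \<omega>)\<^sup>2))"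
            by (intro mult_mono) auto
          then show ?thesis by (simp add: gen_def ito_gen_def abs_mult)
        qed
        then show "norm (case p of (u, \<omega>) \<Rightarrow> indicator {0..t} u *\<^sub>R gen u \<omega>)
            \<le> norm (K * ((1 + \<sigma>\<^sup>2 / 2 + \<beta>) * (case p of (u, \<omega>) \<Rightarrow> indicator {0..t} u * 1) + (case p of (u, \<omega>) \<Rightarrow> indicator {0..t} u * (a u \<omega>)\<^sup>2)))"
          by (cases "u \<in> {0..t}") (auto simp: p intro: order_trans[OF _ abs_ge_self])
      qed
    qed
  qed
  have goodgen: "AE \<omega> in M. set_integrable lborel {0..t} (\<lambda>u. gen u \<omega>)" for t
    using T.AE_integrable_snd[OF igen] by (simp add: set_integrable_def)
  have Igen: "integrable M (\<lambda>\<omega>. LINT u:{0..t}|lborel. gen u \<omega>)" for t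
    using T.integrable_snd[OF igen] by (simp add: set_lebesgue_integral_def)
  define \<rho> where "\<rho> t \<omega> = exp (- \<beta> * t) * f (X t \<omega>) - (LINT u:{0..t}|lborel. gen u \<omega>)" for t \<omega>
  have ifX: "integrable M (\<lambda>\<omega>. f (X t \<omega>))" "integrable M (\<lambda>\<omega>. f1 (X t \<omega>))" "integrable M (\<lambda>\<omega>. f2 (X t \<omega>))" if "0 \<le> t" for t
    using measurable_compose[OF XM[OF that] c21_measurable(1)[OF f]] measurable_compose[OF XM[OF that] c21_measurable(2)[OF f]]
      measurable_compose[OF XM[OF that] c21_measurable(3)[OF f]] c21D(3-5)[OF f] by (blast intro: integrable_bounded)+
  have i\<rho>: "integrable M (\<rho> t)" if "0 \<le> t" for t
    unfolding \<rho>_def by (intro Bochner_Integration.integrable_diff integrable_mult_right ifX that Igen)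
  define e where "e s t = (\<integral>\<omega>. (LINT u:{s..t}|lborel. (a u \<omega>)\<^sup>2) \<partial>M)" for s t
  have e0: "0 \<le> e s t" for s t
    unfolding e_def set_lebesgue_integral_def by (intro Bochner_Integration.integral_nonneg) (auto simp: indicator_def)
  define C where "C = K * (5 + \<sigma>\<^sup>2 + 5 * \<beta> + \<beta> * \<sigma>\<^sup>2)"
  have C: "0 \<le> C" using K \<beta> by (auto simp: C_def)
  define D where "D = C * (1 + 2 * \<sigma>\<^sup>2 + 3 * \<sigma> ^ 4)"
  have D: "0 \<le> D" using C by (simp add: D_def)
  have step: "\<bar>(\<integral>\<omega>. \<rho> t \<omega> \<partial>M) - (\<integral>\<omega>. \<rho> s \<omega> \<partial>M)\<bar> \<le> D * sqrt (t - s) * ((t - s) + e s t)"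
    if st: "0 \<le> s" "s < t" "t - s \<le> 1" for s t
  proof -
    define h where "h = t - s"
    define r where "r = sqrt h"
    have h: "0 < h" "h \<le> 1" using st by (auto simp: h_def)
    have r: "0 < r" "r * r = h" using h by (auto simp: r_def)
    define w where "w \<omega> u = \<sigma> * Bj u \<omega>" for \<omega> u
    \<comment> \<open>The martingale part of the step: a linear term whose coefficient is known at
      time \<open>s\<close>, and a squared increment compensated by its mean. Both have expectation
      0 by independence.\<close>
    define Mart where "Mart \<omega> = exp (- \<beta> * s) * (f1 (X s \<omega>) * (w \<omega> t - w \<omega> s) + f2 (X s \<omega>) / 2 * ((w \<omega> t - w \<omega> s)\<^sup>2 - \<sigma>\<^sup>2 * (t - s)))" for \<omega>
    have wst: "w \<omega> t - w \<omega> s = \<sigma> * (B t \<omega> - B s \<omega>)" for \<omega> using st by (simp add: w_def Bj_def right_diff_distrib)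
    define P where "P \<omega> = step_error s t (\<lambda>u. a u \<omega>) (w \<omega>)" for \<omega>
    have pathwise: "AE \<omega> in M. \<bar>\<rho> t \<omega> - \<rho> s \<omega> - Mart \<omega>\<bar> \<le> C * P \<omega>"
      using good goodgen[of t] AE_space
    proof eventually_elim
      case (elim \<omega>)
      have am: "(\<lambda>u. a u \<omega>) \<in> borel_measurable borel" by (rule section_measurable[OF a elim(3)])
      have Xm: "(\<lambda>u. Xj u \<omega>) \<in> borel_measurable borel" by (rule section_measurable[OF Xjm elim(3)])
      have wm: "w \<omega> \<in> borel_measurable borel" unfolding w_def[abs_def] using section_measurable[OF Bjm elim(3)] by measurable
      have wc: "continuous_on {s..t} (w \<omega>)"
      proof -
        have "continuous_on {s..t} (\<lambda>u. \<sigma> * B u \<omega>)"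
          by (intro continuous_intros continuous_on_subset[OF B_cont]) (use st in auto)
        then show ?thesis by (rule continuous_on_eq) (use st in \<open>simp add: w_def Bj_def\<close>)
      qed
      have ia0: "set_integrable lborel {0..t} (\<lambda>u. a u \<omega>)"
        by (rule set_integrable_dominated[OF set_integral_add(1)[OF set_integrable_const_Icc[of 0 t 1] goodI[OF elim(1)]]])
           (use am mult_le_sum_squares[of 1 "\<bar>a u \<omega>\<bar>" for u] in auto)
      have Xinc: "Xj u \<omega> = Xj s \<omega> + (LINT v:{s..u}|lborel. a v \<omega>) + (w \<omega> u - w \<omega> s)" if "u \<in> {s..t}" for u
      proof -
        have "set_integrable lborel {0..u} (\<lambda>u. a u \<omega>)" by (rule set_integrable_subset[OF ia0]) (use that in auto)
        from set_integral_split[OF this, of s] that st show ?thesis by (simp add: Xj_def w_def)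
      qed
      have split: "(LINT u:{0..t}|lborel. gen u \<omega>) = (LINT u:{0..s}|lborel. gen u \<omega>) + (LINT u:{s..t}|lborel. gen u \<omega>)"
        by (rule set_integral_split[OF elim(2)]) (use st in auto)
      have regroup: "(x - (i + l)) - (y - i) - m = x - y - l - m" for x i l y m :: real by simp
      have Xst: "Xj s \<omega> = X s \<omega>" "Xj t \<omega> = X t \<omega>" using st by (auto intro: XjX)
      show ?case
        unfolding \<rho>_def split regroup Mart_def C_def P_def
        using ito_step_bound[OF f \<beta> st am goodI[OF elim(1) st(1)] wc Xm wm Xinc, of \<sigma>]
        unfolding Xst gen_def[symmetric] .
    qed
    have X_Fs: "(\<lambda>\<omega>. f1 (X s \<omega>)) \<in> borel_measurable (F s)" "(\<lambda>\<omega>. f2 (X s \<omega>)) \<in> borel_measurable (F s)"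
      using measurable_compose[OF Xad[OF st(1)] c21_measurable(2)[OF f]] measurable_compose[OF Xad[OF st(1)] c21_measurable(3)[OF f]] by auto
    note m1 = increment_power_product[OF st(1,2) X_Fs(1) c21D(4)[OF f], of 1]
    note m2 = increment_power_product[OF st(1,2) X_Fs(2) c21D(5)[OF f], of 2]
    have Mart_eq: "Mart \<omega> = exp (- \<beta> * s) * (\<sigma> * (f1 (X s \<omega>) * (B t \<omega> - B s \<omega>) ^ 1) + \<sigma>\<^sup>2 / 2 * (f2 (X s \<omega>) * (B t \<omega> - B s \<omega>)\<^sup>2) - \<sigma>\<^sup>2 / 2 * (t - s) * f2 (X s \<omega>))" for \<omega>
    proof -
      have "c * (p * (\<sigma> * d) + q / 2 * ((\<sigma> * d)\<^sup>2 - \<sigma>\<^sup>2 * \<tau>)) = c * (\<sigma> * (p * d ^ 1) + \<sigma>\<^sup>2 / 2 * (q * d\<^sup>2) - \<sigma>\<^sup>2 / 2 * \<tau> * q)"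
        for c p q d \<tau> :: real by (simp add: power2_eq_square field_simps)
      then show ?thesis unfolding Mart_def wst .
    qed
    have iM: "integrable M Mart" unfolding Mart_eq[abs_def]
      by (intro integrable_mult_right Bochner_Integration.integrable_add Bochner_Integration.integrable_diff m1(1) m2(1) ifX st(1))
    have EM: "(\<integral>\<omega>. Mart \<omega> \<partial>M) = 0"
    proof -
      have "(\<integral>\<omega>. Mart \<omega> \<partial>M) = exp (- \<beta> * s) * (\<sigma> * (\<integral>\<omega>. f1 (X s \<omega>) * (B t \<omega> - B s \<omega>) ^ 1 \<partial>M)
          + \<sigma>\<^sup>2 / 2 * (\<integral>\<omega>. f2 (X s \<omega>) * (B t \<omega> - B s \<omega>)\<^sup>2 \<partial>M) - \<sigma>\<^sup>2 / 2 * (t - s) * (\<integral>\<omega>. f2 (X s \<omega>) \<partial>M))"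
        unfolding Mart_eq using m1(1) m2(1) ifX(3)[OF st(1)] by simp
      also have "\<dots> = 0" unfolding m1(2) m2(2) using increment_moments[OF st(1,2)] by simp
      finally show ?thesis .
    qed
    have iS: "integrable M (\<lambda>\<omega>. LINT u:{s..t}|lborel. (a u \<omega>)\<^sup>2)" by (rule ea2[OF st(1)])
    have pw2: "(w \<omega> t - w \<omega> s)\<^sup>2 = \<sigma>\<^sup>2 * (B t \<omega> - B s \<omega>)\<^sup>2" and pw4: "(w \<omega> t - w \<omega> s) ^ 4 = \<sigma> ^ 4 * (B t \<omega> - B s \<omega>) ^ 4" for \<omega>
      unfolding wst by (simp_all add: power_mult_distrib)
    have iV: "integrable M (\<lambda>\<omega>. LINT u:{s..t}|lborel. (w \<omega> u - w \<omega> s)\<^sup>2)"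
      and EV: "(\<integral>\<omega>. (LINT u:{s..t}|lborel. (w \<omega> u - w \<omega> s)\<^sup>2) \<partial>M) \<le> \<sigma>\<^sup>2 * h * h"
    proof -
      have Bsm [measurable]: "Bj s \<in> borel_measurable M" unfolding Bj_def[abs_def] using measurable_B[of s] st by simp
      have m: "(\<lambda>p. indicator {s..t} (fst p) * (w (snd p) (fst p) - w (snd p) s)\<^sup>2) \<in> borel_measurable (lborel \<Otimes>\<^sub>M M)"
        unfolding w_def using Bjm unfolding case_prod_unfold by measurable
      have "(\<integral>\<^sup>+u. \<integral>\<^sup>+\<omega>. ennreal (indicator {s..t} u * (w \<omega> u - w \<omega> s)\<^sup>2) \<partial>M \<partial>lborel)
          \<le> (\<integral>\<^sup>+u. ennreal (\<sigma>\<^sup>2 * h) * indicator {s..t} u \<partial>lborel)"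
      proof (rule nn_integral_mono)
        fix u :: real
        show "(\<integral>\<^sup>+\<omega>. ennreal (indicator {s..t} u * (w \<omega> u - w \<omega> s)\<^sup>2) \<partial>M) \<le> ennreal (\<sigma>\<^sup>2 * h) * indicator {s..t} u"
        proof (cases "s < u \<and> u \<le> t")
          case True
          have eq: "(w \<omega> u - w \<omega> s)\<^sup>2 = \<sigma>\<^sup>2 * (B u \<omega> - B s \<omega>)\<^sup>2" for \<omega>
            using True st by (simp add: w_def Bj_def right_diff_distrib[symmetric] power_mult_distrib)
          have i: "integrable M (\<lambda>\<omega>. \<sigma>\<^sup>2 * (B u \<omega> - B s \<omega>)\<^sup>2)"
            using increment_power(1)[of s u 2] True st by (intro integrable_mult_right) auto
          have "(\<integral>\<^sup>+\<omega>. ennreal (indicator {s..t} u * (w \<omega> u - w \<omega> s)\<^sup>2) \<partial>M) = (\<integral>\<^sup>+\<omega>. ennreal (\<sigma>\<^sup>2 * (B u \<omega> - B s \<omega>)\<^sup>2) \<partial>M)"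
            using True by (simp add: eq)
          also have "\<dots> = ennreal (\<integral>\<omega>. \<sigma>\<^sup>2 * (B u \<omega> - B s \<omega>)\<^sup>2 \<partial>M)"
            by (rule nn_integral_eq_integral[OF i]) simp
          also have "(\<integral>\<omega>. \<sigma>\<^sup>2 * (B u \<omega> - B s \<omega>)\<^sup>2 \<partial>M) = \<sigma>\<^sup>2 * (u - s)"
            using increment_moments(2)[of s u] True st by simp
          also have "ennreal (\<sigma>\<^sup>2 * (u - s)) \<le> ennreal (\<sigma>\<^sup>2 * h)"
            using True by (intro ennreal_leI mult_left_mono) (auto simp: h_def)
          finally show ?thesis using True by simp
        next
          case False
          then have "indicator {s..t} u * (w \<omega> u - w \<omega> s)\<^sup>2 = 0" for \<omega>
            by (cases "u = s") (auto simp: indicator_def)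
          then have "(\<integral>\<^sup>+\<omega>. ennreal (indicator {s..t} u * (w \<omega> u - w \<omega> s)\<^sup>2) \<partial>M) = 0"
            by (simp only: ennreal_0 nn_integral_const mult_zero_left)
          then show ?thesis by (simp only: zero_le)
        qed
      qed
      also have "\<dots> = ennreal (\<sigma>\<^sup>2 * h) * ennreal h"
        using st by (simp add: nn_integral_cmult h_def)
      also have "\<dots> = ennreal (\<sigma>\<^sup>2 * h * h)" using h by (simp add: ennreal_mult')
      finally have "(\<integral>\<^sup>+u. \<integral>\<^sup>+\<omega>. ennreal (indicator {s..t} u * (w \<omega> u - w \<omega> s)\<^sup>2) \<partial>M \<partial>lborel) \<le> ennreal (\<sigma>\<^sup>2 * h * h)" .
      with nonneg_fubini(2,3)[OF m, of "\<sigma>\<^sup>2 * h * h"] h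
      show "integrable M (\<lambda>\<omega>. LINT u:{s..t}|lborel. (w \<omega> u - w \<omega> s)\<^sup>2)"
        "(\<integral>\<omega>. (LINT u:{s..t}|lborel. (w \<omega> u - w \<omega> s)\<^sup>2) \<partial>M) \<le> \<sigma>\<^sup>2 * h * h"
        by (simp_all add: set_lebesgue_integral_def)
    qed
    note ip = increment_power(1)[OF st(1,2)]
    have P_eq: "P \<omega> = r * (h + (LINT u:{s..t}|lborel. (a u \<omega>)\<^sup>2) + \<sigma>\<^sup>2 * (B t \<omega> - B s \<omega>)\<^sup>2)
        + (\<sigma> ^ 4 * (B t \<omega> - B s \<omega>) ^ 4 + (LINT u:{s..t}|lborel. (w \<omega> u - w \<omega> s)\<^sup>2)) / r" for \<omega>
      unfolding P_def step_error_def pw2[of \<omega>, unfolded w_def, folded w_def] pw2 pw4 r_def h_def by simp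
    have iP: "integrable M P" unfolding P_eq[abs_def]
      by (intro integrable_mult_right integrable_divide Bochner_Integration.integrable_add ip iS iV) auto
    have EP: "(\<integral>\<omega>. P \<omega> \<partial>M) \<le> (1 + 2 * \<sigma>\<^sup>2 + 3 * \<sigma> ^ 4) * (r * (h + e s t))"
    proof -
      have "(\<integral>\<omega>. P \<omega> \<partial>M) = r * (h + e s t + \<sigma>\<^sup>2 * h) + (\<sigma> ^ 4 * (3 * h\<^sup>2) + (\<integral>\<omega>. (LINT u:{s..t}|lborel. (w \<omega> u - w \<omega> s)\<^sup>2) \<partial>M)) / r"
        unfolding P_eq e_def using ip iS iV increment_moments[OF st(1,2)] by (simp add: prob_space h_def)
      also have "\<dots> \<le> r * (h + e s t + \<sigma>\<^sup>2 * h) + (\<sigma> ^ 4 * (3 * h\<^sup>2) + \<sigma>\<^sup>2 * h * h) / r"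
        using EV r by (intro add_left_mono divide_right_mono) auto
      also have "\<dots> = r * (h + e s t) + (2 * \<sigma>\<^sup>2 + 3 * \<sigma> ^ 4) * (r * h)"
        using r(1) by (simp add: r(2)[symmetric] power2_eq_square field_simps)
      also have "\<dots> \<le> r * (h + e s t) + (2 * \<sigma>\<^sup>2 + 3 * \<sigma> ^ 4) * (r * (h + e s t))"
        using r e0[of s t] by (intro add_left_mono mult_left_mono) auto
      finally show ?thesis by (simp add: algebra_simps)
    qed
    have id: "integrable M (\<lambda>\<omega>. \<rho> t \<omega> - \<rho> s \<omega> - Mart \<omega>)"
      using i\<rho>[of t] i\<rho>[of s] iM st by auto
    have "(\<integral>\<omega>. \<rho> t \<omega> \<partial>M) - (\<integral>\<omega>. \<rho> s \<omega> \<partial>M) = (\<integral>\<omega>. \<rho> t \<omega> - \<rho> s \<omega> - Mart \<omega> \<partial>M)"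
      using i\<rho>[of t] i\<rho>[of s] iM EM st by simp
    also have "\<bar>\<dots>\<bar> \<le> (\<integral>\<omega>. \<bar>\<rho> t \<omega> - \<rho> s \<omega> - Mart \<omega>\<bar> \<partial>M)" by (rule integral_abs_bound)
    also have "\<dots> \<le> (\<integral>\<omega>. C * P \<omega> \<partial>M)"
      by (rule integral_mono_AE[OF integrable_abs[OF id] integrable_mult_right[OF iP] pathwise])
    also have "\<dots> = C * (\<integral>\<omega>. P \<omega> \<partial>M)" by simp
    also have "\<dots> \<le> C * ((1 + 2 * \<sigma>\<^sup>2 + 3 * \<sigma> ^ 4) * (r * (h + e s t)))" by (rule mult_left_mono[OF EP C])
    finally show ?thesis by (simp add: D_def r_def h_def mult_ac)
  qed
  have eadd: "e 0 t = e 0 s + e s t" if "0 \<le> s" "s \<le> t" for s t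
  proof -
    have "e 0 t = (\<integral>\<omega>. (LINT u:{0..s}|lborel. (a u \<omega>)\<^sup>2) + (LINT u:{s..t}|lborel. (a u \<omega>)\<^sup>2) \<partial>M)"
      unfolding e_def
    proof (rule integral_cong_AE)
      show "AE \<omega> in M. (LINT u:{0..t}|lborel. (a u \<omega>)\<^sup>2) = (LINT u:{0..s}|lborel. (a u \<omega>)\<^sup>2) + (LINT u:{s..t}|lborel. (a u \<omega>)\<^sup>2)"
        using good by eventually_elim (rule set_integral_split[OF goodI], use that in auto)
    qed (use ea2 that in auto)
    also have "\<dots> = e 0 s + e s t" using ea2[of 0 s] ea2[of s t] that by (simp add: e_def)
    finally show ?thesis .
  qed
  have eq: "(\<integral>\<omega>. \<rho> T \<omega> \<partial>M) = (\<integral>\<omega>. \<rho> 0 \<omega> \<partial>M)"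
  proof (cases "T = 0")
    case False
    then have T: "T > 0" using T by simp
    have bound: "\<bar>(\<integral>\<omega>. \<rho> T \<omega> \<partial>M) - (\<integral>\<omega>. \<rho> 0 \<omega> \<partial>M)\<bar> \<le> D * sqrt (T / real n) * (T + e 0 T)" if n: "n \<ge> 1" "T \<le> real n" for n
    proof -
      define h where "h = T / real n"
      have h: "0 < h" "h \<le> 1" "real n * h = T" using T n by (auto simp: h_def)
      have "\<bar>(\<integral>\<omega>. \<rho> (real k * h) \<omega> \<partial>M) - (\<integral>\<omega>. \<rho> 0 \<omega> \<partial>M)\<bar> \<le> D * sqrt h * (real k * h + e 0 (real k * h))" for k
      proof (induction k)
        case 0 then show ?case using D e0 h by simp
      next
        case (Suc k)
        have d: "real (Suc k) * h - real k * h = h" by (simp add: algebra_simps)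
        have lt: "0 \<le> real k * h" "real k * h < real (Suc k) * h" "real (Suc k) * h - real k * h \<le> 1" unfolding d using h by auto
        have "D * sqrt h * (real k * h + e 0 (real k * h)) + D * sqrt h * (h + e (real k * h) (real (Suc k) * h))
            = D * sqrt h * (real (Suc k) * h + e 0 (real (Suc k) * h))"
          using eadd[OF lt(1) less_imp_le[OF lt(2)]] by (simp add: algebra_simps)
        then show ?case using Suc step[OF lt] unfolding d by linarith
      qed
      from this[of n] show ?thesis unfolding h(3) by (simp add: h_def)
    qed
    have lim: "(\<lambda>n. D * sqrt (T / real n) * (T + e 0 T)) \<longlonglongrightarrow> D * sqrt 0 * (T + e 0 T)"
      by (intro tendsto_mult tendsto_const tendsto_real_sqrt lim_const_over_n)
    have "\<bar>(\<integral>\<omega>. \<rho> T \<omega> \<partial>M) - (\<integral>\<omega>. \<rho> 0 \<omega> \<partial>M)\<bar> \<le> D * sqrt 0 * (T + e 0 T)"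
    proof (rule tendsto_lowerbound[OF lim])
      show "\<forall>\<^sub>F n in sequentially. \<bar>(\<integral>\<omega>. \<rho> T \<omega> \<partial>M) - (\<integral>\<omega>. \<rho> 0 \<omega> \<partial>M)\<bar> \<le> D * sqrt (T / real n) * (T + e 0 T)"
        using eventually_ge_at_top[of "max 1 (nat \<lceil>T\<rceil>)"]
      proof eventually_elim
        case (elim n)
        then have "n \<ge> 1" "T \<le> real n" by (auto simp: nat_le_iff ceiling_le_iff)
        then show ?case by (rule bound)
      qed
    qed simp
    then show ?thesis by simp
  qed simp
  have congX: "(LINT u:{0..t}|lborel. ito_gen \<beta> \<sigma> f f1 f2 u (X u \<omega>) (a u \<omega>)) = (LINT u:{0..t}|lborel. gen u \<omega>)" for t \<omega>
    unfolding gen_def by (rule set_lebesgue_integral_cong) (auto simp: XjX)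
  have "(\<lambda>(u, \<omega>). indicator {0..T} u *\<^sub>R ito_gen \<beta> \<sigma> f f1 f2 u (X u \<omega>) (a u \<omega>)) = (\<lambda>(u, \<omega>). indicator {0..T} u *\<^sub>R gen u \<omega>)"
    by (auto simp: fun_eq_iff gen_def XjX indicator_def)
  then show "integrable (lborel \<Otimes>\<^sub>M M) (\<lambda>(u, \<omega>). indicator {0..T} u *\<^sub>R ito_gen \<beta> \<sigma> f f1 f2 u (X u \<omega>) (a u \<omega>))"
    using igen[of T] by simp
  have \<rho>0: "(\<integral>\<omega>. \<rho> 0 \<omega> \<partial>M) = (\<integral>\<omega>. f (X 0 \<omega>) \<partial>M)"
    unfolding \<rho>_def by (simp add: set_integral_at_point)
  have "(\<integral>\<omega>. \<rho> T \<omega> \<partial>M) = exp (- \<beta> * T) * (\<integral>\<omega>. f (X T \<omega>) \<partial>M) - (\<integral>\<omega>. (LINT u:{0..T}|lborel. gen u \<omega>) \<partial>M)"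
    unfolding \<rho>_def using ifX(1)[OF T] Igen[of T] by simp
  then show "(\<integral>\<omega>. (LINT u:{0..T}|lborel. ito_gen \<beta> \<sigma> f f1 f2 u (X u \<omega>) (a u \<omega>)) \<partial>M)
      = exp (- \<beta> * T) * (\<integral>\<omega>. f (X T \<omega>) \<partial>M) - (\<integral>\<omega>. f (X 0 \<omega>) \<partial>M)"
    unfolding congX using eq \<rho>0 by simp
qed

end

section \<open>Discounted cost and verification\<close>

lemma enn2ereal_nn_integral_diff:
  fixes f :: "'a \<Rightarrow> real"
  assumes f: "integrable N f"
  shows "enn2ereal (\<integral>\<^sup>+x. ennreal (f x) \<partial>N) - enn2ereal (\<integral>\<^sup>+x. ennreal (- f x) \<partial>N) = ereal (\<integral>x. f x \<partial>N)"
proof -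
  have fin: "(\<integral>\<^sup>+x. ennreal (f x) \<partial>N) \<noteq> \<infinity>" "(\<integral>\<^sup>+x. ennreal (- f x) \<partial>N) \<noteq> \<infinity>"
    using f unfolding real_integrable_def by auto
  have e: "enn2ereal x = ereal (enn2real x)" if "x \<noteq> \<infinity>" for x
    using that by (cases x) auto
  show ?thesis unfolding e[OF fin(1)] e[OF fin(2)] real_lebesgue_integral_def[OF f] by simp
qed

lemma ereal_integral_integrable:
  fixes f :: "'a \<Rightarrow> real"
  assumes "integrable N f"
  shows "ereal_integral N (\<lambda>x. ereal (f x)) = ereal (\<integral>x. f x \<partial>N)"
  unfolding ereal_integral_def using enn2ereal_nn_integral_diff[OF assms] by simp

lemma ereal_integral_cong_AE:
  assumes "AE x in N. f x = g x"
  shows "ereal_integral N f = ereal_integral N g"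
proof -
  have "(\<integral>\<^sup>+x. e2ennreal (f x) \<partial>N) = (\<integral>\<^sup>+x. e2ennreal (g x) \<partial>N)"
    by (rule nn_integral_cong_AE) (use assms in eventually_elim, simp)
  moreover have "(\<integral>\<^sup>+x. e2ennreal (- f x) \<partial>N) = (\<integral>\<^sup>+x. e2ennreal (- g x) \<partial>N)"
    by (rule nn_integral_cong_AE) (use assms in eventually_elim, simp)
  ultimately show ?thesis by (simp add: ereal_integral_def)
qed

text \<open>\<open>P\<close> and \<open>N\<close> stand for the integrals of the positive and the
  negative part of the cost of one path. A finite bound on \<open>N\<close> excludes the difference
  of two infinities and limits what subtraction can take away from \<open>P\<close>.\<close>

lemma ennreal_diff_bounds:
  fixes P N :: ennreal
  assumes "N \<le> ennreal G" "0 \<le> G"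
  shows "P \<le> e2ennreal (enn2ereal P - enn2ereal N) + ennreal G"
    and "e2ennreal (- (enn2ereal P - enn2ereal N)) \<le> ennreal G"
proof -
  have "N \<noteq> \<top>" using assms(1) by (auto simp: top_unique)
  then obtain n where n: "0 \<le> n" "N = ennreal n" by (cases N) auto
  have nG: "n \<le> G" using assms n by (simp add: ennreal_le_iff)
  have "P \<le> e2ennreal (enn2ereal P - enn2ereal N) + ennreal G \<and> e2ennreal (- (enn2ereal P - enn2ereal N)) \<le> ennreal G"
  proof (cases P)
    case (real p)
    have "ennreal p \<le> ennreal (p - n) + ennreal G"
    proof (cases "n \<le> p")
      case True
      then have "ennreal (p - n) + ennreal G = ennreal (p - n + G)" using assms by (simp add: ennreal_plus[symmetric] del: ennreal_plus)
      then show ?thesis using nG by (auto intro: ennreal_leI)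
    next
      case False
      then have "ennreal p \<le> ennreal G" using nG by (intro ennreal_leI) auto
      then show ?thesis using False by (simp add: ennreal_neg)
    qed
    moreover have "ennreal (- (p - n)) \<le> ennreal G" using nG real by (intro ennreal_leI) auto
    ultimately show ?thesis using real n by (simp add: enn2ereal_ennreal)
  next
    case top
    then show ?thesis using n by (simp add: enn2ereal_ennreal e2ennreal_neg)
  qed
  then show "P \<le> e2ennreal (enn2ereal P - enn2ereal N) + ennreal G"
    and "e2ennreal (- (enn2ereal P - enn2ereal N)) \<le> ennreal G" by auto
qed

context cont_brownian begin

text \<open>The nested extended integrals are resolved by a dichotomy on the mean discounted energy
  \<open>Q\<close>: if it is finite, the cost is an ordinary integral over the product space; if it
  is infinite, so is the cost, because the bounded part \<open>c\<close> cannot compensate for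
  it.\<close>

lemma discounted_cost:
  fixes q c R :: "real \<Rightarrow> 'w \<Rightarrow> real"
  assumes q: "(\<lambda>(u, \<omega>). q u \<omega>) \<in> borel_measurable (lborel \<Otimes>\<^sub>M M)" "\<And>u \<omega>. 0 \<le> q u \<omega>"
    and c: "(\<lambda>(u, \<omega>). c u \<omega>) \<in> borel_measurable (lborel \<Otimes>\<^sub>M M)" "\<And>u \<omega>. \<bar>c u \<omega>\<bar> \<le> g u"
    and g: "g \<in> borel_measurable borel" "(\<integral>\<^sup>+u. ennreal (g u) \<partial>lborel) \<le> ennreal G" "0 \<le> G"
    and R: "\<And>u \<omega>. 0 \<le> u \<Longrightarrow> R u \<omega> = q u \<omega> + c u \<omega>" "\<And>u \<omega>. u < 0 \<Longrightarrow> q u \<omega> + c u \<omega> = 0"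
  defines "J \<equiv> ereal_integral M (\<lambda>\<omega>. ereal_integral (restrict_space lborel {0..}) (\<lambda>u. ereal (R u \<omega>)))"
    and "Q \<equiv> \<integral>\<^sup>+u. \<integral>\<^sup>+\<omega>. ennreal (q u \<omega>) \<partial>M \<partial>lborel"
  shows "Q < \<infinity> \<Longrightarrow> integrable (lborel \<Otimes>\<^sub>M M) (\<lambda>(u, \<omega>). q u \<omega> + c u \<omega>)"
    and "Q < \<infinity> \<Longrightarrow> J = ereal (\<integral>p. (case p of (u, \<omega>) \<Rightarrow> q u \<omega> + c u \<omega>) \<partial>(lborel \<Otimes>\<^sub>M M))"
    and "Q = \<infinity> \<Longrightarrow> J = \<infinity>"
proof -
  note [measurable] = q(1) c(1) g(1)
  define P where "P \<omega> = (\<integral>\<^sup>+u. ennreal (q u \<omega> + c u \<omega>) \<partial>lborel)" for \<omega>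
  define N where "N \<omega> = (\<integral>\<^sup>+u. ennreal (- (q u \<omega> + c u \<omega>)) \<partial>lborel)" for \<omega>
  have inner: "ereal_integral (restrict_space lborel {0..}) (\<lambda>u. ereal (R u \<omega>)) = enn2ereal (P \<omega>) - enn2ereal (N \<omega>)" for \<omega>
  proof -
    have "(\<integral>\<^sup>+u. e2ennreal (ereal (R u \<omega>)) \<partial>restrict_space lborel {0..}) = P \<omega>"
      unfolding P_def by (subst nn_integral_restrict_space) (auto intro!: nn_integral_cong simp: indicator_def R)
    moreover have "(\<integral>\<^sup>+u. e2ennreal (- ereal (R u \<omega>)) \<partial>restrict_space lborel {0..}) = N \<omega>"
      unfolding N_def
    proof (subst nn_integral_restrict_space)
      show "(\<integral>\<^sup>+u. e2ennreal (- ereal (R u \<omega>)) * indicator {0..} u \<partial>lborel) = (\<integral>\<^sup>+u. ennreal (- (q u \<omega> + c u \<omega>)) \<partial>lborel)"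
      proof (rule nn_integral_cong)
        fix u show "e2ennreal (- ereal (R u \<omega>)) * indicator {0..} u = ennreal (- (q u \<omega> + c u \<omega>))"
          using R(1)[of u \<omega>] R(2)[of u \<omega>] by (cases "0 \<le> u") (auto simp del: minus_add_distrib)
      qed
    qed simp
    ultimately show ?thesis by (simp add: ereal_integral_def)
  qed
  have J: "J = ereal_integral M (\<lambda>\<omega>. enn2ereal (P \<omega>) - enn2ereal (N \<omega>))" unfolding J_def inner ..
  have g0: "0 \<le> g u" for u using c(2)[of u undefined] abs_ge_zero order_trans by blast
  have Pm [measurable]: "P \<in> borel_measurable M" and Nm [measurable]: "N \<in> borel_measurable M"
    unfolding P_def[abs_def] N_def[abs_def] by measurable
  \<comment> \<open>The energy part is nonnegative, so only \<open>c\<close> can contribute to the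
    negative part, and its dominating function \<open>g\<close> does not depend on the path.\<close>
  have NG: "N \<omega> \<le> ennreal G" for \<omega>
  proof -
    have "N \<omega> \<le> (\<integral>\<^sup>+u. ennreal (g u) \<partial>lborel)"
      unfolding N_def by (intro nn_integral_mono ennreal_leI) (use q(2) c(2) in \<open>smt (verit)\<close>)
    then show ?thesis using g(2) by (rule order_trans)
  qed
  {
    assume fin: "Q < \<infinity>"
    have qm: "(\<lambda>p. q (fst p) (snd p)) \<in> borel_measurable (lborel \<Otimes>\<^sub>M M)" using q(1) unfolding case_prod_unfold .
    have gm: "(\<lambda>p. g (fst p)) \<in> borel_measurable (lborel \<Otimes>\<^sub>M M)" by measurable
    obtain d where d: "0 \<le> d" "Q = ennreal d" using fin by (cases Q) auto
    have iq: "integrable (lborel \<Otimes>\<^sub>M M) (\<lambda>p. q (fst p) (snd p))"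
      by (rule nonneg_fubini(1)[OF qm, of d]) (use q(2) d in \<open>auto simp: Q_def\<close>)
    have ig: "integrable (lborel \<Otimes>\<^sub>M M) (\<lambda>p. g (fst p))"
      by (rule nonneg_fubini(1)[OF gm, of G]) (use g g0 in \<open>auto simp: emeasure_space_1\<close>)
    have ic: "integrable (lborel \<Otimes>\<^sub>M M) (\<lambda>p. c (fst p) (snd p))"
      by (rule Bochner_Integration.integrable_bound[OF ig]) (use c g0 in \<open>auto simp: case_prod_unfold\<close>)
    show i: "integrable (lborel \<Otimes>\<^sub>M M) (\<lambda>(u, \<omega>). q u \<omega> + c u \<omega>)"
      using Bochner_Integration.integrable_add[OF iq ic] by (simp add: case_prod_unfold)
    have "AE \<omega> in M. enn2ereal (P \<omega>) - enn2ereal (N \<omega>) = ereal (\<integral>u. q u \<omega> + c u \<omega> \<partial>lborel)"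
      using T.AE_integrable_snd[OF i] by eventually_elim (simp only: P_def N_def enn2ereal_nn_integral_diff)
    then have "J = ereal_integral M (\<lambda>\<omega>. ereal (\<integral>u. q u \<omega> + c u \<omega> \<partial>lborel))"
      unfolding J by (rule ereal_integral_cong_AE)
    also have "\<dots> = ereal (\<integral>\<omega>. (\<integral>u. q u \<omega> + c u \<omega> \<partial>lborel) \<partial>M)"
      by (rule ereal_integral_integrable[OF T.integrable_snd[OF i]])
    also have "(\<integral>\<omega>. (\<integral>u. q u \<omega> + c u \<omega> \<partial>lborel) \<partial>M) = (\<integral>p. (case p of (u, \<omega>) \<Rightarrow> q u \<omega> + c u \<omega>) \<partial>(lborel \<Otimes>\<^sub>M M))"
      by (rule T.integral_snd[OF i])
    finally show "J = ereal (\<integral>p. (case p of (u, \<omega>) \<Rightarrow> q u \<omega> + c u \<omega>) \<partial>(lborel \<Otimes>\<^sub>M M))" .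
  }
  {
    assume inf: "Q = \<infinity>"
    define h where "h \<omega> = enn2ereal (P \<omega>) - enn2ereal (N \<omega>)" for \<omega>
    have hm [measurable]: "h \<in> borel_measurable M" unfolding h_def[abs_def] by measurable
    have "Q = (\<integral>\<^sup>+\<omega>. \<integral>\<^sup>+u. ennreal (q u \<omega>) \<partial>lborel \<partial>M)"
      unfolding Q_def by (rule T.Fubini'[symmetric]) (use q(1) in measurable)
    \<comment> \<open>From \<open>q \<le> max 0 (q + c) + g\<close>: infinite mean energy forces an
      infinite mean of the positive parts.\<close>
    also have "\<dots> \<le> (\<integral>\<^sup>+\<omega>. P \<omega> + ennreal G \<partial>M)"
    proof (rule nn_integral_mono)
      fix \<omega> assume "\<omega> \<in> space M"
      then have sm: "(\<lambda>u. q u \<omega>) \<in> borel_measurable borel" "(\<lambda>u. c u \<omega>) \<in> borel_measurable borel"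
        using section_measurable[OF q(1)] section_measurable[OF c(1)] by auto
      have "(\<integral>\<^sup>+u. ennreal (q u \<omega>) \<partial>lborel) \<le> (\<integral>\<^sup>+u. ennreal (q u \<omega> + c u \<omega>) + ennreal (g u) \<partial>lborel)"
      proof (rule nn_integral_mono)
        fix u
        have "ennreal (q u \<omega>) \<le> ennreal (max 0 (q u \<omega> + c u \<omega>) + g u)"
          by (rule ennreal_leI) (use c(2)[of u \<omega>] in \<open>auto simp: max_def abs_le_iff\<close>)
        also have "\<dots> = ennreal (q u \<omega> + c u \<omega>) + ennreal (g u)"
          using g0[of u] by (auto simp: max_def ennreal_neg ennreal_plus)
        finally show "ennreal (q u \<omega>) \<le> ennreal (q u \<omega> + c u \<omega>) + ennreal (g u)" .
      qed
      also have "\<dots> = P \<omega> + (\<integral>\<^sup>+u. ennreal (g u) \<partial>lborel)"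
        unfolding P_def using sm by (intro nn_integral_add) auto
      also have "\<dots> \<le> P \<omega> + ennreal G" using g(2) by (intro add_left_mono)
      finally show "(\<integral>\<^sup>+u. ennreal (q u \<omega>) \<partial>lborel) \<le> P \<omega> + ennreal G" .
    qed
    also have "\<dots> \<le> (\<integral>\<^sup>+\<omega>. (e2ennreal (h \<omega>) + ennreal G) + ennreal G \<partial>M)"
      unfolding h_def by (intro nn_integral_mono add_right_mono ennreal_diff_bounds(1)[OF NG g(3)])
    also have "\<dots> = (\<integral>\<^sup>+\<omega>. e2ennreal (h \<omega>) \<partial>M) + ennreal G + ennreal G"
      by (subst nn_integral_add, simp, simp, subst nn_integral_add) (simp_all add: emeasure_space_1)
    finally have top: "(\<integral>\<^sup>+\<omega>. e2ennreal (h \<omega>) \<partial>M) = \<infinity>" using inf by (auto simp: top_unique)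
    have "(\<integral>\<^sup>+\<omega>. e2ennreal (- h \<omega>) \<partial>M) \<le> (\<integral>\<^sup>+\<omega>. ennreal G \<partial>M)"
      unfolding h_def by (intro nn_integral_mono ennreal_diff_bounds(2)[OF NG g(3)])
    also have "\<dots> = ennreal G" by (simp add: emeasure_space_1)
    finally obtain d where d: "0 \<le> d" "(\<integral>\<^sup>+\<omega>. e2ennreal (- h \<omega>) \<partial>M) = ennreal d"
      by (cases "\<integral>\<^sup>+\<omega>. e2ennreal (- h \<omega>) \<partial>M") (auto simp: top_unique)
    show "J = \<infinity>" unfolding J h_def[symmetric] ereal_integral_def top d(2) using d(1) by (simp add: enn2ereal_ennreal)
  }
qed

lemma nn_integral_discount:
  assumes "\<beta> > 0" "0 \<le> C"
  shows "(\<integral>\<^sup>+u. ennreal (if 0 \<le> u then C * exp (- \<beta> * u) else 0) \<partial>lborel) = ennreal (C / \<beta>)"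
proof -
  have "(\<integral>\<^sup>+u. ennreal (C * exp (- \<beta> * u)) * indicator {0..} u \<partial>lborel) = ennreal (0 - (- (C / \<beta>) * exp (- \<beta> * 0)))"
  proof (rule nn_integral_FTC_atLeast[where F = "\<lambda>u. - (C / \<beta>) * exp (- \<beta> * u)"])
    have "filterlim (\<lambda>u. \<beta> * u) at_top at_top"
      using assms by (intro filterlim_tendsto_pos_mult_at_top[OF tendsto_const _ filterlim_ident]) auto
    then have "((\<lambda>u. exp (- (\<beta> * u))) \<longlongrightarrow> 0) at_top"
      by (intro filterlim_compose[OF exp_at_bot] filterlim_compose[OF filterlim_uminus_at_bot_at_top])
    from tendsto_mult[OF tendsto_const[of "- (C / \<beta>)"] this]
    show "((\<lambda>u. - (C / \<beta>) * exp (- \<beta> * u)) \<longlongrightarrow> 0) at_top" by simp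
    show "DERIV (\<lambda>u. - (C / \<beta>) * exp (- \<beta> * u)) x :> C * exp (- \<beta> * x)" for x
      using assms by (auto intro!: derivative_eq_intros)
  qed (use assms in auto)
  moreover have "ennreal (C * exp (- \<beta> * u)) * indicator {0..} u = ennreal (if 0 \<le> u then C * exp (- \<beta> * u) else 0)" for u :: real
    by (simp add: indicator_def)
  ultimately show ?thesis by simp
qed

text \<open>Completing the square in the Hamilton-Jacobi-Bellman equation shows that the running cost dominates minus the generator
  applied to the discounted value function, with equality for the feedback control.\<close>

lemma verification:
  assumes v: "c21 K v v1 v2" and hjb: "\<And>x. \<sigma>\<^sup>2 / 2 * v2 x = \<beta> * v x + (v1 x)\<^sup>2 / 2 + \<gamma> * cos x"
    and \<beta>: "\<beta> > 0" and \<gamma>: "\<gamma> \<ge> 0"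
    and \<alpha>: "progressive F \<alpha>" and x0: "x0 \<in> borel_measurable (F 0)"
  defines "X \<equiv> \<lambda>t \<omega>. x0 \<omega> + (LINT u:{0..t}|lborel. \<alpha> u \<omega>) + \<sigma> * B t \<omega>"
  defines "J \<equiv> ereal_integral M (\<lambda>\<omega>. ereal_integral (restrict_space lborel {0..})
      (\<lambda>t. ereal (exp (- \<beta> * t) * (- \<gamma> * cos (X t \<omega>) + (\<alpha> t \<omega>)\<^sup>2 / 2))))"
  shows "ereal (\<integral>\<omega>. v (x0 \<omega>) \<partial>M) \<le> J"
    and "(\<And>t \<omega>. 0 \<le> t \<Longrightarrow> \<alpha> t \<omega> = - v1 (X t \<omega>)) \<Longrightarrow> J = ereal (\<integral>\<omega>. v (x0 \<omega>) \<partial>M)"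
proof -
  note K = c21_nonneg[OF v]
  define a where "a u \<omega> = (if 0 \<le> u then \<alpha> u \<omega> else 0)" for u \<omega>
  have am [measurable]: "(\<lambda>(u, \<omega>). a u \<omega>) \<in> borel_measurable (lborel \<Otimes>\<^sub>M M)"
    unfolding a_def by (rule progressive_joint[OF \<alpha>])
  have Xeq: "X t \<omega> = x0 \<omega> + (LINT u:{0..t}|lborel. a u \<omega>) + \<sigma> * B t \<omega>" if "0 \<le> t" for t \<omega>
  proof -
    have "(LINT u:{0..t}|lborel. \<alpha> u \<omega>) = (LINT u:{0..t}|lborel. a u \<omega>)"
      by (rule set_lebesgue_integral_cong) (auto simp: a_def)
    then show ?thesis by (simp add: X_def)
  qed
  have Xad: "X t \<in> borel_measurable (F t)" if t: "0 \<le> t" for t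
  proof -
    note [measurable] = F_mono[OF t x0] progressive_integral_adapted[OF \<alpha> t] B_adapted[OF t]
    show ?thesis unfolding X_def[abs_def] by measurable
  qed
  have X0: "X 0 \<omega> = x0 \<omega>" for \<omega> by (simp add: X_def B_zero set_integral_at_point)
  define Xj where "Xj u \<omega> = (if 0 \<le> u then X u \<omega> else 0)" for u \<omega>
  have Xjm [measurable]: "(\<lambda>(u, \<omega>). Xj u \<omega>) \<in> borel_measurable (lborel \<Otimes>\<^sub>M M)"
  proof -
    note [measurable] = state_joint_measurable[OF am F_into_M[OF order_refl x0], of \<sigma>]
    have "(\<lambda>p. if 0 \<le> fst p then (case p of (u, \<omega>) \<Rightarrow> x0 \<omega> + (LINT v:{0..u}|lborel. a v \<omega>) + \<sigma> * (if 0 \<le> u then B u \<omega> else 0)) else 0)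
        \<in> borel_measurable (lborel \<Otimes>\<^sub>M M)"
      by measurable
    also have "(\<lambda>p. if 0 \<le> fst p then (case p of (u, \<omega>) \<Rightarrow> x0 \<omega> + (LINT v:{0..u}|lborel. a v \<omega>) + \<sigma> * (if 0 \<le> u then B u \<omega> else 0)) else 0)
        = (\<lambda>(u, \<omega>). Xj u \<omega>)"
      by (auto simp: fun_eq_iff Xj_def Xeq)
    finally show ?thesis .
  qed
  define q where "q u \<omega> = (if 0 \<le> u then exp (- \<beta> * u) * ((a u \<omega>)\<^sup>2 / 2) else 0)" for u \<omega>
  define c where "c u \<omega> = (if 0 \<le> u then exp (- \<beta> * u) * (- \<gamma> * cos (Xj u \<omega>)) else 0)" for u \<omega>
  define g where "g u = (if 0 \<le> u then \<gamma> * exp (- \<beta> * u) else 0)" for u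
  have qm: "(\<lambda>(u, \<omega>). q u \<omega>) \<in> borel_measurable (lborel \<Otimes>\<^sub>M M)" unfolding q_def by measurable
  have cm: "(\<lambda>(u, \<omega>). c u \<omega>) \<in> borel_measurable (lborel \<Otimes>\<^sub>M M)" unfolding c_def by measurable
  have gm: "g \<in> borel_measurable borel" unfolding g_def[abs_def] by measurable
  have q0: "0 \<le> q u \<omega>" for u \<omega> by (simp add: q_def)
  have cg: "\<bar>c u \<omega>\<bar> \<le> g u" for u \<omega>
    using mult_left_mono[OF abs_cos_le_one[of "Xj u \<omega>"] \<gamma>] \<gamma> by (auto simp: c_def g_def abs_mult mult.commute)
  have gI: "(\<integral>\<^sup>+u. ennreal (g u) \<partial>lborel) \<le> ennreal (\<gamma> / \<beta>)"
    unfolding g_def nn_integral_discount[OF \<beta> \<gamma>] ..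
  have gG: "0 \<le> \<gamma> / \<beta>" using \<beta> \<gamma> by simp
  have R1: "exp (- \<beta> * u) * (- \<gamma> * cos (X u \<omega>) + (\<alpha> u \<omega>)\<^sup>2 / 2) = q u \<omega> + c u \<omega>" if "0 \<le> u" for u \<omega>
    using that by (simp add: q_def c_def Xj_def a_def algebra_simps)
  have R2: "q u \<omega> + c u \<omega> = 0" if "u < 0" for u \<omega> using that by (simp add: q_def c_def)
  note cost = discounted_cost[where R = "\<lambda>u \<omega>. exp (- \<beta> * u) * (- \<gamma> * cos (X u \<omega>) + (\<alpha> u \<omega>)\<^sup>2 / 2)", OF qm q0 cm cg gm gI gG R1 R2, folded J_def]
  define Q where "Q = (\<integral>\<^sup>+u. \<integral>\<^sup>+\<omega>. ennreal (q u \<omega>) \<partial>M \<partial>lborel)"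
  define r where "r = (\<lambda>(u, \<omega>). q u \<omega> + c u \<omega>)"
  \<comment> \<open>The formula of Ito needs a control of finite energy on bounded intervals, so the
    value function is compared with the cost under this restriction; infinite energy is settled
    afterwards by the dichotomy.\<close>
  have main: "\<bar>(\<integral>\<omega>. v (x0 \<omega>) \<partial>M)\<bar> \<le> K \<and> (\<integral>\<omega>. v (x0 \<omega>) \<partial>M) \<le> (\<integral>p. r p \<partial>(lborel \<Otimes>\<^sub>M M))
      \<and> ((\<forall>t \<omega>. 0 \<le> t \<longrightarrow> \<alpha> t \<omega> = - v1 (X t \<omega>)) \<longrightarrow> (\<integral>p. r p \<partial>(lborel \<Otimes>\<^sub>M M)) = (\<integral>\<omega>. v (x0 \<omega>) \<partial>M))"
    if fin: "Q < \<infinity>"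
  proof -
    have ir: "integrable (lborel \<Otimes>\<^sub>M M) r" using cost(1) fin unfolding r_def Q_def by blast
    have rm [measurable]: "r \<in> borel_measurable (lborel \<Otimes>\<^sub>M M)" using ir by auto
    \<comment> \<open>On a bounded interval the discount factor is at least
      \<open>exp (- \<beta> * T)\<close>, so finite discounted energy controls the plain energy
      there.\<close>
    have energy: "(\<integral>\<^sup>+u. \<integral>\<^sup>+\<omega>. ennreal (indicator {0..T} u * (a u \<omega>)\<^sup>2) \<partial>M \<partial>lborel) < \<infinity>" for T
    proof -
      have "(\<integral>\<^sup>+u. \<integral>\<^sup>+\<omega>. ennreal (indicator {0..T} u * (a u \<omega>)\<^sup>2) \<partial>M \<partial>lborel)
          \<le> (\<integral>\<^sup>+u. \<integral>\<^sup>+\<omega>. ennreal (2 * exp (\<beta> * T)) * ennreal (q u \<omega>) \<partial>M \<partial>lborel)"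
      proof (intro nn_integral_mono)
        fix u \<omega>
        have "indicator {0..T} u * (a u \<omega>)\<^sup>2 \<le> 2 * exp (\<beta> * T) * q u \<omega>"
        proof (cases "u \<in> {0..T}")
          case True
          have "1 \<le> exp (\<beta> * T) * exp (- \<beta> * u)"
            using True \<beta> by (simp add: exp_add[symmetric] mult_left_mono)
          then have "1 * (a u \<omega>)\<^sup>2 \<le> (exp (\<beta> * T) * exp (- \<beta> * u)) * (a u \<omega>)\<^sup>2" by (intro mult_right_mono) auto
          then show ?thesis using True by (simp add: q_def mult_ac)
        qed (simp add: q0)
        then show "ennreal (indicator {0..T} u * (a u \<omega>)\<^sup>2) \<le> ennreal (2 * exp (\<beta> * T)) * ennreal (q u \<omega>)"
          using q0[of u \<omega>] by (simp add: ennreal_mult'[symmetric] ennreal_leI)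
      qed
      also have "\<dots> = ennreal (2 * exp (\<beta> * T)) * Q"
        unfolding Q_def using qm by (simp add: nn_integral_cmult)
      also have "\<dots> < \<infinity>" using fin by (simp add: ennreal_mult_less_top)
      finally show ?thesis .
    qed
    note ito = ito_expectation[OF v less_imp_le[OF \<beta>] am Xeq Xad energy]
    let ?gen = "\<lambda>u \<omega>. ito_gen \<beta> \<sigma> v v1 v2 u (X u \<omega>) (a u \<omega>)"
    have gen: "?gen u \<omega> = exp (- \<beta> * u) * ((v1 (X u \<omega>) + a u \<omega>)\<^sup>2 / 2) - r (u, \<omega>)" if "0 \<le> u" for u \<omega>
    proof -
      have "?gen u \<omega> = exp (- \<beta> * u) * (v1 (X u \<omega>) * a u \<omega> + ((v1 (X u \<omega>))\<^sup>2 / 2 + \<gamma> * cos (X u \<omega>)))"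
        unfolding ito_gen_def hjb by simp
      also have "v1 (X u \<omega>) * a u \<omega> + ((v1 (X u \<omega>))\<^sup>2 / 2 + \<gamma> * cos (X u \<omega>))
          = (v1 (X u \<omega>) + a u \<omega>)\<^sup>2 / 2 - ((a u \<omega>)\<^sup>2 / 2 + - \<gamma> * cos (X u \<omega>))"
        by (simp add: power2_sum add_divide_distrib)
      finally show ?thesis using that by (simp add: r_def q_def c_def Xj_def distrib_left right_diff_distrib)
    qed
    have lim: "(\<lambda>n. \<integral>p. indicator {0..real n} (fst p) *\<^sub>R r p \<partial>(lborel \<Otimes>\<^sub>M M)) \<longlonglongrightarrow> (\<integral>p. r p \<partial>(lborel \<Otimes>\<^sub>M M))"
    proof (rule integral_dominated_convergence[where w = "\<lambda>p. \<bar>r p\<bar>"])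
      show "AE p in lborel \<Otimes>\<^sub>M M. (\<lambda>n. indicator {0..real n} (fst p) *\<^sub>R r p) \<longlonglongrightarrow> r p"
      proof (rule AE_I2)
        fix p :: "real \<times> 'w"
        obtain u \<omega> where p: "p = (u, \<omega>)" by (cases p)
        show "(\<lambda>n. indicator {0..real n} (fst p) *\<^sub>R r p) \<longlonglongrightarrow> r p"
        proof (cases "0 \<le> u")
          case True
          have "\<forall>\<^sub>F n in sequentially. indicator {0..real n} (fst p) *\<^sub>R r p = r p"
            using eventually_ge_at_top[of "nat \<lceil>u\<rceil>"]
          proof eventually_elim
            case (elim n)
            then have "u \<le> real n" by linarith
            then show ?case using True p by simp
          qed
          then show ?thesis by (rule tendsto_eventually)
        next
          case False
          then show ?thesis by (simp add: p r_def R2)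
        qed
      qed
      show "AE p in lborel \<Otimes>\<^sub>M M. norm (indicator {0..real n} (fst p) *\<^sub>R r p) \<le> \<bar>r p\<bar>" for n
        by (auto simp: indicator_def)
    qed (use ir in auto)
    have irn: "integrable (lborel \<Otimes>\<^sub>M M) (\<lambda>p. indicator {0..T} (fst p) *\<^sub>R r p)" for T
      by (rule Bochner_Integration.integrable_bound[OF ir]) (auto simp: indicator_def)
    have vX: "\<bar>\<integral>\<omega>. v (X t \<omega>) \<partial>M\<bar> \<le> K" if "0 \<le> t" for t
      by (rule abs_integral_le_const[OF measurable_compose[OF F_into_M[OF that Xad[OF that]] c21_measurable(1)[OF v]] c21D(3)[OF v]])
    have gI: "(\<integral>p. (case p of (u, \<omega>) \<Rightarrow> indicator {0..real n} u *\<^sub>R ?gen u \<omega>) \<partial>(lborel \<Otimes>\<^sub>M M))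
        = exp (- \<beta> * real n) * (\<integral>\<omega>. v (X (real n) \<omega>) \<partial>M) - (\<integral>\<omega>. v (x0 \<omega>) \<partial>M)" for n
      using T.integral_snd[OF ito(1)[of "real n"]] ito(2)[of "real n"] by (simp add: X0 set_lebesgue_integral_def)
    \<comment> \<open>Transversality at infinity: the value function is bounded, so discounting
      alone removes the terminal term.\<close>
    have decay: "(\<lambda>n. exp (- \<beta> * real n) * (\<integral>\<omega>. v (X (real n) \<omega>) \<partial>M)) \<longlonglongrightarrow> 0"
    proof (rule Lim_null_comparison)
      show "\<forall>\<^sub>F n in sequentially. norm (exp (- \<beta> * real n) * (\<integral>\<omega>. v (X (real n) \<omega>) \<partial>M)) \<le> K * exp (- \<beta>) ^ n"
        by (rule always_eventually) (auto simp: abs_mult mult.commute exp_of_nat_mult[symmetric] intro!: mult_right_mono vX)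
      have "(\<lambda>n. K * exp (- \<beta>) ^ n) \<longlonglongrightarrow> K * 0"
        using \<beta> by (intro tendsto_mult tendsto_const LIMSEQ_power_zero) auto
      then show "(\<lambda>n. K * exp (- \<beta>) ^ n) \<longlonglongrightarrow> 0" by simp
    qed
    have decay': "(\<lambda>n. (\<integral>\<omega>. v (x0 \<omega>) \<partial>M) - exp (- \<beta> * real n) * (\<integral>\<omega>. v (X (real n) \<omega>) \<partial>M)) \<longlonglongrightarrow> (\<integral>\<omega>. v (x0 \<omega>) \<partial>M)"
      using tendsto_diff[OF tendsto_const decay] by simp
    \<comment> \<open>The inequality enters here, by dropping the nonnegative square in
      \<open>gen\<close>. For the feedback control the square vanishes and equality holds.\<close>
    have neg: "- (case p of (u, \<omega>) \<Rightarrow> indicator {0..T} u *\<^sub>R ?gen u \<omega>) \<le> indicator {0..T} (fst p) *\<^sub>R r p" for p T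
      by (cases p) (auto simp: indicator_def gen)
    have le: "(\<integral>\<omega>. v (x0 \<omega>) \<partial>M) - exp (- \<beta> * real n) * (\<integral>\<omega>. v (X (real n) \<omega>) \<partial>M)
        \<le> (\<integral>p. indicator {0..real n} (fst p) *\<^sub>R r p \<partial>(lborel \<Otimes>\<^sub>M M))" for n
    proof -
      have "(\<integral>p. - (case p of (u, \<omega>) \<Rightarrow> indicator {0..real n} u *\<^sub>R ?gen u \<omega>) \<partial>(lborel \<Otimes>\<^sub>M M))
          \<le> (\<integral>p. indicator {0..real n} (fst p) *\<^sub>R r p \<partial>(lborel \<Otimes>\<^sub>M M))"
        by (rule integral_mono[OF Bochner_Integration.integrable_minus[OF ito(1)] irn neg]) simp_all
      then show ?thesis using gI[of n] by simp
    qed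
    have "(\<integral>\<omega>. v (x0 \<omega>) \<partial>M) \<le> (\<integral>p. r p \<partial>(lborel \<Otimes>\<^sub>M M))"
      by (rule LIMSEQ_le[OF decay' lim]) (use le in blast)
    moreover have "(\<integral>p. r p \<partial>(lborel \<Otimes>\<^sub>M M)) = (\<integral>\<omega>. v (x0 \<omega>) \<partial>M)"
      if opt: "\<forall>t \<omega>. 0 \<le> t \<longrightarrow> \<alpha> t \<omega> = - v1 (X t \<omega>)"
    proof -
      have "- (case p of (u, \<omega>) \<Rightarrow> indicator {0..T} u *\<^sub>R ?gen u \<omega>) = indicator {0..T} (fst p) *\<^sub>R r p" for p T
      proof (cases p)
        case (Pair u \<omega>)
        show ?thesis
        proof (cases "u \<in> {0..T}")
          case True
          then have "a u \<omega> = - v1 (X u \<omega>)" using opt by (simp add: a_def)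
          then have "?gen u \<omega> = - r (u, \<omega>)" using gen[of u \<omega>] True by simp
          then show ?thesis using Pair True by simp
        qed (simp add: Pair)
      qed
      then have "(\<integral>p. indicator {0..real n} (fst p) *\<^sub>R r p \<partial>(lborel \<Otimes>\<^sub>M M))
          = (\<integral>p. - (case p of (u, \<omega>) \<Rightarrow> indicator {0..real n} u *\<^sub>R ?gen u \<omega>) \<partial>(lborel \<Otimes>\<^sub>M M))" for n by simp
      then have "(\<integral>p. indicator {0..real n} (fst p) *\<^sub>R r p \<partial>(lborel \<Otimes>\<^sub>M M))
          = (\<integral>\<omega>. v (x0 \<omega>) \<partial>M) - exp (- \<beta> * real n) * (\<integral>\<omega>. v (X (real n) \<omega>) \<partial>M)" for n using gI[of n] by simp
      then show ?thesis using LIMSEQ_unique[OF lim] decay' by simp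
    qed
    ultimately show ?thesis using vX[of 0] by (simp add: X0)
  qed
  show "ereal (\<integral>\<omega>. v (x0 \<omega>) \<partial>M) \<le> J"
  proof (cases "Q = \<infinity>")
    case True then show ?thesis using cost(3) by (simp add: Q_def)
  next
    case False
    then have fin: "Q < \<infinity>" by (simp add: less_top)
    show ?thesis using main[OF fin] cost(2) fin unfolding r_def Q_def by simp
  qed
  assume opt: "\<And>t \<omega>. 0 \<le> t \<Longrightarrow> \<alpha> t \<omega> = - v1 (X t \<omega>)"
  \<comment> \<open>The feedback is bounded by \<open>K\<close>, hence of finite discounted energy,
    and the equality case of \<open>main\<close> applies to it.\<close>
  have "Q \<le> (\<integral>\<^sup>+u. \<integral>\<^sup>+\<omega>. ennreal (if 0 \<le> u then K\<^sup>2 / 2 * exp (- \<beta> * u) else 0) \<partial>M \<partial>lborel)"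
    unfolding Q_def
  proof (intro nn_integral_mono ennreal_leI)
    fix u \<omega>
    have "(v1 (X u \<omega>))\<^sup>2 \<le> K\<^sup>2" using power_mono[OF c21D(4)[OF v, of "X u \<omega>"], of 2] by simp
    then show "q u \<omega> \<le> (if 0 \<le> u then K\<^sup>2 / 2 * exp (- \<beta> * u) else 0)"
      using opt by (auto simp: q_def a_def)
  qed
  also have "\<dots> = (\<integral>\<^sup>+u. ennreal (if 0 \<le> u then K\<^sup>2 / 2 * exp (- \<beta> * u) else 0) \<partial>lborel)"
    by (simp add: emeasure_space_1)
  also have "\<dots> = ennreal (K\<^sup>2 / 2 / \<beta>)" by (rule nn_integral_discount[OF \<beta>]) simp
  also have "\<dots> < \<infinity>" by simp
  finally have fin: "Q < \<infinity>" .
  then show "J = ereal (\<integral>\<omega>. v (x0 \<omega>) \<partial>M)" using main[OF fin] cost(2) opt unfolding r_def Q_def by simp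
qed

end

section \<open>Invariant measure and self-consistency\<close>

text \<open>Periodicity turns continuity into boundedness, and a bounded third derivative makes the
  second one Lipschitz.\<close>

lemma per_c3_bounded:
  fixes f :: "real \<Rightarrow> real"
  assumes "per f" "\<And>x. (f has_real_derivative f1 x) (at x)" "\<And>x. (f1 has_real_derivative f2 x) (at x)"
    "\<And>x. (f2 has_real_derivative f3 x) (at x)" "continuous_on UNIV f3"
  obtains K where "c21 K f f1 f2"
proof -
  have p1: "per f1" by (rule per_deriv[OF assms(1,2)])
  have p2: "per f2" by (rule per_deriv[OF p1 assms(3)])
  have p3: "per f3" by (rule per_deriv[OF p2 assms(4)])
  note c = DERIV_continuous_on[OF has_field_derivative_at_within]
  obtain C0 where C0: "\<And>x. \<bar>f x\<bar> \<le> C0" using per_cont_bounded[OF assms(1) c[OF assms(2)]] by blast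
  obtain C1 where C1: "\<And>x. \<bar>f1 x\<bar> \<le> C1" using per_cont_bounded[OF p1 c[OF assms(3)]] by blast
  obtain C2 where C2: "\<And>x. \<bar>f2 x\<bar> \<le> C2" using per_cont_bounded[OF p2 c[OF assms(4)]] by blast
  obtain C3 where C3: "\<And>x. \<bar>f3 x\<bar> \<le> C3" using per_cont_bounded[OF p3 assms(5)] by blast
  define K where "K = max (max C0 C1) (max C2 C3)"
  have "\<bar>f3 x\<bar> \<le> K" for x using C3[of x] by (auto simp: K_def max_def split: if_splits)
  then have l: "\<bar>f2 x - f2 y\<bar> \<le> K * \<bar>x - y\<bar>" for x y by (rule bounded_deriv_lipschitz[OF assms(4)])
  have "\<bar>f x\<bar> \<le> K" "\<bar>f1 x\<bar> \<le> K" "\<bar>f2 x\<bar> \<le> K" for x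
    unfolding K_def using C0[of x] C1[of x] C2[of x] by linarith+
  then have "c21 K f f1 f2" unfolding c21_def using assms(2,3) l by blast
  then show thesis by (rule that)
qed

text \<open>Bootstrapping: the equation expresses the second derivative through \<open>v\<close> and
  \<open>v1\<close>, so it can be differentiated again. The drift \<open>- v1\<close> has to belong
  to the test class itself, which takes four continuous derivatives of \<open>v\<close>.\<close>

lemma hjb_regular:
  assumes h: "hjb \<beta> k (\<lambda>x. \<gamma> * cos x) v v1"
  defines "v2 \<equiv> \<lambda>x. k * (\<beta> * v x + (v1 x)\<^sup>2 / 2 + \<gamma> * cos x)"
  obtains K L b1 b2 where "c21 K v v1 v2" "c21 L (\<lambda>x. - v1 x) b1 b2" "per v1"
proof -
  have p: "per v" and d: "\<And>x. (v has_real_derivative v1 x) (at x)" and d1: "\<And>x. (v1 has_real_derivative v2 x) (at x)"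
    using h by (auto simp: hjb_def v2_def)
  have p1: "per v1" by (rule per_deriv[OF p d])
  define v3 where "v3 x = k * (\<beta> * v1 x + v1 x * v2 x - \<gamma> * sin x)" for x
  define v4 where "v4 x = k * (\<beta> * v2 x + (v2 x * v2 x + v1 x * v3 x) - \<gamma> * cos x)" for x
  have d2: "(v2 has_real_derivative v3 x) (at x)" for x
    unfolding v2_def v3_def by (auto intro!: derivative_eq_intros d d1[unfolded v2_def] simp: v2_def)
  have d3: "(v3 has_real_derivative v4 x) (at x)" for x
    unfolding v3_def[abs_def] v4_def by (auto intro!: derivative_eq_intros d d1 d2 simp: v3_def mult.commute)
  note c = DERIV_continuous_on[OF has_field_derivative_at_within]
  have c0: "continuous_on UNIV v" "continuous_on UNIV v1" "continuous_on UNIV v2" "continuous_on UNIV v3"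
    by (rule c[OF d] c[OF d1] c[OF d2] c[OF d3])+
  have c4: "continuous_on UNIV v4" unfolding v4_def[abs_def] by (intro continuous_intros c0)
  obtain K where K: "c21 K v v1 v2" by (rule per_c3_bounded[OF p d d1 d2 c0(4)])
  have p1': "per (\<lambda>x. - v1 x)" using p1 by (simp add: per_def)
  obtain L where "c21 L (\<lambda>x. - v1 x) (\<lambda>x. - v2 x) (\<lambda>x. - v3 x)"
    by (rule per_c3_bounded[OF p1' DERIV_minus[OF d1] DERIV_minus[OF d2] DERIV_minus[OF d3] continuous_on_minus[OF c4]])
  from that[OF K this p1] show thesis .
qed

text \<open>A law on the line carried by one period, so that calculus applies directly; the
  stationary law is its image on the torus.\<close>

definition gibbs :: "real \<Rightarrow> (real \<Rightarrow> real) \<Rightarrow> real measure" where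
  "gibbs k v = density lborel (\<lambda>x. ennreal (indicator {-pi..pi} x * exp (- k * v x) / integral {-pi..pi} (\<lambda>x. exp (- k * v x))))"

lemma gibbs_props:
  fixes v :: "real \<Rightarrow> real" and k :: real
  assumes v: "continuous_on UNIV v"
  defines "Z \<equiv> integral {-pi..pi} (\<lambda>x. exp (- k * v x))"
  shows "0 < Z" "prob_space (gibbs k v)" "sets (gibbs k v) = sets borel"
    "\<And>g. continuous_on UNIV g \<Longrightarrow> (\<integral>x. g x \<partial>gibbs k v) = integral {-pi..pi} (\<lambda>x. g x * exp (- k * v x)) / Z"
proof -
  let ?p = "\<lambda>x. exp (- k * v x)"
  have pc: "continuous_on S ?p" for S by (intro continuous_intros continuous_on_subset[OF v]) auto
  have [measurable]: "v \<in> borel_measurable borel" using v by (rule borel_measurable_continuous_onI)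
  have pm [measurable]: "?p \<in> borel_measurable borel" using pc by (rule borel_measurable_continuous_onI)
  have si: "set_integrable lborel {-pi..pi} (\<lambda>x. g x * ?p x)" if "continuous_on UNIV g" for g :: "real \<Rightarrow> real"
    by (intro borel_integrable_atLeastAtMost' continuous_intros continuous_on_subset[OF that] pc) auto
  have ip: "set_integrable lborel {-pi..pi} ?p" using si[of "\<lambda>x. 1"] by simp
  show Z: "0 < Z"
  proof -
    have "integral {-pi..pi} (\<lambda>x. 0 :: real) < Z"
      unfolding Z_def by (rule integral_less_real[OF continuous_on_const pc]) (insert pi_gt_zero, auto simp del: pi_gt_zero)
    then show ?thesis by simp
  qed
  show "sets (gibbs k v) = sets borel" by (simp add: gibbs_def)
  have LZ: "(\<integral>x. indicator {-pi..pi} x * ?p x \<partial>lborel) = Z"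
    using set_borel_integral_eq_integral(2)[OF ip] by (simp add: set_lebesgue_integral_def Z_def)
  have i: "integrable lborel (\<lambda>x. indicator {-pi..pi} x * ?p x / Z)"
    using ip by (simp add: set_integrable_def)
  have "emeasure (gibbs k v) UNIV = (\<integral>\<^sup>+x. ennreal (indicator {-pi..pi} x * ?p x / Z) \<partial>lborel)"
    unfolding gibbs_def Z_def[symmetric] by (subst emeasure_density) auto
  also have "\<dots> = ennreal (\<integral>x. indicator {-pi..pi} x * ?p x / Z \<partial>lborel)"
    by (rule nn_integral_eq_integral[OF i]) (use Z in auto)
  also have "\<dots> = 1" using LZ Z by simp
  finally show "prob_space (gibbs k v)" by (intro prob_spaceI) (simp add: gibbs_def)
  fix g :: "real \<Rightarrow> real" assume g: "continuous_on UNIV g"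
  have [measurable]: "g \<in> borel_measurable borel" using g by (rule borel_measurable_continuous_onI)
  have "(\<integral>x. g x \<partial>gibbs k v) = (\<integral>x. (indicator {-pi..pi} x * ?p x / Z) *\<^sub>R g x \<partial>lborel)"
    unfolding gibbs_def Z_def[symmetric] using Z by (subst integral_density) auto
  also have "\<dots> = (\<integral>x. indicator {-pi..pi} x *\<^sub>R (g x * ?p x) / Z \<partial>lborel)"
    by (rule Bochner_Integration.integral_cong) (auto simp: mult_ac)
  also have "\<dots> = (LINT x:{-pi..pi}|lborel. g x * ?p x) / Z" by (simp add: set_lebesgue_integral_def)
  also have "\<dots> = integral {-pi..pi} (\<lambda>x. g x * ?p x) / Z"
    by (simp only: set_borel_integral_eq_integral(2)[OF si[OF g]])
  finally show "(\<integral>x. g x \<partial>gibbs k v) = integral {-pi..pi} (\<lambda>x. g x * exp (- k * v x)) / Z" .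
qed

text \<open>The density makes the probability flux vanish: the integrand times the density is the
  derivative of \<open>1 / k * exp (- k * v x) * f1 x\<close>, and the boundary terms cancel by
  periodicity.\<close>

lemma gibbs_stationary:
  assumes per: "per v" and v: "\<And>x. (v has_real_derivative v1 x) (at x)" and v1: "continuous_on UNIV v1" and k: "k > 0"
    and f: "c21 K f f1 f2" "per f"
  shows "(\<integral>x. - v1 x * f1 x + 1 / k * f2 x \<partial>gibbs k v) = 0"
proof -
  let ?p = "\<lambda>x. exp (- k * v x)"
  have vc: "continuous_on UNIV v" by (rule DERIV_continuous_on[OF has_field_derivative_at_within[OF v]])
  have pf: "per f1" by (rule per_deriv[OF f(2) c21D(1)[OF f(1)]])
  have gc: "continuous_on UNIV (\<lambda>x. - v1 x * f1 x + 1 / k * f2 x)"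
    by (intro continuous_intros v1 c21_measurable(5,6)[OF f(1)])
  have "((\<lambda>x. (- v1 x * f1 x + 1 / k * f2 x) * ?p x) has_integral 1 / k * (?p pi * f1 pi) - 1 / k * (?p (- pi) * f1 (- pi))) {-pi..pi}"
  proof (rule fundamental_theorem_of_calculus)
    fix x
    have "((\<lambda>x. 1 / k * (?p x * f1 x)) has_real_derivative (- v1 x * f1 x + 1 / k * f2 x) * ?p x) (at x)"
      using k by (auto intro!: derivative_eq_intros v c21D(2)[OF f(1)] simp: field_simps)
    then show "((\<lambda>x. 1 / k * (?p x * f1 x)) has_vector_derivative (- v1 x * f1 x + 1 / k * f2 x) * ?p x) (at x within {-pi..pi})"
      by (simp add: has_real_derivative_iff_has_vector_derivative has_vector_derivative_at_within)
  qed simp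
  moreover have "v pi = v (- pi)" "f1 pi = f1 (- pi)"
    using per pf by (auto simp: per_def dest: spec[of _ "- pi"])
  ultimately have "integral {-pi..pi} (\<lambda>x. (- v1 x * f1 x + 1 / k * f2 x) * ?p x) = 0"
    by (simp add: has_integral_iff)
  then show ?thesis unfolding gibbs_props(4)[OF vc gc] by simp
qed

text \<open>The mean of the cosine separates the two laws: it is 0 here and
  \<open>\<gamma> / \<kappa>\<close>, hence nonzero, for the solution constructed below.\<close>

lemma uniform_torus_cos: "(\<integral>y. cos_torus y \<partial>uniform_torus) = 0"
proof -
  let ?U = "uniform_measure lborel {0..<2 * pi}"
  have "(\<integral>y. cos_torus y \<partial>uniform_torus) = (\<integral>x. cos x \<partial>?U)"
    unfolding uniform_torus_def by (subst integral_distr) (auto simp: measurable_cong_sets[of ?U borel])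
  also have "\<dots> = (\<integral>x. (indicator {0..<2 * pi} x / (2 * pi)) *\<^sub>R cos x \<partial>lborel)"
  proof -
    have "?U = density lborel (\<lambda>x. ennreal (indicator {0..<2 * pi} x / (2 * pi)))"
      unfolding uniform_measure_def
      by (rule density_cong) (auto simp: indicator_def divide_ennreal[symmetric] intro!: AE_I2)
    then show ?thesis by (simp only:) (subst integral_density, auto)
  qed
  also have "\<dots> = (\<integral>x. cos x / (2 * pi) * indicator {0..2 * pi} x \<partial>lborel)"
  proof (rule integral_cong_AE)
    have "AE x in lborel. x \<noteq> 2 * pi" by (rule AE_lborel_singleton)
    then show "AE x in lborel. (indicator {0..<2 * pi} x / (2 * pi)) *\<^sub>R cos x = cos x / (2 * pi) * indicator {0..2 * pi} x"
      by eventually_elim (auto simp: indicator_def)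
  qed auto
  also have "\<dots> = sin (2 * pi) / (2 * pi) - sin 0 / (2 * pi)"
    by (rule integral_FTC_Icc_real) (auto intro!: derivative_eq_intros)
  finally show ?thesis by simp
qed

lemma state_eq: "state \<sigma> B X0 \<alpha> t \<omega> = to_torus (torus_angle (X0 \<omega>) + (LINT u:{0..t}|lborel. \<alpha> u \<omega>) + \<sigma> * B t \<omega>)"
  unfolding state_def using to_torus_plus[of "torus_angle (X0 \<omega>)"] by (simp add: add.assoc)

theorem theorem4p1:
  fixes \<beta> \<sigma> \<kappa> :: real
    and M :: "'w measure" and F :: "real \<Rightarrow> 'w measure" and B :: "real \<Rightarrow> 'w \<Rightarrow> real"
  assumes "brownian_basis M F B"
    and "\<beta> > 0" and "\<sigma> > 0"
    and "\<kappa> > critical_kappa \<beta> \<sigma>"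
  shows "\<exists>\<mu>. stationary_solution \<beta> \<sigma> M F B \<kappa> \<mu> \<and> \<mu> \<noteq> uniform_torus"
proof -
  interpret bb: brownian_basis M F B by fact
  \<comment> \<open>With this choice \<open>1 / k\<close> is the diffusion coefficient
    \<open>\<sigma>\<^sup>2 / 2\<close>, and \<open>2 * (\<beta> + 1 / k)\<close> equals
    \<open>k\<close> times the critical value.\<close>
  define k where "k = 2 / \<sigma>\<^sup>2"
  have k: "k > 0" "1 / k = \<sigma>\<^sup>2 / 2" using assms(3) by (auto simp: k_def)
  have \<kappa>k: "\<kappa> * k > 2 * (\<beta> + 1 / k)"
  proof -
    have "2 * (\<beta> + 1 / k) = critical_kappa \<beta> \<sigma> * k"
      using assms(3) by (simp add: critical_kappa_def k_def field_simps power2_eq_square power4_eq_xxxx)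
    also have "\<dots> < \<kappa> * k" using assms(4) k by simp
    finally show ?thesis .
  qed
  obtain \<gamma> v v1 where \<gamma>: "\<gamma> > 0" and hj: "hjb \<beta> k (\<lambda>x. \<gamma> * cos x) v v1"
    and selfc: "\<kappa> * integral {-pi..pi} (\<lambda>x. cos x * exp (- k * v x)) = \<gamma> * integral {-pi..pi} (\<lambda>x. exp (- k * v x))"
    by (rule hjb_gibbs_selfconsistent[OF assms(2) k(1) \<kappa>k])
  define v2 where "v2 x = k * (\<beta> * v x + (v1 x)\<^sup>2 / 2 + \<gamma> * cos x)" for x
  obtain K L b1 b2 where v: "c21 K v v1 v2" and b: "c21 L (\<lambda>x. - v1 x) b1 b2" and p1: "per v1"
    using hjb_regular[OF hj, folded v2_def] by blast
  have pv: "per v" using hj by (simp add: hjb_def)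
  have pb: "per (\<lambda>x. - v1 x)" using p1 by (simp add: per_def)
  note vc = c21_measurable(4)[OF v] and v1c = c21_measurable(5)[OF v]
  have v2eq: "\<sigma>\<^sup>2 / 2 * v2 x = \<beta> * v x + (v1 x)\<^sup>2 / 2 + \<gamma> * cos x" for x
    unfolding v2_def k(2)[symmetric] using k(1) by simp
  define m where "m = gibbs k v"
  define Z where "Z = integral {-pi..pi} (\<lambda>x. exp (- k * v x))"
  have selfcZ: "\<kappa> * integral {-pi..pi} (\<lambda>x. cos x * exp (- k * v x)) = \<gamma> * Z"
    using selfc by (simp only: Z_def)
  note gp = gibbs_props[OF vc, where k = k, folded m_def Z_def]
  interpret m: prob_space m by (rule gp(2))
  have [measurable_cong]: "sets m = sets borel" by (rule gp(3))
  have stat: "(\<integral>x. - v1 x * f1 x + \<sigma>\<^sup>2 / 2 * f2 x \<partial>m) = 0" if "c21 K f f1 f2" "per f" for K f f1 f2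
    using gibbs_stationary[OF pv c21D(1)[OF v] v1c k(1) that] unfolding m_def k(2) .
  define \<mu> where "\<mu> = distr m borel to_torus"
  have \<mu>: "\<mu> \<in> torus_probs" unfolding torus_probs_def \<mu>_def by (auto intro!: m.prob_space_distr)
  have mcos: "(\<integral>y. cos_torus y \<partial>\<mu>) = \<gamma> / \<kappa>"
  proof -
    have \<kappa>0: "\<kappa> \<noteq> 0" using selfcZ \<gamma> gp(1) by auto
    have "(\<integral>y. cos_torus y \<partial>\<mu>) = (\<integral>x. cos x \<partial>m)" unfolding \<mu>_def by (subst integral_distr) auto
    also have "\<dots> = integral {-pi..pi} (\<lambda>x. cos x * exp (- k * v x)) / Z" by (rule gp(4)) (intro continuous_intros)
    also have "\<dots> = \<gamma> / \<kappa>" using selfcZ gp(1) \<kappa>0 by (simp add: field_simps)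
    finally show ?thesis .
  qed
  have \<kappa>\<gamma>: "\<kappa> * (\<gamma> / \<kappa>) = \<gamma>" using selfcZ \<gamma> gp(1) by auto
  \<comment> \<open>The reflected function solves the same equation, so comparison in both
    directions identifies it with \<open>v\<close>. Evenness removes the sine from the interaction
    cost, which is then exactly the cosine potential that \<open>v\<close> was built for.\<close>
  have even: "v (- x) = v x" for x
  proof -
    have r1: "((\<lambda>x. v (- x)) has_real_derivative - v1 (- x)) (at x)" for x
      using DERIV_reflect[of v "v1 (- x)" 0 x] c21D(1)[OF v, of "- x"] by simp
    have r2: "((\<lambda>x. - v1 (- x)) has_real_derivative v2 (- x)) (at x)" for x
      using DERIV_minus[OF DERIV_reflect[of v1 "v2 (- x)" 0 x]] c21D(2)[OF v, of "- x"] by simp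
    have "per (\<lambda>x. v (- x))" unfolding per_def
    proof
      fix x
      have "v (- x) = v (- x - 2 * pi + 2 * pi)" by simp
      also have "\<dots> = v (- x - 2 * pi)" using pv unfolding per_def by blast
      finally show "v (- (x + 2 * pi)) = v (- x)" by simp
    qed
    then have w: "hjb \<beta> k (\<lambda>x. \<gamma> * cos x) (\<lambda>x. v (- x)) (\<lambda>x. - v1 (- x))"
      unfolding hjb_def using r1 r2 by (simp add: v2_def)
    have "v (- x) - v x \<le> 0 / \<beta>" by (rule hjb_comparison[OF hj w assms(2) k(1)]) simp
    moreover have "v x - v (- x) \<le> 0 / \<beta>" by (rule hjb_comparison[OF w hj assms(2) k(1)]) simp
    ultimately show ?thesis by simp
  qed
  have msin: "(\<integral>y. sin_torus y \<partial>\<mu>) = 0"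
  proof -
    let ?f = "\<lambda>x. sin x * exp (- k * v x)"
    have "integral {-pi..pi} ?f = integral {-pi..- (- pi)} (\<lambda>x. ?f (- x))" using Henstock_Kurzweil_Integration.integral_reflect_real[of pi "-pi" ?f] by simp
    also have "\<dots> = - integral {-pi..pi} ?f" by (simp add: even)
    finally have "integral {-pi..pi} ?f = 0" by simp
    moreover have "(\<integral>y. sin_torus y \<partial>\<mu>) = (\<integral>x. sin x \<partial>m)" unfolding \<mu>_def by (subst integral_distr) auto
    moreover have "(\<integral>x. sin x \<partial>m) = integral {-pi..pi} ?f / Z" by (rule gp(4)) (intro continuous_intros)
    ultimately show ?thesis by simp
  qed
  have cost: "kuramoto_cost \<kappa> (\<lambda>t. \<mu>) t (to_torus x) = - \<gamma> * cos x" for t x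
    unfolding kuramoto_cost_def mcos msin using \<kappa>\<gamma> by simp
  have "\<mu> \<noteq> uniform_torus"
  proof
    assume "\<mu> = uniform_torus"
    then have "\<gamma> / \<kappa> = 0" using mcos uniform_torus_cos by simp
    then show False using \<kappa>\<gamma> \<gamma> by simp
  qed
  moreover have "stationary_solution \<beta> \<sigma> M F B \<kappa> \<mu>"
    unfolding stationary_solution_def kuramoto_solution_def
  proof (intro conjI allI impI, rule \<mu>)
    fix X0 assume X0: "X0 \<in> F 0 \<rightarrow>\<^sub>M borel \<and> distr M borel X0 = \<mu>"
    obtain B' where cb: "cont_brownian M F B'" and BB: "AE \<omega> in M. \<forall>t\<ge>0. B' t \<omega> = B t \<omega>"
      by (rule brownian_basis_cont_version[OF assms(1)])
    interpret c: cont_brownian M F B' by (rule cb)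
    \<comment> \<open>The prescribed state on the torus is lifted to the line. The law of the lift
      is known only up to multiples of \<open>2 * pi\<close>, which is all that periodic test
      functions detect.\<close>
    define x0 where "x0 \<omega> = torus_angle (X0 \<omega>)" for \<omega>
    have x0: "x0 \<in> borel_measurable (F 0)" unfolding x0_def[abs_def]
      using measurable_compose[OF conjunct1[OF X0] measurable_torus_angle] .
    have X0M: "X0 \<in> measurable M borel" using X0 by (intro c.F_into_M[of 0]) auto
    have law0: "(\<integral>\<omega>. g (x0 \<omega>) \<partial>M) = (\<integral>x. g x \<partial>m)" if [measurable]: "g \<in> borel_measurable borel" and g: "per g" for g :: "real \<Rightarrow> real"
    proof -
      have "(\<integral>\<omega>. g (x0 \<omega>) \<partial>M) = (\<integral>y. g (torus_angle y) \<partial>distr M borel X0)"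
        unfolding x0_def using X0M by (subst integral_distr) auto
      also have "\<dots> = (\<integral>x. g (torus_angle (to_torus x)) \<partial>m)"
        using X0 unfolding \<mu>_def by (simp add: integral_distr)
      finally show ?thesis by (simp only: per_torus_angle[OF g])
    qed
    have law0': "(\<integral>\<omega>. g (x0 \<omega>) \<partial>M) = (\<integral>x. g x \<partial>m)"
      if "g \<in> borel_measurable borel" "per g" "\<And>x. \<bar>g x\<bar> \<le> C" for g :: "real \<Rightarrow> real" and C
      by (rule law0[OF that(1,2)])
    obtain X where X: "\<And>\<omega>. continuous_on {0..} (\<lambda>t. X t \<omega>)"
      "\<And>t. 0 \<le> t \<Longrightarrow> X t \<in> borel_measurable (F t)"
      "\<And>t \<omega>. 0 \<le> t \<Longrightarrow> X t \<omega> = x0 \<omega> + (LINT u:{0..t}|lborel. - v1 (X u \<omega>)) + \<sigma> * B' t \<omega>"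
      "\<And>t K f f1 f2. 0 \<le> t \<Longrightarrow> c21 K f f1 f2 \<Longrightarrow> per f \<Longrightarrow> (\<integral>\<omega>. f (X t \<omega>) \<partial>M) = (\<integral>x. f x \<partial>m)"
    proof (rule c.sde_solution[OF b pb x0 gp(2,3) stat law0'])
      fix X
      assume X: "\<And>\<omega>. continuous_on {0..} (\<lambda>t. X t \<omega>)"
      "\<And>t. 0 \<le> t \<Longrightarrow> X t \<in> borel_measurable (F t)"
      "\<And>t \<omega>. 0 \<le> t \<Longrightarrow> X t \<omega> = x0 \<omega> + (LINT u:{0..t}|lborel. - v1 (X u \<omega>)) + \<sigma> * B' t \<omega>"
      "\<And>t K f f1 f2. 0 \<le> t \<Longrightarrow> c21 K f f1 f2 \<Longrightarrow> per f \<Longrightarrow> (\<integral>\<omega>. f (X t \<omega>) \<partial>M) = (\<integral>x. f x \<partial>m)"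
      show thesis by (rule that[OF X])
    qed
    define \<alpha> where "\<alpha> t \<omega> = - v1 (X t \<omega>)" for t \<omega>
    have \<alpha>: "progressive F \<alpha>"
    proof (rule c.progressive_continuous)
      show "continuous_on {0..} (\<lambda>t. \<alpha> t \<omega>)" for \<omega>
        unfolding \<alpha>_def by (rule continuous_on_compose2[OF c21_measurable(4)[OF b] X(1)]) auto
      show "\<alpha> t \<in> borel_measurable (F t)" if "0 \<le> t" for t
        unfolding \<alpha>_def[abs_def] using X(2)[OF that] c21_measurable(2)[OF v] by measurable
    qed
    let ?J = "\<lambda>\<alpha>. ereal_integral M (\<lambda>\<omega>. ereal_integral (restrict_space lborel {0..})
      (\<lambda>t. ereal (exp (- \<beta> * t) * (- \<gamma> * cos (x0 \<omega> + (LINT u:{0..t}|lborel. \<alpha> u \<omega>) + \<sigma> * B' t \<omega>) + (\<alpha> t \<omega>)\<^sup>2 / 2))))"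
    \<comment> \<open>The cost sees the state only through its cosine, so the lift to the line may
      replace the state on the torus; passing to the continuous version of the noise changes the
      inner integral on a null set only.\<close>
    have total: "total_cost \<beta> \<sigma> M B \<kappa> (\<lambda>t. \<mu>) X0 \<alpha> = ?J \<alpha>" for \<alpha>
      unfolding total_cost_def
    proof (rule ereal_integral_cong_AE)
      show "AE \<omega> in M. ereal_integral (restrict_space lborel {0..})
          (\<lambda>t. ereal (exp (- \<beta> * t) * (kuramoto_cost \<kappa> (\<lambda>t. \<mu>) t (state \<sigma> B X0 \<alpha> t \<omega>) + (\<alpha> t \<omega>)\<^sup>2 / 2))) =
        ereal_integral (restrict_space lborel {0..})
          (\<lambda>t. ereal (exp (- \<beta> * t) * (- \<gamma> * cos (x0 \<omega> + (LINT u:{0..t}|lborel. \<alpha> u \<omega>) + \<sigma> * B' t \<omega>) + (\<alpha> t \<omega>)\<^sup>2 / 2)))"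
        using BB
      proof eventually_elim
        case (elim \<omega>)
        show ?case
          by (rule ereal_integral_cong_AE, rule AE_I2)
             (use elim in \<open>simp add: state_eq cost x0_def space_restrict_space\<close>)
      qed
    qed
    have Xa: "\<alpha> t \<omega> = - v1 (x0 \<omega> + (LINT u:{0..t}|lborel. \<alpha> u \<omega>) + \<sigma> * B' t \<omega>)" if "0 \<le> t" for t \<omega>
      using X(3)[OF that, of \<omega>] unfolding \<alpha>_def by simp
    have lower: "ereal (\<integral>\<omega>. v (x0 \<omega>) \<partial>M) \<le> ?J \<alpha>'" if "progressive F \<alpha>'" for \<alpha>'
      by (rule c.verification(1)[OF v v2eq assms(2) less_imp_le[OF \<gamma>] that x0])
    have opt: "?J \<alpha> = ereal (\<integral>\<omega>. v (x0 \<omega>) \<partial>M)"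
      by (rule c.verification(2)[OF v v2eq assms(2) less_imp_le[OF \<gamma>] \<alpha> x0 Xa])
    show "\<exists>\<alpha>. progressive F \<alpha> \<and>
        total_cost \<beta> \<sigma> M B \<kappa> (\<lambda>t. \<mu>) X0 \<alpha> = (INF \<alpha>'\<in>{\<alpha>'. progressive F \<alpha>'}. total_cost \<beta> \<sigma> M B \<kappa> (\<lambda>t. \<mu>) X0 \<alpha>') \<and>
        (\<forall>t\<ge>0. distr M borel (state \<sigma> B X0 \<alpha> t) = \<mu>)"
    proof (intro exI conjI allI impI)
      show "progressive F \<alpha>" by (rule \<alpha>)
      show "total_cost \<beta> \<sigma> M B \<kappa> (\<lambda>t. \<mu>) X0 \<alpha> = (INF \<alpha>'\<in>{\<alpha>'. progressive F \<alpha>'}. total_cost \<beta> \<sigma> M B \<kappa> (\<lambda>t. \<mu>) X0 \<alpha>')"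
      proof (rule antisym)
        show "total_cost \<beta> \<sigma> M B \<kappa> (\<lambda>t. \<mu>) X0 \<alpha> \<le> (INF \<alpha>'\<in>{\<alpha>'. progressive F \<alpha>'}. total_cost \<beta> \<sigma> M B \<kappa> (\<lambda>t. \<mu>) X0 \<alpha>')"
          unfolding total opt by (rule INF_greatest) (use lower in simp)
        show "(INF \<alpha>'\<in>{\<alpha>'. progressive F \<alpha>'}. total_cost \<beta> \<sigma> M B \<kappa> (\<lambda>t. \<mu>) X0 \<alpha>') \<le> total_cost \<beta> \<sigma> M B \<kappa> (\<lambda>t. \<mu>) X0 \<alpha>"
          by (rule INF_lower) (simp add: \<alpha>)
      qed
      fix t :: real assume t: "0 \<le> t"
      have XM: "X t \<in> borel_measurable M" by (rule c.F_into_M[OF t X(2)[OF t]])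
      have "distr M borel (state \<sigma> B X0 \<alpha> t) = distr M borel (\<lambda>\<omega>. to_torus (X t \<omega>))"
      proof (rule distr_cong_AE)
        show "AE \<omega> in M. state \<sigma> B X0 \<alpha> t \<omega> = to_torus (X t \<omega>)"
          using BB by eventually_elim (use X(3)[OF t] t in \<open>simp add: state_eq x0_def \<alpha>_def\<close>)
        show "(\<lambda>\<omega>. to_torus (X t \<omega>)) \<in> measurable M borel" using XM by measurable
        have [measurable]: "B t \<in> borel_measurable M" by (rule c.F_into_M[OF t bb.B_adapted[OF t]])
        have [measurable]: "(\<lambda>\<omega>. LINT u:{0..t}|lborel. \<alpha> u \<omega>) \<in> borel_measurable M"
          by (rule c.F_into_M[OF t c.progressive_integral_adapted[OF \<alpha> t]])
        note [measurable] = X0M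
        show "state \<sigma> B X0 \<alpha> t \<in> measurable M borel"
          unfolding state_eq[abs_def] by measurable
      qed simp_all
      also have "\<dots> = \<mu>"
      \<comment> \<open>The laws are compared on periodic test functions of the class
        \<open>c21\<close>, for which the law of \<open>X t\<close> is known from the Euler
        limit.\<close>
      proof (rule torus_measure_eqI)
        show "prob_space (distr M borel (\<lambda>\<omega>. to_torus (X t \<omega>)))"
          by (rule bb.prob_space_distr) (use XM in measurable)
        show "prob_space \<mu>" "sets \<mu> = sets borel" using \<mu> by (auto simp: torus_probs_def)
        fix K f f1 f2 assume f: "c21 K f f1 f2" "per f"
        note [measurable] = c21_measurable(1)[OF f(1)] XM
        have "(\<integral>y. f (torus_angle y) \<partial>distr M borel (\<lambda>\<omega>. to_torus (X t \<omega>))) = (\<integral>\<omega>. f (X t \<omega>) \<partial>M)"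
          by (subst integral_distr) (auto simp: per_torus_angle[OF f(2)])
        also have "\<dots> = (\<integral>x. f x \<partial>m)" by (rule X(4)[OF t f])
        also have "\<dots> = (\<integral>y. f (torus_angle y) \<partial>\<mu>)"
          unfolding \<mu>_def by (subst integral_distr) (auto simp: per_torus_angle[OF f(2)])
        finally show "(\<integral>y. f (torus_angle y) \<partial>distr M borel (\<lambda>\<omega>. to_torus (X t \<omega>))) = (\<integral>y. f (torus_angle y) \<partial>\<mu>)" .
      qed simp
      finally show "distr M borel (state \<sigma> B X0 \<alpha> t) = \<mu>" .
    qed
  qed
  ultimately show ?thesis by blast
qed

end
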